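(* Let $\mathcal{G}$ be a compact, connected metric graph having at least one Dirichlet vertex (with standard conditions at all other vertices), and let $s=s(\mathcal{G})$ be its girth. Then $$\lambda_1^{\mathrm{D}}(\mathcal{G}) \leq \frac{\pi^2}{s^2}.$$ Equality is attained if and only if $\mathcal{G}$ is an equilateral star graph with $n\geq 2$ edges of length $s/2$ with Dirichlet conditions at all degree-one vertices.
   Context: A compact metric graph $\mathcal{G}=(\mathsf{V},\mathsf{E})$ has finitely many edges, each edge $\mathsf{e}$ being identified with an interval $(0,\ell_{\mathsf{e}})$ of finite length $\ell_{\mathsf{e}}>0$; loops and multiple edges are allowed. The Laplacian on $\mathcal{G}$ acts as $-\frac{d^2}{dx^2}$ on functions that are in $H^2(0,\ell_{\mathsf{e}})$ on each edge and satisfy at each vertex either standard conditions (continuity at the vertex, and the sum over all incident edges of the normal derivatives at the vertex is zero) or Dirichlet conditions (the function vanishes at the vertex). A vertex with Dirichlet conditions is called a Dirichlet vertex. This operator is self-adjoint with discrete spectrum; $\lambda_1^{\mathrm{D}}(\mathcal{G})>0$ denotes its lowest eigenvalue when there is at least one Dirichlet vertex. A cycle in a metric graph is (the image of) a continuous map $\gamma$ from $[0,1]$ to the graph with $\gamma(0)=\gamma(1)$ and $\gamma$ injective on $[0,1)$. Let $\mathcal{G}'$ be the metric graph obtained from $\mathcal{G}$ by identifying (gluing together) all Dirichlet vertices of $\mathcal{G}$. The girth $s(\mathcal{G})$ is the minimum of the total lengths $|\mathfrak{c}|$ over subsets $\mathfrak{c}\subset\mathcal{G}$ that are cycles in $\mathcal{G}'$,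 and is defined to be $0$ if $\mathcal{G}'$ is a tree; in that case the inequality is vacuous (right-hand side read as $+\infty$). A star graph consists of $n$ edges all joined at one common vertex, the other endpoints being distinct degree-one vertices; it is equilateral if all edges have the same length. The case $n=2$ is a Dirichlet interval of length $s$. Conventions: degree-two vertices with standard conditions ("dummy" vertices) may be inserted or suppressed, and a Dirichlet vertex of degree $d$ may be separated into $d$ degree-one Dirichlet vertices, or Dirichlet vertices may be identified, without modifying the operator.
   Formalization: The equality characterization is stated only for graphs that stay connected when Dirichlet vertices are separated into degree-one vertices; otherwise it fails, e.g. for a figure eight of two loops of length s with Dirichlet centre. *)

theory Defs
  imports "HOL-Analysis.Analysis"
begin

text \<open>
  A metric graph is given by finitely many vertices and edges; the edge \<open>e\<close> is identified with
  the interval \<open>(0, len G e)\<close>, its end \<open>0\<close> being attached to \<open>src G e\<close> and its end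
  \<open>len G e\<close> to \<open>tgt G e\<close>. The orientation is only this choice of parametrisation. Loops and
  multiple edges are allowed. The set of Dirichlet vertices is part of the data; all other
  vertices carry standard conditions.
\<close>

record ('v, 'e) metric_graph =
  verts :: "'v set"
  edges :: "'e set"
  src :: "'e \<Rightarrow> 'v"
  tgt :: "'e \<Rightarrow> 'v"
  len :: "'e \<Rightarrow> real"
  dirichlet :: "'v set"

definition compact_metric_graph :: "('v, 'e) metric_graph \<Rightarrow> bool" where
  "compact_metric_graph G \<longleftrightarrow>
     finite (verts G) \<and> finite (edges G) \<and> dirichlet G \<subseteq> verts G \<and>
     (\<forall>e\<in>edges G. src G e \<in> verts G \<and> tgt G e \<in> verts G \<and> 0 < len G e)"


section \<open>The underlying topological space and lengths\<close>

datatype ('v, 'e) point = Vertex 'v | Inner 'e real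

definition points :: "('v, 'e) metric_graph \<Rightarrow> ('v, 'e) point set" where
  "points G = Vertex ` verts G \<union> {Inner e t | e t. e \<in> edges G \<and> 0 < t \<and> t < len G e}"

text \<open>The parametrisation of the closed edge \<open>e\<close> by \<open>[0, len G e]\<close>.\<close>

definition chart :: "('v, 'e) metric_graph \<Rightarrow> 'e \<Rightarrow> real \<Rightarrow> ('v, 'e) point" where
  "chart G e t =
     (if t \<le> 0 then Vertex (src G e)
      else if t \<ge> len G e then Vertex (tgt G e)
      else Inner e t)"

text \<open>
  The quotient topology: \<open>G\<close> is the disjoint union of its vertices and of the closed intervals
  \<open>[0, len G e]\<close>, with the endpoints of the intervals glued to the vertices.
\<close>

definition mg_topology :: "('v, 'e) metric_graph \<Rightarrow> ('v, 'e) point topology" where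
  "mg_topology G = topology (\<lambda>U. U \<subseteq> points G \<and>
     (\<forall>e\<in>edges G. openin (top_of_set {0..len G e}) {t \<in> {0..len G e}. chart G e t \<in> U}))"

lemma openin_mg_topology:
  "openin (mg_topology G) U \<longleftrightarrow> U \<subseteq> points G \<and>
     (\<forall>e\<in>edges G. openin (top_of_set {0..len G e}) {t \<in> {0..len G e}. chart G e t \<in> U})"
proof -
  have "istopology (\<lambda>U. U \<subseteq> points G \<and>
     (\<forall>e\<in>edges G. openin (top_of_set {0..len G e}) {t \<in> {0..len G e}. chart G e t \<in> U}))"
    unfolding istopology_def
  proof (intro conjI allI impI ballI; (elim conjE)?)
    fix S T e
    assume "\<forall>e\<in>edges G. openin (top_of_set {0..len G e}) {t \<in> {0..len G e}. chart G e t \<in> S}"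
      "\<forall>e\<in>edges G. openin (top_of_set {0..len G e}) {t \<in> {0..len G e}. chart G e t \<in> T}"
      "e \<in> edges G"
    then have "openin (top_of_set {0..len G e})
        ({t \<in> {0..len G e}. chart G e t \<in> S} \<inter> {t \<in> {0..len G e}. chart G e t \<in> T})"
      by (intro openin_Int) auto
    moreover have "{t \<in> {0..len G e}. chart G e t \<in> S} \<inter> {t \<in> {0..len G e}. chart G e t \<in> T} =
        {t \<in> {0..len G e}. chart G e t \<in> S \<inter> T}"
      by auto
    ultimately show "openin (top_of_set {0..len G e}) {t \<in> {0..len G e}. chart G e t \<in> S \<inter> T}"
      by simp
  next
    fix K e
    assume K: "\<forall>U\<in>K. U \<subseteq> points G \<and> (\<forall>e\<in>edges G.
        openin (top_of_set {0..len G e}) {t \<in> {0..len G e}. chart G e t \<in> U})"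
      and e: "e \<in> edges G"
    have "openin (top_of_set {0..len G e}) (\<Union>U\<in>K. {t \<in> {0..len G e}. chart G e t \<in> U})"
      using K e by (intro openin_Union) auto
    moreover have "(\<Union>U\<in>K. {t \<in> {0..len G e}. chart G e t \<in> U}) =
        {t \<in> {0..len G e}. chart G e t \<in> \<Union>K}"
      by auto
    ultimately show "openin (top_of_set {0..len G e}) {t \<in> {0..len G e}. chart G e t \<in> \<Union>K}"
      by simp
  qed auto
  then show ?thesis
    unfolding mg_topology_def by (simp add: topology_inverse')
qed

lemma topspace_mg_topology:
  assumes "compact_metric_graph G"
  shows "topspace (mg_topology G) = points G"
proof -
  have "{t \<in> {0..len G e}. chart G e t \<in> points G} = {0..len G e}" if "e \<in> edges G" for e
    using assms that by (auto simp: compact_metric_graph_def points_def chart_def)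
  then have "openin (mg_topology G) (points G)"
    by (simp add: openin_mg_topology)
  then show ?thesis
    using openin_mg_topology[of G "topspace (mg_topology G)"]
    by (auto dest: openin_subset)
qed

definition connected_graph :: "('v, 'e) metric_graph \<Rightarrow> bool" where
  "connected_graph G \<longleftrightarrow> connected_space (mg_topology G)"

definition total_length :: "('v, 'e) metric_graph \<Rightarrow> ('v, 'e) point set \<Rightarrow> real" where
  "total_length G C = (\<Sum>e\<in>edges G. measure lebesgue {t \<in> {0<..<len G e}. Inner e t \<in> C})"

text \<open>
  Two metric graphs with the same underlying length structure and the same Dirichlet points, that
  is, metric graphs which are equal up to relabelling, reparametrisation of the edges, and insertion
  or suppression of degree-two vertices with standard conditions.
\<close>

definition same_metric_graph ::
    "('v, 'e) metric_graph \<Rightarrow> ('w, 'f) metric_graph \<Rightarrow> bool" where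
  "same_metric_graph G H \<longleftrightarrow> (\<exists>h. homeomorphic_map (mg_topology G) (mg_topology H) h \<and>
     (\<forall>U. openin (mg_topology G) U \<longrightarrow> total_length H (h ` U) = total_length G U) \<and>
     h ` Vertex ` dirichlet G = Vertex ` dirichlet H)"


section \<open>The Laplacian and its lowest eigenvalue\<close>

text \<open>
  \<open>f\<close> belongs to \<open>H\<^sup>2(0, l)\<close> with first derivative \<open>f1\<close> and second derivative \<open>f2\<close>: it is
  continuously differentiable up to the boundary, its derivative is absolutely continuous (the
  primitive of an integrable function), and its second derivative is square integrable. Taking the
  \<open>C\<^sup>1\<close> representative gives a meaning to the boundary values of \<open>f\<close> and \<open>f1\<close>.
\<close>

definition H2_derivs :: "real \<Rightarrow> (real \<Rightarrow> real) \<Rightarrow> (real \<Rightarrow> real) \<Rightarrow> (real \<Rightarrow> real) \<Rightarrow> bool" where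
  "H2_derivs l f f1 f2 \<longleftrightarrow>
     (\<forall>x\<in>{0..l}. (f has_real_derivative f1 x) (at x within {0..l})) \<and>
     (\<forall>x\<in>{0..l}. (f2 has_integral (f1 x - f1 0)) {0..x}) \<and>
     f2 \<in> borel_measurable (lebesgue_on {0..l}) \<and>
     integrable (lebesgue_on {0..l}) (\<lambda>x. (f2 x)\<^sup>2)"

text \<open>
  Edge ends are pairs \<open>(e, b)\<close>, where \<open>b\<close> distinguishes the end at \<open>len G e\<close> from the end at
  \<open>0\<close>; so a loop contributes two ends at its vertex.
\<close>

definition end_vertex :: "('v, 'e) metric_graph \<Rightarrow> 'e \<Rightarrow> bool \<Rightarrow> 'v" where
  "end_vertex G e b = (if b then tgt G e else src G e)"

definition ends_at :: "('v, 'e) metric_graph \<Rightarrow> 'v \<Rightarrow> ('e \<times> bool) set" where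
  "ends_at G v = {(e, b). e \<in> edges G \<and> end_vertex G e b = v}"

definition end_value :: "('v, 'e) metric_graph \<Rightarrow> ('e \<Rightarrow> real \<Rightarrow> real) \<Rightarrow> 'e \<times> bool \<Rightarrow> real" where
  "end_value G u = (\<lambda>(e, b). u e (if b then len G e else 0))"

text \<open>
  The derivative at an edge end in the direction pointing into the edge, given the derivatives
  \<open>u1\<close> with respect to the edge parameters.
\<close>

definition normal_deriv ::
    "('v, 'e) metric_graph \<Rightarrow> ('e \<Rightarrow> real \<Rightarrow> real) \<Rightarrow> 'e \<times> bool \<Rightarrow> real" where
  "normal_deriv G u1 = (\<lambda>(e, b). if b then - u1 e (len G e) else u1 e 0)"

definition vertex_conditions ::
    "('v, 'e) metric_graph \<Rightarrow> ('e \<Rightarrow> real \<Rightarrow> real) \<Rightarrow> ('e \<Rightarrow> real \<Rightarrow> real) \<Rightarrow> bool" where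
  "vertex_conditions G u u1 \<longleftrightarrow>
     (\<forall>v\<in>dirichlet G. \<forall>a\<in>ends_at G v. end_value G u a = 0) \<and>
     (\<forall>v\<in>verts G - dirichlet G.
        (\<exists>c. \<forall>a\<in>ends_at G v. end_value G u a = c) \<and>
        (\<Sum>a\<in>ends_at G v. normal_deriv G u1 a) = 0)"

text \<open>
  The graph of the operator: \<open>u\<close> lies in the domain of the Laplacian and its image
  \<open>- u''\<close> is \<open>w\<close> (as elements of \<open>L\<^sup>2\<close>).
\<close>

definition laplacian ::
    "('v, 'e) metric_graph \<Rightarrow> ('e \<Rightarrow> real \<Rightarrow> real) \<Rightarrow> ('e \<Rightarrow> real \<Rightarrow> real) \<Rightarrow> bool" where
  "laplacian G u w \<longleftrightarrow> (\<exists>u1 u2.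
     (\<forall>e\<in>edges G. H2_derivs (len G e) (u e) (u1 e) (u2 e)) \<and>
     vertex_conditions G u u1 \<and>
     (\<forall>e\<in>edges G. AE x in lebesgue_on {0..len G e}. w e x = - u2 e x))"

definition laplacian_eigenvalue :: "('v, 'e) metric_graph \<Rightarrow> real \<Rightarrow> bool" where
  "laplacian_eigenvalue G \<mu> \<longleftrightarrow> (\<exists>u. laplacian G u (\<lambda>e x. \<mu> * u e x) \<and>
     (\<exists>e\<in>edges G. \<not> (AE x in lebesgue_on {0..len G e}. u e x = 0)))"

definition lambda1 :: "('v, 'e) metric_graph \<Rightarrow> real" where
  "lambda1 G = (LEAST \<mu>. laplacian_eigenvalue G \<mu>)"


section \<open>Gluing and separating the Dirichlet vertices\<close>

text \<open>
  Gluing: the vertices of the new graph are the equivalence classes of the old vertices, where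
  all Dirichlet vertices form a single class.
\<close>

definition glue_vertex :: "('v, 'e) metric_graph \<Rightarrow> 'v \<Rightarrow> 'v set" where
  "glue_vertex G v = (if v \<in> dirichlet G then dirichlet G else {v})"

definition glue_dirichlet :: "('v, 'e) metric_graph \<Rightarrow> ('v set, 'e) metric_graph" where
  "glue_dirichlet G =
     \<lparr>verts = glue_vertex G ` verts G,
      edges = edges G,
      src = (\<lambda>e. glue_vertex G (src G e)),
      tgt = (\<lambda>e. glue_vertex G (tgt G e)),
      len = len G,
      dirichlet = glue_vertex G ` dirichlet G\<rparr>"

fun glue_point :: "('v, 'e) metric_graph \<Rightarrow> ('v, 'e) point \<Rightarrow> ('v set, 'e) point" where
  "glue_point G (Vertex v) = Vertex (glue_vertex G v)"
| "glue_point G (Inner e t) = Inner e t"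

text \<open>
  Separating: every edge end at a Dirichlet vertex receives a degree-one Dirichlet vertex of its
  own. This does not affect the Laplacian, but it may disconnect the graph, for instance a figure
  eight with a single Dirichlet vertex at its centre.
\<close>

definition separate_vertex ::
    "('v, 'e) metric_graph \<Rightarrow> 'e \<Rightarrow> bool \<Rightarrow> 'v + 'e \<times> bool" where
  "separate_vertex G e b =
     (if end_vertex G e b \<in> dirichlet G then Inr (e, b) else Inl (end_vertex G e b))"

definition separate_dirichlet ::
    "('v, 'e) metric_graph \<Rightarrow> ('v + 'e \<times> bool, 'e) metric_graph" where
  "separate_dirichlet G =
     \<lparr>verts = Inl ` (verts G - dirichlet G) \<union> Inr ` (\<Union>v\<in>dirichlet G. ends_at G v),
      edges = edges G,
      src = (\<lambda>e. separate_vertex G e False),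
      tgt = (\<lambda>e. separate_vertex G e True),
      len = len G,
      dirichlet = Inr ` (\<Union>v\<in>dirichlet G. ends_at G v)\<rparr>"


section \<open>Cycles, girth and star graphs\<close>

definition is_cycle :: "('v, 'e) metric_graph \<Rightarrow> ('v, 'e) point set \<Rightarrow> bool" where
  "is_cycle G C \<longleftrightarrow> (\<exists>\<gamma>. pathin (mg_topology G) \<gamma> \<and> \<gamma> 0 = \<gamma> 1 \<and> inj_on \<gamma> {0..<1} \<and> C = \<gamma> ` {0..1})"

definition is_tree :: "('v, 'e) metric_graph \<Rightarrow> bool" where
  "is_tree G \<longleftrightarrow> connected_graph G \<and> (\<nexists>C. is_cycle G C)"

definition girth :: "('v, 'e) metric_graph \<Rightarrow> real" where
  "girth G =
     (if is_tree (glue_dirichlet G) then 0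
      else (LEAST L. \<exists>C. C \<subseteq> points G \<and> is_cycle (glue_dirichlet G) (glue_point G ` C) \<and>
                         L = total_length G C))"

text \<open>
  The equilateral star with edges \<open>1, \<dots>, n\<close> of length \<open>a\<close> joined at the vertex \<open>0\<close>. For
  \<open>n \<ge> 2\<close> the Dirichlet vertices are exactly the degree-one vertices.
\<close>

definition equilateral_star :: "nat \<Rightarrow> real \<Rightarrow> (nat, nat) metric_graph" where
  "equilateral_star n a =
     \<lparr>verts = {0..n}, edges = {1..n}, src = (\<lambda>_. 0), tgt = (\<lambda>i. i), len = (\<lambda>_. a),
      dirichlet = {1..n}\<rparr>"

text \<open>
  Being an equilateral Dirichlet star, up to the conventions that Dirichlet vertices may be
  separated or identified and that dummy vertices may be inserted or suppressed. For \<open>n = 2\<close> this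
  covers a Dirichlet interval of length \<open>2 a\<close>.
\<close>

definition is_equilateral_dirichlet_star :: "('v, 'e) metric_graph \<Rightarrow> nat \<Rightarrow> real \<Rightarrow> bool" where
  "is_equilateral_dirichlet_star G n a \<longleftrightarrow>
     0 < a \<and> same_metric_graph (separate_dirichlet G) (equilateral_star n a)"

end

theory Submission
  imports Defs
begin

text \<open>
  A first eigenfunction of frequency \<open>k\<close> is a sine arch on every edge. Cut the edges at the maxima
  of the arches, so that the eigenfunction is monotone on each piece; by Kirchhoff's condition every
  vertex that is not a Dirichlet vertex has a piece leading down from it. From the lowest node where
  two pieces lead down, follow both descents until they meet or reach Dirichlet vertices: together
  they form a cycle of the glued graph. Seen from above, the phase of the arch can only drop at a
  vertex, because the flux arriving there may be joined by further pieces from above. Hence each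
  descent has length at most \<open>\<pi> / (2 * k)\<close>, and \<open>s \<le> \<pi> / k\<close>. If equality holds, no further piece
  joins any of the descents from the top node, and the eigenfunction takes its maximum there, so by
  connectedness these descents are the whole graph, which is therefore an equilateral star.
  Conversely, on an equilateral star with edges of length \<open>r\<close> a positive eigenfunction with
  \<open>k * r < \<pi> / 2\<close> is impossible, as its Wronskian with \<open>sin (k * d)\<close>, where \<open>d\<close> is the distance to
  the boundary, would have total flux of a strict sign.
\<close>

text \<open>The eigenfunction is obtained without the spectral theorem. As long as
  \<open>k * len G e \<le> pi\<close>, a solution of \<open>u'' = - k^2 u\<close> is determined by
  its values at vertices and midpoints, so the energy becomes a quadratic form on a
  finite-dimensional space that depends continuously on \<open>k\<close>. It is definite at
  \<open>k = 0\<close>, by connectedness and a Dirichlet vertex; the first \<open>k\<close> at which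
  it degenerates is the frequency.

  The obstacle is that this eigenfunction may vanish on parts of the graph. Dirichlet vertices
  decouple their edges, and a component of the graph cut there may be an interval with one Dirichlet
  end, where no two descents start at one node. The frequency is therefore taken on the component of
  an edge that lies on a cycle of the glued graph. This \<open>k\<close> satisfies only
  \<open>lambda1 G \<le> k^2\<close>, which suffices for the bound. The cycle edges in that
  component have no loose ends away from Dirichlet vertices, so two pieces lead down from their
  highest node. In the equality statement the separated graph is connected, hence the component is
  everything and \<open>lambda1 G = k^2\<close>.\<close>

section \<open>The quadratic form of the vertex values\<close>

text \<open>
  If \<open>C a = cos (k * h)\<close> and \<open>S a = sin (k * h) / k\<close>, the summand of \<open>a\<close> is \<open>\<integral>(u')\<^sup>2 - k\<^sup>2 u\<^sup>2\<close> over an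
  interval of length \<open>h\<close>, for the solution \<open>u\<close> of \<open>u'' = - k\<^sup>2 u\<close> with the boundary values \<open>x (p a)\<close> and
  \<open>x (q a)\<close>; this formula is polarised in \<open>x\<close> and \<open>y\<close>.
\<close>

definition vform :: "'l set \<Rightarrow> ('l \<Rightarrow> 'n) \<Rightarrow> ('l \<Rightarrow> 'n) \<Rightarrow> ('l \<Rightarrow> real) \<Rightarrow> ('l \<Rightarrow> real) \<Rightarrow>
    ('n \<Rightarrow> real) \<Rightarrow> ('n \<Rightarrow> real) \<Rightarrow> real" where
  "vform L p q C S x y = (\<Sum>a\<in>L. ((x (p a) * y (p a) + x (q a) * y (q a)) * C a
     - x (p a) * y (q a) - x (q a) * y (p a)) / S a)"

definition unit_at :: "'n \<Rightarrow> 'n \<Rightarrow> real" where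
  "unit_at n m = (if m = n then 1 else 0)"

text \<open>Vectors are total functions vanishing off \<open>N\<close>. A Dirichlet vertex is left
  out of \<open>N\<close>, so its boundary condition needs no further clause.\<close>

definition supported_on :: "'n set \<Rightarrow> ('n \<Rightarrow> real) \<Rightarrow> bool" where
  "supported_on N x \<longleftrightarrow> (\<forall>n. n \<notin> N \<longrightarrow> x n = 0)"

lemma vform_add:
  "vform L p q C S (\<lambda>n. x n + r * y n) (\<lambda>n. x n + r * y n) =
     vform L p q C S x x + 2 * r * vform L p q C S x y + r\<^sup>2 * vform L p q C S y y"
  unfolding vform_def sum_distrib_left sum.distrib[symmetric]
  by (rule sum.cong) (simp_all add: field_simps power2_eq_square add_divide_distrib diff_divide_distrib)

lemma vform_scale:
  "vform L p q C S (\<lambda>n. r * x n) (\<lambda>n. r * x n) = r\<^sup>2 * vform L p q C S x x"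
  unfolding vform_def sum_distrib_left
  by (rule sum.cong) (simp_all add: field_simps power2_eq_square)

text \<open>A nonnegative form that is \<open>\<le> 0\<close> at \<open>x\<close> is minimal there,
  so its first variation in every direction \<open>y\<close> vanishes.\<close>

lemma vform_stationary:
  assumes nonneg: "\<And>z. supported_on N z \<Longrightarrow> 0 \<le> vform L p q C S z z"
    and "supported_on N x" "supported_on N y" "vform L p q C S x x \<le> 0"
  shows "vform L p q C S x y = 0"
proof (rule ccontr)
  define B where "B = vform L p q C S x y"
  define Q where "Q = vform L p q C S y y"
  assume "vform L p q C S x y \<noteq> 0"
  then have B: "B \<noteq> 0" by (simp add: B_def)
  have Q: "0 \<le> Q" unfolding Q_def by (rule nonneg) fact
  \<comment> \<open>The minimiser in \<open>r\<close> would be \<open>- B / Q\<close>. The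
    denominator \<open>Q + 1\<close> avoids a case distinction at \<open>Q = 0\<close> and still
    produces the negative value \<open>- (r^2 * (Q + 2))\<close>.\<close>
  define r where "r = - B / (Q + 1)"
  have "supported_on N (\<lambda>n. x n + r * y n)"
    using assms(2,3) by (auto simp: supported_on_def)
  then have "0 \<le> vform L p q C S x x + 2 * r * B + r\<^sup>2 * Q"
    using nonneg unfolding B_def Q_def vform_add[symmetric] by blast
  then have "0 \<le> 2 * r * B + r\<^sup>2 * Q" using assms(4) by simp
  moreover have "r * (Q + 1) = - B" using Q by (simp add: r_def field_simps)
  then have Br: "B = - (r * (Q + 1))" by linarith
  then have "2 * r * B + r\<^sup>2 * Q = - (r\<^sup>2 * (Q + 2))"
    by (subst Br) (simp add: power2_eq_square algebra_simps)
  ultimately have "0 \<le> - (r\<^sup>2 * (Q + 2))" by simp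
  moreover have "r \<noteq> 0" using B Q by (simp add: r_def)
  then have "0 < r\<^sup>2 * (Q + 2)" using Q by simp
  ultimately show False by linarith
qed

text \<open>For the interpolating solution of \<open>u'' = - k^2 u\<close> on a link,
  \<open>(x n * C a - x (q a)) / S a\<close> is minus the derivative at \<open>n\<close> pointing
  into the link. Vanishing of the sum is thus Kirchhoff's condition at the node
  \<open>n\<close>.\<close>

lemma vform_unit_at:
  assumes "finite L"
  shows "vform L p q C S x (unit_at n) =
    (\<Sum>a\<in>{a\<in>L. p a = n}. (x n * C a - x (q a)) / S a) +
    (\<Sum>a\<in>{a\<in>L. q a = n}. (x n * C a - x (p a)) / S a)"
proof -
  have 1: "(\<Sum>a\<in>{a\<in>L. p a = n}. (x n * C a - x (q a)) / S a) =
      (\<Sum>a\<in>L. if p a = n then (x (p a) * C a - x (q a)) / S a else 0)"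
    using assms by (subst sum.inter_filter[symmetric]) (auto intro!: sum.cong)
  have 2: "(\<Sum>a\<in>{a\<in>L. q a = n}. (x n * C a - x (p a)) / S a) =
      (\<Sum>a\<in>L. if q a = n then (x (q a) * C a - x (p a)) / S a else 0)"
    using assms by (subst sum.inter_filter[symmetric]) (auto intro!: sum.cong)
  show ?thesis
    unfolding 1 2 sum.distrib[symmetric] vform_def
    by (rule sum.cong) (auto simp: unit_at_def add_divide_distrib[symmetric] algebra_simps)
qed

lemma vform_expand:
  assumes "finite N" "supported_on N y"
  shows "vform L p q C S x y = (\<Sum>n\<in>N. y n * vform L p q C S x (unit_at n))"
proof -
  have y: "y m = (\<Sum>n\<in>N. y n * unit_at n m)" for m
    using assms by (auto simp: unit_at_def supported_on_def if_distrib cong: if_cong)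
  have "(\<Sum>n\<in>N. y n * vform L p q C S x (unit_at n)) = (\<Sum>a\<in>L. \<Sum>n\<in>N.
      y n * (((x (p a) * unit_at n (p a) + x (q a) * unit_at n (q a)) * C a
     - x (p a) * unit_at n (q a) - x (q a) * unit_at n (p a)) / S a))"
    unfolding vform_def sum_distrib_left by (rule sum.swap)
  also have "\<dots> = vform L p q C S x y"
    unfolding vform_def
  proof (rule sum.cong[OF refl])
    fix a
    have "(\<Sum>n\<in>N. y n * (((x (p a) * unit_at n (p a) + x (q a) * unit_at n (q a)) * C a
       - x (p a) * unit_at n (q a) - x (q a) * unit_at n (p a)) / S a)) =
      (\<Sum>n\<in>N. (x (p a) * C a - x (q a)) / S a * (y n * unit_at n (p a)) +
             (x (q a) * C a - x (p a)) / S a * (y n * unit_at n (q a)))"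
      by (rule sum.cong) (simp_all add: algebra_simps add_divide_distrib diff_divide_distrib)
    also have "\<dots> = (x (p a) * C a - x (q a)) / S a * y (p a) + (x (q a) * C a - x (p a)) / S a * y (q a)"
      unfolding sum.distrib sum_distrib_left[symmetric] y[symmetric] by simp
    also have "\<dots> = ((x (p a) * y (p a) + x (q a) * y (q a)) * C a
       - x (p a) * y (q a) - x (q a) * y (p a)) / S a"
      by (simp add: algebra_simps add_divide_distrib diff_divide_distrib)
    finally show "(\<Sum>n\<in>N. y n * (((x (p a) * unit_at n (p a) + x (q a) * unit_at n (q a)) * C a
       - x (p a) * unit_at n (q a) - x (q a) * unit_at n (p a)) / S a)) = \<dots>" .
  qed
  finally show ?thesis by simp
qed

section \<open>The first parameter at which the form degenerates\<close>

definition unit_sphere :: "'n set \<Rightarrow> ('n \<Rightarrow> real) set" where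
  "unit_sphere N = {x. supported_on N x \<and> (\<Sum>n\<in>N. (x n)\<^sup>2) = 1}"

text \<open>Node functions carry the product topology. The sphere is a closed subset of a product of
  compact sets, with the factor \<open>{0}\<close> at every node off \<open>N\<close>, so
  Tychonoff's theorem applies even if the node type is infinite.\<close>

lemma compact_unit_sphere:
  assumes "finite N"
  shows "compact (unit_sphere N)"
proof -
  define K where "K = (\<lambda>n. if n \<in> N then {-1..1} else {0::real})"
  have "compactin (product_topology (\<lambda>_. euclidean) UNIV) (PiE UNIV K)"
    unfolding compactin_PiE by (auto simp: K_def compactin_euclidean_iff)
  then have "compact (PiE UNIV K)"
    by (simp add: euclidean_product_topology)
  moreover have "closed {x. (\<Sum>n\<in>N. (x n)\<^sup>2) = (1::real)}"
    by (intro closed_Collect_eq continuous_intros continuous_on_product_coordinates)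
  moreover have "unit_sphere N = PiE UNIV K \<inter> {x. (\<Sum>n\<in>N. (x n)\<^sup>2) = 1}"
  proof -
    have "\<bar>x n\<bar> \<le> 1" if "(\<Sum>n\<in>N. (x n)\<^sup>2) = (1::real)" "n \<in> N" for x n
    proof -
      have "(x n)\<^sup>2 \<le> (\<Sum>n\<in>N. (x n)\<^sup>2)" using that assms by (intro member_le_sum) auto
      then show ?thesis using that by (simp add: abs_square_le_1)
    qed
    then show ?thesis
      by (force simp: unit_sphere_def supported_on_def K_def PiE_def Pi_def abs_le_iff split: if_splits)
  qed
  ultimately show ?thesis by (simp add: compact_Int_closed)
qed

lemma supported_on_normalize:
  assumes "finite N" "supported_on N x" "x \<noteq> (\<lambda>_. 0)"
  obtains r where "r > 0" "(\<lambda>n. r * x n) \<in> unit_sphere N"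
proof -
  have "0 < (\<Sum>n\<in>N. (x n)\<^sup>2)"
  proof -
    obtain n where n: "x n \<noteq> 0" using assms(3) by blast
    then have "n \<in> N" using assms(2) by (auto simp: supported_on_def)
    then show ?thesis using n assms(1) by (intro sum_pos2[of N n]) auto
  qed
  then have "(\<lambda>n. (1 / sqrt (\<Sum>n\<in>N. (x n)\<^sup>2)) * x n) \<in> unit_sphere N"
    using assms(2)
    by (auto simp: unit_sphere_def supported_on_def power_divide sum_divide_distrib[symmetric])
  with \<open>0 < _\<close> show ?thesis by (intro that[of "1 / sqrt (\<Sum>n\<in>N. (x n)\<^sup>2)"]) auto
qed

text \<open>The pairs \<open>(k, x)\<close> with \<open>x\<close> on the unit sphere at which the
  form is \<open>\<le> 0\<close> form a compact set, not empty because of \<open>x1\<close>, so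
  there is a smallest such \<open>k\<close>. Below it the form is positive definite; by continuity
  it is still nonnegative at it, which makes \<open>x\<close> stationary.\<close>

lemma first_degenerate_parameter:
  fixes C S :: "real \<Rightarrow> 'l \<Rightarrow> real" and p q :: "'l \<Rightarrow> 'n" and N :: "'n set"
  assumes fin: "finite L" "finite N" and K: "0 < K"
    and contC: "\<And>a. a \<in> L \<Longrightarrow> continuous_on {0..K} (\<lambda>k. C k a)"
    and contS: "\<And>a. a \<in> L \<Longrightarrow> continuous_on {0..K} (\<lambda>k. S k a)"
    and Spos: "\<And>a k. a \<in> L \<Longrightarrow> k \<in> {0..K} \<Longrightarrow> 0 < S k a"
    and C0: "\<And>a. a \<in> L \<Longrightarrow> C 0 a = 1"
    and x1: "supported_on N x1" "x1 \<noteq> (\<lambda>_. 0)" "vform L p q (C K) (S K) x1 x1 \<le> 0"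
    and conn: "\<And>x. supported_on N x \<Longrightarrow> (\<And>a. a \<in> L \<Longrightarrow> x (p a) = x (q a)) \<Longrightarrow> x = (\<lambda>_. 0)"
  obtains k x where "0 < k" "k \<le> K" "supported_on N x" "x \<noteq> (\<lambda>_. 0)" "\<And>n. 0 \<le> x n"
    "\<And>y. supported_on N y \<Longrightarrow> vform L p q (C k) (S k) x y = 0"
    "\<And>k' y. 0 \<le> k' \<Longrightarrow> k' < k \<Longrightarrow> supported_on N y \<Longrightarrow> y \<noteq> (\<lambda>_. 0) \<Longrightarrow> 0 < vform L p q (C k') (S k') y y"
proof -
  define Q where "Q = (\<lambda>k x. vform L p q (C k) (S k) x x)"
  define Z where "Z = {z \<in> {0..K} \<times> unit_sphere N. Q (fst z) (snd z) \<le> 0}"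
  have cont: "continuous_on ({0..K} \<times> unit_sphere N) (\<lambda>z. Q (fst z) (snd z))"
  proof -
    have [continuous_intros]: "continuous_on ({0..K} \<times> unit_sphere N) (\<lambda>z. snd z n)" for n :: 'n
      by (rule continuous_on_compose2[OF continuous_on_product_coordinates continuous_on_snd[OF continuous_on_id]]) auto
    have [continuous_intros]: "continuous_on ({0..K} \<times> unit_sphere N) (\<lambda>z. C (fst z) a)" if "a \<in> L" for a
      by (rule continuous_on_compose2[OF contC[OF that] continuous_on_fst[OF continuous_on_id]]) auto
    have [continuous_intros]: "continuous_on ({0..K} \<times> unit_sphere N) (\<lambda>z. S (fst z) a)" if "a \<in> L" for a
      by (rule continuous_on_compose2[OF contS[OF that] continuous_on_fst[OF continuous_on_id]]) auto
    have "S (fst z) a \<noteq> 0" if "a \<in> L" "z \<in> {0..K} \<times> unit_sphere N" for a z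
      using Spos[OF that(1), of "fst z"] that(2) by (metis less_numeral_extra(3) mem_Times_iff)
    then show ?thesis
      unfolding Q_def vform_def by (intro continuous_intros) auto
  qed
  have comp: "compact ({0..K} \<times> unit_sphere N)"
    by (intro compact_Times compact_Icc compact_unit_sphere fin)
  have "Z = ({0..K} \<times> unit_sphere N) \<inter> (\<lambda>z. Q (fst z) (snd z)) -` {..0}"
    unfolding Z_def by blast
  then have "closedin (top_of_set ({0..K} \<times> unit_sphere N)) Z"
    using continuous_closedin_preimage[OF cont closed_atMost] by metis
  then have "compact Z"
    using comp closedin_compact by blast
  then have compZ: "compact (fst ` Z)"
    by (intro compact_continuous_image continuous_on_fst continuous_on_id)
  have scale: "\<exists>r>0. (\<lambda>n. r * x n) \<in> unit_sphere N \<and> Q k (\<lambda>n. r * x n) = r\<^sup>2 * Q k x"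
    if "supported_on N x" "x \<noteq> (\<lambda>_. 0)" for k x
    using supported_on_normalize[OF fin(2) that] vform_scale unfolding Q_def by metis
  have "fst ` Z \<noteq> {}"
  proof -
    obtain r where "r > 0" "(\<lambda>n. r * x1 n) \<in> unit_sphere N" "Q K (\<lambda>n. r * x1 n) = r\<^sup>2 * Q K x1"
      using scale[OF x1(1,2)] by blast
    moreover have "r\<^sup>2 * Q K x1 \<le> 0" using x1(3) by (simp add: Q_def mult_nonneg_nonpos)
    ultimately have "(K, (\<lambda>n. r * x1 n)) \<in> Z" using K by (simp add: Z_def)
    then show ?thesis by blast
  qed
  then obtain k where k: "k \<in> fst ` Z" "\<And>k'. k' \<in> fst ` Z \<Longrightarrow> k \<le> k'"
    using compact_attains_inf[OF compZ] by blast
  then obtain x0 where x0: "(k, x0) \<in> Z" by force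
  have below: "0 < Q k' y" if k': "0 \<le> k'" "k' < k" and y: "supported_on N y" "y \<noteq> (\<lambda>_. 0)" for k' y
  proof (rule ccontr)
    assume "\<not> 0 < Q k' y"
    moreover obtain r where "r > 0" "(\<lambda>n. r * y n) \<in> unit_sphere N" "Q k' (\<lambda>n. r * y n) = r\<^sup>2 * Q k' y"
      using scale[OF y] by blast
    ultimately have "(k', (\<lambda>n. r * y n)) \<in> Z"
      using k' x0 by (auto simp: Z_def mult_nonneg_nonpos)
    then have "k' \<in> fst ` Z" by force
    with k(2) k' show False by force
  qed
  have kK: "k \<in> {0..K}" and x0S: "x0 \<in> unit_sphere N" and Qx0: "Q k x0 \<le> 0"
    using x0 by (auto simp: Z_def)
  have x0supp: "supported_on N x0" and x0nz: "x0 \<noteq> (\<lambda>_. 0)"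
    using x0S by (auto simp: unit_sphere_def)
  \<comment> \<open>At parameter \<open>0\<close> the form is a weighted sum of the squares of
    \<open>x0 (p a) - x0 (q a)\<close>, so \<open>x0\<close> would be constant along links, which
    \<open>conn\<close> forbids.\<close>
  have kpos: "0 < k"
  proof (rule ccontr)
    assume "\<not> 0 < k"
    then have k0: "k = 0" using kK by auto
    have t: "((x0 (p a) * x0 (p a) + x0 (q a) * x0 (q a)) * C 0 a
     - x0 (p a) * x0 (q a) - x0 (q a) * x0 (p a)) / S 0 a = (x0 (p a) - x0 (q a))\<^sup>2 / S 0 a" if "a \<in> L" for a
      using that C0 by (simp add: power2_eq_square algebra_simps)
    have "Q 0 x0 = (\<Sum>a\<in>L. (x0 (p a) - x0 (q a))\<^sup>2 / S 0 a)"
      unfolding Q_def vform_def using t by (rule sum.cong[OF refl])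
    moreover have nn: "0 \<le> (x0 (p a) - x0 (q a))\<^sup>2 / S 0 a" if "a \<in> L" for a
      using Spos[OF that, of 0] K by simp
    ultimately have "(x0 (p a) - x0 (q a))\<^sup>2 / S 0 a = 0" if "a \<in> L" for a
      using Qx0 k0 that fin(1) by (metis (no_types, lifting) nn sum_nonneg_eq_0_iff sum_nonneg antisym)
    then have "x0 (p a) = x0 (q a)" if "a \<in> L" for a
      using that Spos[OF that, of 0] K by fastforce
    then show False using conn[OF x0supp] x0nz by blast
  qed
  have Qk: "0 \<le> Q k y" if "supported_on N y" for y
  proof (cases "y = (\<lambda>_. 0)")
    case True
    then show ?thesis by (simp add: Q_def vform_def)
  next
    case False
    have "continuous_on {0..K} (\<lambda>k. Q k y)"
      unfolding Q_def vform_def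
      by (intro continuous_intros contC contS) (metis Spos less_numeral_extra(3))+
    then have "continuous_on {0..k} (\<lambda>k. Q k y)"
      by (rule continuous_on_subset) (use kK in auto)
    moreover have "0 \<le> Q k' y" if "k' \<in> {0..<k}" for k'
      using below[of k' y] that False \<open>supported_on N y\<close> by force
    moreover have "closure {0..<k} = {0..k}" using kpos by simp
    ultimately show ?thesis
      using continuous_ge_on_closure[of "{0..<k}" "\<lambda>k. Q k y" k 0] kpos by auto
  qed
  \<comment> \<open>Absolute values leave the diagonal terms unchanged and can only lower the mixed
    ones, since \<open>S k a > 0\<close>; so the form stays \<open>\<le> 0\<close>.\<close>
  define x where "x = (\<lambda>n. \<bar>x0 n\<bar>)"
  have xsupp: "supported_on N x" using x0supp by (simp add: x_def supported_on_def)
  have "Q k x \<le> Q k x0"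
    unfolding Q_def vform_def
  proof (intro sum_mono divide_right_mono)
    fix a assume "a \<in> L"
    have "x0 (p a) * x0 (q a) \<le> x (p a) * x (q a)"
      unfolding x_def by (metis abs_ge_self abs_mult)
    then show "(x (p a) * x (p a) + x (q a) * x (q a)) * C k a - x (p a) * x (q a) - x (q a) * x (p a)
       \<le> (x0 (p a) * x0 (p a) + x0 (q a) * x0 (q a)) * C k a - x0 (p a) * x0 (q a) - x0 (q a) * x0 (p a)"
      by (simp add: x_def mult.commute)
    show "0 \<le> S k a" using Spos[OF \<open>a \<in> L\<close> kK] by simp
  qed
  then have Qx: "Q k x \<le> 0" using Qx0 by simp
  show ?thesis
  proof (rule that[of k x])
    show "0 < k" "k \<le> K" "supported_on N x" using kpos kK xsupp by auto
    show "x \<noteq> (\<lambda>_. 0)" using x0nz by (auto simp: x_def fun_eq_iff)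
    show "0 \<le> x n" for n by (simp add: x_def)
    show "vform L p q (C k) (S k) x y = 0" if "supported_on N y" for y
      using vform_stationary[of N L p q "C k" "S k" x y] Qk Qx xsupp that by (simp add: Q_def)
    show "0 < vform L p q (C k') (S k') y y" if "0 \<le> k'" "k' < k" "supported_on N y" "y \<noteq> (\<lambda>_. 0)" for k' y
      using below[OF that] by (simp add: Q_def)
  qed
qed

section \<open>Solutions on an edge\<close>

lemma H2_derivsI:
  assumes "\<And>x. x \<in> {0..l} \<Longrightarrow> (f has_real_derivative f1 x) (at x within {0..l})"
    and "\<And>x. x \<in> {0..l} \<Longrightarrow> (f1 has_real_derivative f2 x) (at x within {0..l})"
    and "continuous_on {0..l} f2"
  shows "H2_derivs l f f1 f2"
  unfolding H2_derivs_def
proof (intro conjI ballI)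
  fix x assume x: "x \<in> {0..l}"
  show "(f has_real_derivative f1 x) (at x within {0..l})" by (rule assms(1)[OF x])
  have "(f1 has_vector_derivative f2 y) (at y within {0..x})" if "y \<in> {0..x}" for y
    using assms(2)[of y] x that
    by (auto simp: has_real_derivative_iff_has_vector_derivative[symmetric] intro: DERIV_subset)
  then show "(f2 has_integral f1 x - f1 0) {0..x}"
    using x by (intro fundamental_theorem_of_calculus) auto
next
  show "f2 \<in> borel_measurable (lebesgue_on {0..l})"
    by (intro continuous_imp_measurable_on_sets_lebesgue assms) auto
  show "integrable (lebesgue_on {0..l}) (\<lambda>x. (f2 x)\<^sup>2)"
    by (intro continuous_imp_integrable_real continuous_intros assms)
qed

text \<open>Regularity: the integrand \<open>f2\<close> agrees almost everywhere with the continuous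
  function \<open>- m * f\<close>, so its primitive \<open>f1\<close> is differentiable at every
  point.\<close>

lemma H2_derivs_classical:
  assumes H: "H2_derivs l f f1 f2" and ae: "AE x in lebesgue_on {0..l}. m * f x = - f2 x"
    and x: "x \<in> {0..l}"
  shows "(f has_real_derivative f1 x) (at x within {0..l})"
    "(f1 has_real_derivative - m * f x) (at x within {0..l})"
proof -
  show "(f has_real_derivative f1 x) (at x within {0..l})"
    using H x by (auto simp: H2_derivs_def)
  have cont: "continuous_on {0..l} f"
    using H by (auto simp: H2_derivs_def continuous_on_eq_continuous_within intro!: DERIV_continuous)
  have "AE x in lebesgue. x \<in> {0..l} \<longrightarrow> m * f x = - f2 x"
    using ae by (subst (asm) AE_restrict_space_iff) auto
  then obtain T where T: "negligible T" "\<And>x. x \<in> {0..l} - T \<Longrightarrow> m * f x = - f2 x"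
    by (auto simp: eventually_ae_filter_negligible)
  have *: "f1 y = f1 0 + integral {0..y} (\<lambda>t. - m * f t)" if "y \<in> {0..l}" for y
  proof -
    have "(f2 has_integral (f1 y - f1 0)) {0..y}"
      using H that by (auto simp: H2_derivs_def)
    then have "((\<lambda>t. - m * f t) has_integral (f1 y - f1 0)) {0..y}"
      by (rule has_integral_spike[OF T(1), rotated]) (use T(2) that in fastforce)
    then have "integral {0..y} (\<lambda>t. - m * f t) = f1 y - f1 0" by (rule integral_unique)
    then show ?thesis by linarith
  qed
  have "continuous_on {0..l} (\<lambda>t. - m * f t)"
    using cont by (intro continuous_intros)
  then have "((\<lambda>y. f1 0 + integral {0..y} (\<lambda>t. - m * f t)) has_real_derivative (0 + - m * f x)) (at x within {0..l})"
    by (intro DERIV_add DERIV_const integral_has_real_derivative x)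
  then show "(f1 has_real_derivative - m * f x) (at x within {0..l})"
    by (rule has_field_derivative_transform_within[OF _ zero_less_one x, THEN DERIV_cong]) (rule *[symmetric], assumption, simp)
qed

lemma wave_classical:
  assumes k: "k \<noteq> 0" and l: "0 \<le> l"
    and f: "\<And>x. x \<in> {0..l} \<Longrightarrow> (f has_real_derivative f1 x) (at x within {0..l})"
    and f1: "\<And>x. x \<in> {0..l} \<Longrightarrow> (f1 has_real_derivative - k\<^sup>2 * f x) (at x within {0..l})"
    and x: "x \<in> {0..l}"
  shows "f x = f 0 * cos (k * x) + f1 0 / k * sin (k * x)"
    "f1 x = f1 0 * cos (k * x) - k * f 0 * sin (k * x)"
proof -
  define c where "c = 1 / k"
  have ck: "c * k = 1" "k * c = 1" "c * k\<^sup>2 = k" using k by (auto simp: c_def power2_eq_square)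
  \<comment> \<open>The point \<open>(f, f1 / k)\<close> rotates with constant angular speed.
    \<open>P\<close> and \<open>R\<close> are its coordinates in the co-rotating frame and hence
    constant, which gives uniqueness of the solution by hand.\<close>
  define P where "P = (\<lambda>t. f t * cos (k * t) - c * f1 t * sin (k * t))"
  define R where "R = (\<lambda>t. f t * sin (k * t) + c * f1 t * cos (k * t))"
  have "\<exists>d. \<forall>t\<in>{0..l}. P t = d"
  proof (rule has_field_derivative_zero_constant)
    fix t assume t: "t \<in> {0..l}"
    have "(P has_real_derivative (f1 t * cos (k * t) + f t * (- sin (k * t) * k)
        - (c * (- k\<^sup>2 * f t) * sin (k * t) + c * f1 t * (cos (k * t) * k)))) (at t within {0..l})"
      unfolding P_def
      by (rule derivative_eq_intros f[OF t] f1[OF t] refl | simp)+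
    moreover have "f1 t * cos (k * t) + f t * (- sin (k * t) * k)
        - (c * (- k\<^sup>2 * f t) * sin (k * t) + c * f1 t * (cos (k * t) * k)) = 0"
      using ck by algebra
    ultimately show "(P has_real_derivative 0) (at t within {0..l})" by simp
  qed auto
  then have P: "P x = P 0" using x l by (metis atLeastAtMost_iff order_refl)
  have "\<exists>d. \<forall>t\<in>{0..l}. R t = d"
  proof (rule has_field_derivative_zero_constant)
    fix t assume t: "t \<in> {0..l}"
    have "(R has_real_derivative (f1 t * sin (k * t) + f t * (cos (k * t) * k)
        + (c * (- k\<^sup>2 * f t) * cos (k * t) + c * f1 t * (- sin (k * t) * k)))) (at t within {0..l})"
      unfolding R_def
      by (rule derivative_eq_intros f[OF t] f1[OF t] refl | simp)+
    moreover have "f1 t * sin (k * t) + f t * (cos (k * t) * k)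
        + (c * (- k\<^sup>2 * f t) * cos (k * t) + c * f1 t * (- sin (k * t) * k)) = 0"
      using ck by algebra
    ultimately show "(R has_real_derivative 0) (at t within {0..l})" by simp
  qed auto
  then have R: "R x = R 0" using x l by (metis atLeastAtMost_iff order_refl)
  have cs: "cos (k * x) * cos (k * x) + sin (k * x) * sin (k * x) = 1"
    by (metis power2_eq_square sin_cos_squared_add2)
  have "f x = P x * cos (k * x) + R x * sin (k * x)"
    unfolding P_def R_def using cs by algebra
  then show "f x = f 0 * cos (k * x) + f1 0 / k * sin (k * x)"
    unfolding P R by (simp add: P_def R_def c_def)
  have "f1 x = k * (R x * cos (k * x) - P x * sin (k * x))"
    unfolding P_def R_def using cs ck by algebra
  then show "f1 x = f1 0 * cos (k * x) - k * f 0 * sin (k * x)"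
    unfolding P R using ck by (simp add: P_def R_def algebra_simps)
qed

lemma sine_H2_derivs:
  "H2_derivs l (\<lambda>t. A * sin (k * t + r)) (\<lambda>t. k * A * cos (k * t + r)) (\<lambda>t. - k\<^sup>2 * (A * sin (k * t + r)))"
  by (rule H2_derivsI)
    (auto intro!: derivative_eq_intros continuous_intros simp: power2_eq_square)

text \<open>The product \<open>f * f1\<close> has the derivative \<open>f1^2 - m * f^2\<close>,
  which is nonnegative for \<open>m \<le> 0\<close>; equal boundary terms force
  \<open>f1 = 0\<close>. Summed over the edges, this local Green identity excludes eigenvalues
  \<open>\<le> 0\<close>.\<close>

lemma wave_nonpos:
  assumes m: "m \<le> 0" and l: "0 \<le> l"
    and f: "\<And>x. x \<in> {0..l} \<Longrightarrow> (f has_real_derivative f1 x) (at x within {0..l})"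
    and f1: "\<And>x. x \<in> {0..l} \<Longrightarrow> (f1 has_real_derivative - m * f x) (at x within {0..l})"
  shows "f 0 * f1 0 \<le> f l * f1 l"
    and "f 0 * f1 0 = f l * f1 l \<Longrightarrow> x \<in> {0..l} \<Longrightarrow> f x = f 0"
proof -
  define g where "g = (\<lambda>t. f t * f1 t)"
  have g: "(g has_real_derivative ((f1 t)\<^sup>2 - m * (f t)\<^sup>2)) (at t within {0..l})" if "t \<in> {0..l}" for t
    unfolding g_def by (rule derivative_eq_intros f[OF that] f1[OF that] refl)+ (simp add: power2_eq_square)
  have nn: "0 \<le> (f1 t)\<^sup>2 - m * (f t)\<^sup>2" for t
    using mult_nonpos_nonneg[OF m zero_le_power2[of "f t"]] zero_le_power2[of "f1 t"] by linarith
  have mono: "g s \<le> g t" if "0 \<le> s" "s \<le> t" "t \<le> l" for s t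
  proof (cases "s = t")
    case False
    then have "s < t" using that by simp
    have "\<exists>z\<in>{s<..<t}. g t - g s = ((f1 z)\<^sup>2 - m * (f z)\<^sup>2) * (t - s)"
    proof (rule mvt_simple[OF \<open>s < t\<close>])
      fix y assume y: "s \<le> y" "y \<le> t"
      then have "(g has_real_derivative ((f1 y)\<^sup>2 - m * (f y)\<^sup>2)) (at y within {s..t})"
        using that by (intro DERIV_subset[OF g]) auto
      then show "(g has_derivative (*) ((f1 y)\<^sup>2 - m * (f y)\<^sup>2)) (at y within {s..t})"
        by (simp add: has_field_derivative_def)
    qed
    then obtain z where "g t - g s = ((f1 z)\<^sup>2 - m * (f z)\<^sup>2) * (t - s)" by blast
    then show ?thesis using mult_nonneg_nonneg[OF nn, of "t - s" z] \<open>s < t\<close> by simp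
  qed simp
  show "f 0 * f1 0 \<le> f l * f1 l" using mono[of 0 l] l by (simp add: g_def)
  assume eq: "f 0 * f1 0 = f l * f1 l" and x: "x \<in> {0..l}"
  have gc: "g t = g 0" if "t \<in> {0..l}" for t
  proof -
    have "g l = g 0" using eq by (simp add: g_def)
    then show ?thesis using mono[of 0 t] mono[of t l] that by simp
  qed
  have z: "f1 t = 0" if t: "t \<in> {0..l}" "l > 0" for t
  proof -
    have "((\<lambda>_. g 0) has_real_derivative ((f1 t)\<^sup>2 - m * (f t)\<^sup>2)) (at t within {0..l})"
      by (rule has_field_derivative_transform_within[OF g[OF t(1)] zero_less_one t(1)]) (rule gc)
    moreover have "((\<lambda>_. g 0) has_real_derivative 0) (at t within {0..l})" by simp
    ultimately have "(f1 t)\<^sup>2 - m * (f t)\<^sup>2 = 0"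
      using t by (intro vector_derivative_unique_within_closed_interval[of 0 l t "\<lambda>_. g 0"])
        (auto simp: has_real_derivative_iff_has_vector_derivative)
    then have "(f1 t)\<^sup>2 \<le> 0"
      using mult_nonpos_nonneg[OF m zero_le_power2[of "f t"]] by linarith
    then show ?thesis by simp
  qed
  show "f x = f 0"
  proof (cases "l > 0")
    case True
    have "\<exists>c. \<forall>t\<in>{0..l}. f t = c"
    proof (rule has_field_derivative_zero_constant)
      fix t assume "t \<in> {0..l}"
      then show "(f has_real_derivative 0) (at t within {0..l})" using f[of t] z[of t] True by simp
    qed simp
    then show ?thesis using x l by (metis atLeastAtMost_iff order_refl)
  next
    case False
    then have "x = 0" using x by auto
    then show ?thesis by simp
  qed
qed

section \<open>Eigenfunctions as sine arches\<close>

text \<open>If \<open>W\<close> and \<open>F\<close> are closed under incidence in both directions,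
  they span an open set, and so do their complements. In this form connectedness enters the
  combinatorial arguments below.\<close>

lemma connected_graph_clopen:
  fixes M :: "('v, 'e) metric_graph"
  assumes conn: "connected_graph M" and comp: "compact_metric_graph M"
    and WF: "W \<subseteq> verts M" "F \<subseteq> edges M"
    and cons: "\<And>e b. e \<in> edges M \<Longrightarrow> e \<in> F \<longleftrightarrow> end_vertex M e b \<in> W"
  shows "((W :: 'v set) = {} \<and> (F :: 'e set) = {}) \<or> (W = verts M \<and> F = edges M)"
proof -
  define U :: "'v set \<Rightarrow> 'e set \<Rightarrow> ('v, 'e) point set" where "U = (\<lambda>W F. Vertex ` W \<union> {Inner e t | e t. e \<in> F \<and> 0 < t \<and> t < len M e})"
  have len: "0 < len M e" if "e \<in> edges M" for e
    using comp that by (auto simp: compact_metric_graph_def)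
  have ends: "src M e \<in> W \<longleftrightarrow> e \<in> F" "tgt M e \<in> W \<longleftrightarrow> e \<in> F" if "e \<in> edges M" for e
    using cons[OF that, of False] cons[OF that, of True] by (auto simp: end_vertex_def)
  have op: "openin (mg_topology M) (U W F)"
    if "W \<subseteq> verts M" "F \<subseteq> edges M" "\<And>e. e \<in> edges M \<Longrightarrow> (src M e \<in> W \<longleftrightarrow> e \<in> F) \<and> (tgt M e \<in> W \<longleftrightarrow> e \<in> F)"
    for W F
    unfolding openin_mg_topology
  proof (intro conjI ballI)
    show "U W F \<subseteq> points M" using that by (auto simp: U_def points_def)
    fix e assume e: "e \<in> edges M"
    have "{t \<in> {0..len M e}. chart M e t \<in> U W F} = (if e \<in> F then {0..len M e} else {})"
      using that(3)[OF e] by (auto simp: U_def chart_def)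
    then show "openin (top_of_set {0..len M e}) {t \<in> {0..len M e}. chart M e t \<in> U W F}"
      by (simp add: openin_subtopology_refl)
  qed
  have "openin (mg_topology M) (U W F)" by (rule op) (use WF ends in auto)
  moreover have "openin (mg_topology M) (U (verts M - W) (edges M - F))"
    by (rule op) (use WF ends comp in \<open>auto simp: compact_metric_graph_def\<close>)
  moreover have "U W F \<inter> U (verts M - W) (edges M - F) = {}"
    by (auto simp: U_def)
  moreover have "topspace (mg_topology M) \<subseteq> U W F \<union> U (verts M - W) (edges M - F)"
    unfolding topspace_mg_topology[OF comp] by (auto simp: U_def points_def)
  ultimately have "U W F = {} \<or> U (verts M - W) (edges M - F) = {}"
    using conn unfolding connected_graph_def connected_space_def by blast
  moreover have "W = {} \<and> F = {}" if "U W F = {}" "F \<subseteq> edges M" for W F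
  proof -
    have "F = {}"
    proof (rule ccontr)
      assume "F \<noteq> {}"
      then obtain e where "e \<in> F" by blast
      then have "Inner e (len M e / 2) \<in> U W F" using len[of e] that(2)
        unfolding U_def by (intro UnI2 CollectI exI[of _ e] exI[of _ "len M e / 2"]) auto
      then show False using that by simp
    qed
    then show ?thesis using that by (auto simp: U_def)
  qed
  ultimately show ?thesis using WF by blast
qed

lemma ends_at_finite: "compact_metric_graph G \<Longrightarrow> finite (ends_at G v)"
  by (rule finite_subset[of _ "edges G \<times> UNIV"]) (auto simp: ends_at_def compact_metric_graph_def)

text \<open>Regroups the vertex conditions into boundary terms of the edges, as in an integration by
  parts.\<close>

lemma sum_edge_ends:
  assumes "compact_metric_graph G"
  shows "(\<Sum>v\<in>verts G. \<Sum>a\<in>ends_at G v. f a) = (\<Sum>e\<in>edges G. f (e, False) + f (e, True))"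
proof -
  have "(\<Sum>v\<in>verts G. \<Sum>a\<in>ends_at G v. f a) =
      (\<Sum>v\<in>verts G. sum f {a \<in> edges G \<times> UNIV. end_vertex G (fst a) (snd a) = v})"
    by (intro sum.cong refl) (auto simp: ends_at_def)
  also have "\<dots> = sum f (edges G \<times> UNIV)"
    using assms by (intro sum.group) (auto simp: compact_metric_graph_def end_vertex_def)
  also have "\<dots> = (\<Sum>e\<in>edges G. \<Sum>b\<in>UNIV. f (e, b))"
    by (simp add: sum.cartesian_product)
  finally show ?thesis by (simp add: UNIV_bool add.commute)
qed

text \<open>These are the edge sets of unions of components left when the graph is cut at its
  Dirichlet vertices. The Laplacian decouples along them, so an eigenfunction on one of them extends
  by zero.\<close>

definition separated_edges :: "('v, 'e) metric_graph \<Rightarrow> 'e set \<Rightarrow> bool" where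
  "separated_edges G F \<longleftrightarrow> F \<subseteq> edges G \<and>
     (\<forall>v\<in>verts G - dirichlet G. ends_at G v \<subseteq> F \<times> UNIV \<or> ends_at G v \<inter> F \<times> UNIV = {})"

text \<open>
  An eigenfunction that is positive on the edges \<open>F\<close> and vanishes elsewhere, with frequency \<open>k\<close>:
  on \<open>e\<close> it is a sine arch of amplitude \<open>A e\<close>, and \<open>ph (e, b)\<close> is its phase at the end \<open>(e, b)\<close>,
  measured in the direction pointing into the edge.
\<close>

definition phase_data ::
    "('v, 'e) metric_graph \<Rightarrow> real \<Rightarrow> 'e set \<Rightarrow> ('e \<Rightarrow> real) \<Rightarrow> ('e \<times> bool \<Rightarrow> real) \<Rightarrow> bool" where
  "phase_data G k F A ph \<longleftrightarrow> 0 < k \<and> F \<noteq> {} \<and> separated_edges G F \<and>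
     (\<forall>e\<in>F. 0 < A e \<and> 0 \<le> ph (e, False) \<and> 0 \<le> ph (e, True) \<and>
        ph (e, False) + ph (e, True) + k * len G e = pi) \<and>
     (\<forall>v\<in>dirichlet G. \<forall>a\<in>ends_at G v. fst a \<in> F \<longrightarrow> ph a = 0) \<and>
     (\<forall>v\<in>verts G - dirichlet G. ends_at G v \<subseteq> F \<times> UNIV \<longrightarrow>
        (\<exists>c>0. \<forall>a\<in>ends_at G v. A (fst a) * sin (ph a) = c) \<and>
        (\<Sum>a\<in>ends_at G v. A (fst a) * cos (ph a)) = 0)"

lemma phase_data_eigenvalue:
  assumes pd: "phase_data G k F A ph" and comp: "compact_metric_graph G"
  shows "laplacian_eigenvalue G (k\<^sup>2)"
proof -
  define B where "B = (\<lambda>e. if e \<in> F then A e else 0)"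
  define r where "r = (\<lambda>e. ph (e, False))"
  define u where "u = (\<lambda>e t. B e * sin (k * t + r e))"
  define u1 where "u1 = (\<lambda>e t. k * B e * cos (k * t + r e))"
  define u2 where "u2 = (\<lambda>e t. - k\<^sup>2 * (B e * sin (k * t + r e)))"
  \<comment> \<open>Seen from the far end, the phase is \<open>pi\<close> minus the running phase:
    the sine keeps its value, and the sign change of the cosine is that of the derivative pointing
    into the edge.\<close>
  have far: "k * len G e + r e = pi - ph (e, True)" if "e \<in> F" for e
  proof -
    have "ph (e, False) + ph (e, True) + k * len G e = pi"
      using pd that by (auto simp: phase_data_def)
    then show ?thesis unfolding r_def by linarith
  qed
  have val: "end_value G u a = B (fst a) * sin (ph a)" for a
    by (cases a) (auto simp: end_value_def u_def B_def r_def far[unfolded r_def])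
  have der: "normal_deriv G u1 a = k * (B (fst a) * cos (ph a))" for a
    by (cases a) (auto simp: normal_deriv_def u1_def B_def r_def far[unfolded r_def])
  have "vertex_conditions G u u1"
    unfolding vertex_conditions_def
  proof (intro conjI ballI)
    fix v a assume "v \<in> dirichlet G" "a \<in> ends_at G v"
    then show "end_value G u a = 0" using pd unfolding val by (auto simp: phase_data_def B_def)
  next
    fix v assume v: "v \<in> verts G - dirichlet G"
    then consider "ends_at G v \<subseteq> F \<times> UNIV" | "ends_at G v \<inter> F \<times> UNIV = {}"
      using pd by (auto simp: phase_data_def separated_edges_def)
    then have "(\<exists>c. \<forall>a\<in>ends_at G v. end_value G u a = c) \<and> (\<Sum>a\<in>ends_at G v. normal_deriv G u1 a) = 0"
    proof cases
      case 1
      then have B: "B (fst a) = A (fst a)" if "a \<in> ends_at G v" for a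
        using that by (auto simp: B_def)
      have "(\<exists>c>0. \<forall>a\<in>ends_at G v. A (fst a) * sin (ph a) = c) \<and> (\<Sum>a\<in>ends_at G v. A (fst a) * cos (ph a)) = 0"
        using pd v 1 by (auto simp: phase_data_def)
      then show ?thesis
        unfolding val der sum_distrib_left[symmetric] using B by auto
    next
      case 2
      then have "B (fst a) = 0" if "a \<in> ends_at G v" for a
        using that by (cases a) (auto simp: B_def)
      then show ?thesis unfolding val der by (auto intro!: sum.neutral exI[of _ 0])
    qed
    then show "\<exists>c. \<forall>a\<in>ends_at G v. end_value G u a = c" "(\<Sum>a\<in>ends_at G v. normal_deriv G u1 a) = 0" by auto
  qed
  then have lap: "laplacian G u (\<lambda>e x. k\<^sup>2 * u e x)"
    unfolding laplacian_def
    by (intro exI[of _ u1] exI[where x = u2] conjI ballI)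
      (use sine_H2_derivs in \<open>auto simp: u_def u1_def u2_def\<close>)
  obtain e where e: "e \<in> F" using pd by (auto simp: phase_data_def)
  then have eE: "e \<in> edges G" using pd by (auto simp: phase_data_def separated_edges_def)
  have "\<not> (AE x in lebesgue_on {0..len G e}. u e x = 0)"
  proof
    have l: "0 < len G e" using comp eE by (auto simp: compact_metric_graph_def)
    assume "AE x in lebesgue_on {0..len G e}. u e x = 0"
    then have "AE x in lebesgue. x \<in> {0..len G e} \<longrightarrow> u e x = 0"
      by (subst (asm) AE_restrict_space_iff) auto
    moreover have "u e x \<noteq> 0" if "x \<in> {0<..<len G e}" for x
    proof -
      have k: "0 < k" "0 \<le> r e" "k * len G e + r e \<le> pi" "0 < A e"
        using pd e far[OF e] by (auto simp: phase_data_def r_def)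
      have "0 < k * x" "k * x < k * len G e" using k that by auto
      then have "0 < sin (k * x + r e)" using k by (intro sin_gt_zero) linarith+
      then show ?thesis using e k by (simp add: u_def B_def)
    qed
    ultimately have "AE x in lebesgue. x \<notin> {0<..<len G e}"
      by (auto elim!: eventually_mono)
    then have "{0<..<len G e} \<in> null_sets lebesgue"
      by (subst AE_iff_null_sets) auto
    then have "emeasure lebesgue {0<..<len G e} = 0" by auto
    then show False using l by simp
  qed
  with lap eE show ?thesis unfolding laplacian_eigenvalue_def by blast
qed

lemma polar:
  fixes a b :: real
  assumes "a \<noteq> 0 \<or> b \<noteq> 0"
  obtains A t where "0 < A" "0 \<le> t" "t < 2 * pi" "a = A * cos t" "b = A * sin t"
proof -
  define A where "A = sqrt (a\<^sup>2 + b\<^sup>2)"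
  have A: "0 < A" 
  proof -
    have "0 < a\<^sup>2 + b\<^sup>2" using assms by (metis sum_power2_gt_zero_iff)
    then show ?thesis unfolding A_def by (rule real_sqrt_gt_zero)
  qed
  have "(a / A)\<^sup>2 + (b / A)\<^sup>2 = (a\<^sup>2 + b\<^sup>2) / A\<^sup>2" by (simp add: power_divide add_divide_distrib)
  also have "\<dots> = 1"
  proof -
    have "A\<^sup>2 = a\<^sup>2 + b\<^sup>2" by (simp add: A_def)
    then show ?thesis using A by (metis div_self less_numeral_extra(3) zero_less_power)
  qed
  finally obtain t where "0 \<le> t" "t < 2*pi" "a / A = cos t" "b / A = sin t"
    by (rule sincos_total_2pi)
  with A show ?thesis by (intro that[of A t]) (auto simp: field_simps)
qed

text \<open>Here \<open>p\<close>, \<open>q\<close>, \<open>p'\<close> are the values at the start,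
  the middle and the end of an edge with \<open>k * len G e = 2 * th\<close>, and \<open>mid\<close>
  reflects \<open>sin (r + 2 * th) + sin r = 2 * sin (r + th) * cos th\<close>. Positivity of
  \<open>q\<close> keeps the whole arch between the phases \<open>0\<close> and
  \<open>pi\<close>.\<close>

lemma sine_arch:
  fixes p p' q th :: real
  assumes "0 \<le> p" "0 \<le> p'" "0 < q" "0 < th" "th \<le> pi / 2" and mid: "p + p' = 2 * q * cos th"
  shows "\<exists>A r r'. 0 < A \<and> 0 \<le> r \<and> 0 \<le> r' \<and> r + r' + 2 * th = pi \<and>
    p = A * sin r \<and> p' = A * sin r' \<and> q = A * sin (r + th) \<and> q = A * sin (r' + th)"
proof -
  have s: "0 < sin th" using assms by (intro sin_gt_zero) auto
  \<comment> \<open>The quotient is the derivative at the start divided by \<open>k\<close>;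
    amplitude and phase are the polar coordinates of this pair.\<close>
  have "(q - p * cos th) / sin th \<noteq> 0 \<or> p \<noteq> 0" using assms s by auto
  then obtain A r where A: "0 < A" "0 \<le> r" "r < 2 * pi" "(q - p * cos th) / sin th = A * cos r" "p = A * sin r"
    by (rule polar)
  have q: "q = A * sin (r + th)"
  proof -
    have "q = p * cos th + A * cos r * sin th" using A(4) s by (simp add: field_simps)
    then show ?thesis using A(5) by (simp add: sin_add algebra_simps)
  qed
  have p': "p' = A * sin (r + 2 * th)"
  proof -
    have "sin (r + 2 * th) + sin r = 2 * sin (r + th) * cos th"
      using sin_plus_sin[of "r + 2 * th" r] by (simp add: algebra_simps add_divide_distrib)
    moreover have "p' = 2 * q * cos th - p" using mid by linarith
    ultimately show ?thesis using A(5) q by algebra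
  qed
  have "0 \<le> sin r" using A assms(1) by (simp add: zero_le_mult_iff)
  then have "r \<le> pi" using sin_lt_zero[of r] A(3) by force
  have "0 < sin (r + th)" using q A(1) assms(3) by (simp add: zero_less_mult_iff)
  have "r + 2 * th \<le> pi"
  proof (rule ccontr)
    assume "\<not> r + 2 * th \<le> pi"
    moreover have "0 \<le> sin (r + 2 * th)" using p' A(1) assms(2) by (simp add: zero_le_mult_iff)
    ultimately have "2 * pi \<le> r + 2 * th" using sin_lt_zero[of "r + 2 * th"] by force
    then have "r = pi" "th = pi / 2" using \<open>r \<le> pi\<close> assms(5) by auto
    then have "sin (r + th) = sin (pi + pi / 2)" by (simp only:)
    also have "\<dots> = - 1" unfolding sin_add by simp
    finally have "sin (r + th) = - 1" .
    then show False using \<open>0 < sin (r + th)\<close> by simp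
  qed
  define r' where "r' = pi - (r + 2 * th)"
  have "sin r' = sin (r + 2 * th)" unfolding r'_def by (rule sin_pi_minus)
  moreover have "sin (r' + th) = sin (r + th)"
    using sin_pi_minus[of "r + th"] by (simp add: r'_def algebra_simps)
  ultimately show ?thesis
    using A q p' \<open>r + 2 * th \<le> pi\<close>
    by (intro exI[of _ A] exI[of _ r] exI[of _ r']) (auto simp: r'_def)
qed

section \<open>Sampling at vertices and midpoints\<close>

text \<open>
  Edges are halved at their midpoints \<open>Inr e\<close>: the conditions \<open>k * len G e \<le> pi\<close> found below then keep
  \<open>half_sin\<close> positive, which for whole edges would fail at \<open>k * len G e = pi\<close>.
\<close>

definition node_end :: "('v, 'e) metric_graph \<Rightarrow> 'e \<times> bool \<Rightarrow> 'v + 'e" where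
  "node_end G a = Inl (end_vertex G (fst a) (snd a))"

definition node_mid :: "'e \<times> bool \<Rightarrow> 'v + 'e" where
  "node_mid a = Inr (fst a)"

definition half_cos :: "('v, 'e) metric_graph \<Rightarrow> real \<Rightarrow> 'e \<times> bool \<Rightarrow> real" where
  "half_cos G k a = cos (k * (len G (fst a) / 2))"

text \<open>The value at \<open>k = 0\<close> is the limit of the quotient, so the form is
  continuous down to \<open>0\<close>, where it is the energy of the piecewise linear
  interpolant.\<close>

definition half_sin :: "('v, 'e) metric_graph \<Rightarrow> real \<Rightarrow> 'e \<times> bool \<Rightarrow> real" where
  "half_sin G k a = (if k = 0 then len G (fst a) / 2 else sin (k * (len G (fst a) / 2)) / k)"

text \<open>Vertices that no edge of \<open>F\<close> touches are excluded: the form does not see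
  their values and could not be definite.\<close>

definition free_nodes :: "('v, 'e) metric_graph \<Rightarrow> 'e set \<Rightarrow> ('v + 'e) set" where
  "free_nodes G F = Inr ` F \<union> Inl ` {v \<in> verts G - dirichlet G. \<exists>e\<in>F. \<exists>b. end_vertex G e b = v}"

abbreviation graph_form ::
    "('v, 'e) metric_graph \<Rightarrow> 'e set \<Rightarrow> real \<Rightarrow> ('v + 'e \<Rightarrow> real) \<Rightarrow> ('v + 'e \<Rightarrow> real) \<Rightarrow> real" where
  "graph_form G F k \<equiv> vform (F \<times> UNIV) (node_end G) node_mid (half_cos G k) (half_sin G k)"

lemma continuous_on_sin_div: "continuous_on S (\<lambda>k::real. if k = 0 then h else sin (k * h) / k)"
proof (rule continuous_at_imp_continuous_on, intro ballI)
  fix k :: real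
  let ?f = "\<lambda>k::real. if k = 0 then h else sin (k * h) / k"
  show "isCont ?f k"
  proof (cases "k = 0")
    case True
    have "((\<lambda>k. sin (k * h)) has_real_derivative h) (at 0)"
      by (auto intro!: derivative_eq_intros)
    then have "(\<lambda>k. sin (k * h) / k) \<midarrow>0\<rightarrow> h"
      by (simp add: DERIV_def)
    then have "?f \<midarrow>0\<rightarrow> h" by (rule Lim_transform_eventually) (auto simp: eventually_at intro!: exI[of _ 1])
    then show ?thesis unfolding True isCont_def by simp
  next
    case False
    then have "isCont (\<lambda>k. sin (k * h) / k) k" by (intro continuous_intros) auto
    moreover have "\<forall>\<^sub>F x in nhds k. x \<noteq> 0" using False t1_space_nhds by blast
    then have "\<forall>\<^sub>F x in nhds k. sin (x * h) / x = ?f x" by (rule eventually_mono) simp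
    then have "isCont (\<lambda>k. sin (k * h) / k) k \<longleftrightarrow> isCont ?f k" by (rule isCont_cong)
    ultimately show ?thesis by blast
  qed
qed

text \<open>A nonempty level set of \<open>x\<close> for a nonzero value is closed under incidence,
  so by connectedness it would contain a Dirichlet vertex, where \<open>x\<close> vanishes. This is
  the definiteness of the form at \<open>k = 0\<close>.\<close>

lemma const_on_links_zero:
  assumes conn: "connected_graph G" and comp: "compact_metric_graph G" and D: "dirichlet G \<noteq> {}"
    and F: "separated_edges G F" and supp: "supported_on (free_nodes G F) x"
    and const: "\<And>a. a \<in> F \<times> UNIV \<Longrightarrow> x (node_end G a) = x (node_mid a)"
  shows "x = (\<lambda>_. 0)"
proof (rule ccontr)
  assume "x \<noteq> (\<lambda>_. 0)"
  then obtain n where n: "x n \<noteq> 0" by auto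
  define c where "c = x n"
  define W where "W = {v \<in> verts G. x (Inl v) = c}"
  define F' where "F' = {e \<in> edges G. x (Inr e) = c}"
  have inF: "e \<in> F" if "e \<in> F'" for e
    using that supp n by (auto simp: F'_def c_def supported_on_def free_nodes_def)
  have cons: "e \<in> F' \<longleftrightarrow> end_vertex G e b \<in> W" if e: "e \<in> edges G" for e b
  proof
    assume *: "e \<in> F'"
    then have "x (Inl (end_vertex G e b)) = c"
      using const[of "(e, b)"] inF by (auto simp: F'_def node_end_def node_mid_def)
    then show "end_vertex G e b \<in> W"
      using comp e by (auto simp: W_def compact_metric_graph_def end_vertex_def)
  next
    assume "end_vertex G e b \<in> W"
    then have x: "x (Inl (end_vertex G e b)) = c" by (simp add: W_def)
    then have "Inl (end_vertex G e b) \<in> free_nodes G F"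
      using supp n by (auto simp: c_def supported_on_def)
    then obtain e' b' where e': "e' \<in> F" "end_vertex G e' b' = end_vertex G e b"
      and v: "end_vertex G e b \<in> verts G - dirichlet G"
      by (auto simp: free_nodes_def)
    then have "(e', b') \<in> ends_at G (end_vertex G e b) \<inter> F \<times> UNIV"
      using F by (auto simp: ends_at_def separated_edges_def)
    then have "ends_at G (end_vertex G e b) \<subseteq> F \<times> UNIV"
      using F v unfolding separated_edges_def by blast
    then have "e \<in> F" using e by (auto simp: ends_at_def)
    then show "e \<in> F'"
      using const[of "(e, b)"] x e by (auto simp: F'_def node_end_def node_mid_def)
  qed
  have "W \<subseteq> verts G" "F' \<subseteq> edges G" by (auto simp: W_def F'_def)
  then consider "W = {}" "F' = {}" | "W = verts G"
    using connected_graph_clopen[OF conn comp _ _ cons] by blast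
  then show False
  proof cases
    case 1
    show ?thesis
    proof (cases n)
      case (Inl v)
      then have "v \<in> verts G" using n supp by (auto simp: supported_on_def free_nodes_def)
      then show ?thesis using 1 Inl by (auto simp: W_def c_def)
    next
      case (Inr e)
      then have "e \<in> edges G" using n supp F
        by (auto simp: supported_on_def free_nodes_def separated_edges_def)
      then show ?thesis using 1 Inr by (auto simp: F'_def c_def)
    qed
  next
    case 2
    obtain d where d: "d \<in> dirichlet G" using D by blast
    then have "d \<in> W" using comp 2 by (auto simp: compact_metric_graph_def)
    moreover have "x (Inl d) = 0" using supp d by (auto simp: supported_on_def free_nodes_def)
    ultimately show ?thesis using n by (simp add: W_def c_def)
  qed
qed

lemma first_frequency:
  fixes G :: "('v, 'e) metric_graph"
  assumes conn: "connected_graph G" and comp: "compact_metric_graph G" and D: "dirichlet G \<noteq> {}"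
    and F: "separated_edges G F" "F \<noteq> {}"
  obtains k x where "0 < k" "\<And>e. e \<in> F \<Longrightarrow> k * len G e \<le> pi"
    "supported_on (free_nodes G F) x" "x \<noteq> (\<lambda>_. 0)" "\<And>n. 0 \<le> x n"
    "\<And>n. n \<in> free_nodes G F \<Longrightarrow> graph_form G F k x (unit_at n) = 0"
    "\<And>k' y. 0 \<le> k' \<Longrightarrow> k' < k \<Longrightarrow> supported_on (free_nodes G F) y \<Longrightarrow> y \<noteq> (\<lambda>_. 0) \<Longrightarrow>
       0 < graph_form G F k' y y"
proof -
  have finE: "finite (edges G)" "finite (verts G)" and lenpos: "\<And>e. e \<in> F \<Longrightarrow> 0 < len G e"
    using comp F by (auto simp: compact_metric_graph_def separated_edges_def)
  have finF: "finite F" using F finE by (auto simp: separated_edges_def intro: finite_subset)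
  define l where "l = Max (len G ` F)"
  obtain e0 where e0: "e0 \<in> F" "len G e0 = l"
    using Max_in[of "len G ` F"] finF F unfolding l_def by (metis finite_imageI image_iff image_is_empty)
  have le: "len G e \<le> l" if "e \<in> F" for e using that finF by (simp add: l_def)
  have l: "0 < l" using lenpos e0 by auto
  \<comment> \<open>On the longest edge \<open>cos (K * l / 2) = 0\<close>, so the form vanishes on
    the unit vector of its midpoint. Hence degeneration occurs at \<open>K\<close> at the latest,
    and up to \<open>K\<close> every \<open>half_sin\<close> stays positive.\<close>
  define K where "K = pi / l"
  have K: "0 < K" using l by (simp add: K_def)
  have kl: "k * len G e \<le> pi" if "0 \<le> k" "k \<le> K" "e \<in> F" for k e
  proof -
    have "k * len G e \<le> K * l" using that le lenpos K l by (intro mult_mono) (auto simp: less_imp_le)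
    then show ?thesis using l by (simp add: K_def)
  qed
  have Spos: "0 < half_sin G k a" if "a \<in> F \<times> UNIV" "k \<in> {0..K}" for a k
  proof (cases "k = 0")
    case True
    then show ?thesis using that lenpos by (auto simp: half_sin_def)
  next
    case False
    have a: "fst a \<in> F" "0 \<le> k" "k \<le> K" using that by auto
    then have "k * len G (fst a) < 2 * pi" using kl[of k "fst a"] pi_gt_zero by linarith
    then have "0 < sin (k * (len G (fst a) / 2))"
      using False a lenpos[of "fst a"] by (intro sin_gt_zero) auto
    then show ?thesis using False that by (simp add: half_sin_def)
  qed
  have cC: "continuous_on {0..K} (\<lambda>k. half_cos G k a)" for a
    unfolding half_cos_def by (intro continuous_intros)
  have cS: "continuous_on {0..K} (\<lambda>k. half_sin G k a)" for a
    unfolding half_sin_def by (rule continuous_on_sin_div)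
  have C0: "half_cos G 0 a = 1" for a by (simp add: half_cos_def)
  have finN: "finite (free_nodes G F)" using finF finE by (simp add: free_nodes_def)
  have suppu: "supported_on (free_nodes G F) (unit_at n)" if "n \<in> free_nodes G F" for n
    using that by (auto simp: supported_on_def unit_at_def)
  have e0N: "Inr e0 \<in> free_nodes G F" using e0 by (simp add: free_nodes_def)
  have "graph_form G F K (unit_at (Inr e0)) (unit_at (Inr e0)) = 0"
  proof -
    have "half_cos G K a = 0" if "fst a = e0" for a
      using that e0 l by (simp add: half_cos_def K_def)
    then show ?thesis
      unfolding vform_def by (intro sum.neutral ballI) (auto simp: unit_at_def node_end_def node_mid_def)
  qed
  then have neg: "graph_form G F K (unit_at (Inr e0)) (unit_at (Inr e0)) \<le> 0" by simp
  have nz: "unit_at (Inr e0) \<noteq> (\<lambda>_ :: 'v + 'e. 0)"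
  proof
    assume "unit_at (Inr e0) = (\<lambda>_::'v + 'e. 0)"
    then have "unit_at (Inr e0) (Inr e0 :: 'v + 'e) = 0" by (rule fun_cong)
    then show False by (simp add: unit_at_def)
  qed
  show ?thesis
  proof (rule first_degenerate_parameter[where L = "F \<times> UNIV" and N = "free_nodes G F" and K = K
        and C = "half_cos G" and S = "half_sin G" and p = "node_end G" and q = node_mid
        and ?x1.0 = "unit_at (Inr e0)"])
    show "finite (F \<times> (UNIV :: bool set))" using finF by simp
    show "supported_on (free_nodes G F) (unit_at (Inr e0))" by (rule suppu[OF e0N])
    show "x = (\<lambda>_. 0)" if "supported_on (free_nodes G F) x"
      "\<And>a. a \<in> F \<times> UNIV \<Longrightarrow> x (node_end G a) = x (node_mid a)" for x
      using const_on_links_zero[OF conn comp D F(1)] that by blast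
    fix k x assume kx: "0 < k" "k \<le> K" "supported_on (free_nodes G F) x" "x \<noteq> (\<lambda>_. 0)" "\<And>n. 0 \<le> x n"
      "\<And>y. supported_on (free_nodes G F) y \<Longrightarrow> graph_form G F k x y = 0"
      "\<And>k' y. 0 \<le> k' \<Longrightarrow> k' < k \<Longrightarrow> supported_on (free_nodes G F) y \<Longrightarrow> y \<noteq> (\<lambda>_. 0) \<Longrightarrow>
         0 < graph_form G F k' y y"
    show thesis
    proof (rule that[of k x])
      show "k * len G e \<le> pi" if "e \<in> F" for e using kl[of k e] kx that by simp
      show "graph_form G F k x (unit_at n) = 0" if "n \<in> free_nodes G F" for n
        using kx(6) suppu[OF that] by blast
    qed (fact kx)+
  qed (fact finN K nz neg | rule cC cS C0 | (rule Spos; assumption))+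
qed

lemma graph_form_mid:
  fixes G :: "('v, 'e) metric_graph"
  assumes "finite F" "e \<in> F"
  shows "graph_form G F k x (unit_at (Inr e)) =
    (2 * x (Inr e) * half_cos G k (e, False) - x (Inl (src G e)) - x (Inl (tgt G e))) / half_sin G k (e, False)"
proof -
  have 1: "{a \<in> F \<times> UNIV. node_end G a = Inr e} = {}" by (auto simp: node_end_def)
  have 2: "{a \<in> F \<times> UNIV. (node_mid a :: 'v + 'e) = Inr e} = {(e, False), (e, True)}"
    using assms(2) by (auto simp: node_mid_def)
  have "half_cos G k (e, True) = half_cos G k (e, False)" "half_sin G k (e, True) = half_sin G k (e, False)"
    by (simp_all add: half_cos_def half_sin_def)
  then show ?thesis
    using assms(1) by (subst vform_unit_at) (simp_all add: 1 2 node_end_def end_vertex_def diff_divide_distrib)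
qed

lemma graph_form_end:
  fixes G :: "('v, 'e) metric_graph"
  assumes "finite F" "F \<subseteq> edges G" "ends_at G v \<subseteq> F \<times> UNIV"
  shows "graph_form G F k x (unit_at (Inl v)) =
    (\<Sum>a\<in>ends_at G v. (x (Inl v) * half_cos G k a - x (Inr (fst a))) / half_sin G k a)"
proof -
  have 1: "{a \<in> F \<times> UNIV. node_end G a = Inl v} = ends_at G v"
    using assms(2,3) by (auto simp: node_end_def ends_at_def)
  have 2: "{a \<in> F \<times> UNIV. (node_mid a :: 'v + 'e) = Inl v} = {}" by (auto simp: node_mid_def)
  show ?thesis
    using assms(1) by (subst vform_unit_at) (simp_all add: 1 2 node_mid_def)
qed

lemma separated_edges_iff:
  "separated_edges G F \<longleftrightarrow> F \<subseteq> edges G \<and>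
     (\<forall>v\<in>verts G - dirichlet G. \<forall>a\<in>ends_at G v. \<forall>b\<in>ends_at G v. fst a \<in> F \<longrightarrow> fst b \<in> F)"
proof -
  have "S \<subseteq> F \<times> UNIV \<longleftrightarrow> (\<forall>a\<in>S. fst a \<in> F)" "S \<inter> F \<times> UNIV = {} \<longleftrightarrow> (\<forall>a\<in>S. fst a \<notin> F)"
    for S :: "('b \<times> bool) set"
    by (auto simp: mem_Times_iff)
  then show ?thesis unfolding separated_edges_def by blast
qed

lemma separated_edges_all: "separated_edges G (edges G)"
  by (auto simp: separated_edges_def ends_at_def)

text \<open>A nonnegative null vector may vanish somewhere, so \<open>F\<close> shrinks to the edges
  with a positive midpoint. A discrete maximum principle shows that this set is again separated:
  zeros spread from midpoints to ends and from vertices to all adjacent midpoints. On the remaining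
  edges \<open>sine_arch\<close> recovers amplitude and phases.\<close>

lemma phase_data_of_null_vector:
  assumes comp: "compact_metric_graph G" and F: "separated_edges G F"
    and k: "0 < k" "\<And>e. e \<in> F \<Longrightarrow> k * len G e \<le> pi"
    and x: "supported_on (free_nodes G F) x" "x \<noteq> (\<lambda>_. 0)" "\<And>n. 0 \<le> x n"
    and null: "\<And>n. n \<in> free_nodes G F \<Longrightarrow> graph_form G F k x (unit_at n) = 0"
  obtains F' A ph where "F' \<subseteq> F" "phase_data G k F' A ph"
proof -
  have FE: "F \<subseteq> edges G" and lenpos: "\<And>e. e \<in> F \<Longrightarrow> 0 < len G e"
    using comp F by (auto simp: compact_metric_graph_def separated_edges_def)
  have finF: "finite F" using FE comp by (auto simp: compact_metric_graph_def intro: finite_subset)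
  have th: "0 < k * (len G e / 2)" "k * (len G e / 2) \<le> pi / 2" if "e \<in> F" for e
    using k(1) k(2)[OF that] lenpos[OF that] by auto
  have spos: "0 < sin (k * (len G e / 2))" if "e \<in> F" for e
    using th[OF that] by (intro sin_gt_zero) (use pi_gt_zero in linarith)+
  have mid: "x (Inl (src G e)) + x (Inl (tgt G e)) = 2 * x (Inr e) * cos (k * (len G e / 2))" if "e \<in> F" for e
  proof -
    have "graph_form G F k x (unit_at (Inr e)) = 0"
      using null that by (simp add: free_nodes_def)
    then show ?thesis
      unfolding graph_form_mid[OF finF that] using spos[OF that] k(1)
      by (simp add: half_cos_def half_sin_def)
  qed
  have vert: "(\<Sum>a\<in>ends_at G v. (x (Inl v) * cos (k * (len G (fst a) / 2)) - x (Inr (fst a))) / (sin (k * (len G (fst a) / 2)) / k)) = 0"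
    if v: "v \<in> verts G - dirichlet G" "ends_at G v \<subseteq> F \<times> UNIV" for v
  proof (cases "ends_at G v = {}")
    case False
    then obtain e b where "(e, b) \<in> ends_at G v" by auto
    then have "e \<in> F" "end_vertex G e b = v" using v by (auto simp: ends_at_def)
    then have "Inl v \<in> free_nodes G F" using v unfolding free_nodes_def by blast
    then have "graph_form G F k x (unit_at (Inl v)) = 0" by (rule null)
    then show ?thesis
      unfolding graph_form_end[OF finF FE v(2)] using k(1) by (simp add: half_cos_def half_sin_def)
  qed simp
  define F' where "F' = {e \<in> F. 0 < x (Inr e)}"
  have mid_zero: "x (Inl (end_vertex G e b)) = 0" if "e \<in> F - F'" for e b
  proof -
    have "x (Inr e) = 0" using that x(3)[of "Inr e"] by (auto simp: F'_def)
    then have "x (Inl (src G e)) + x (Inl (tgt G e)) = 0" using mid[of e] that by simp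
    then show ?thesis
      using x(3)[of "Inl (src G e)"] x(3)[of "Inl (tgt G e)"] by (simp add: end_vertex_def add_nonneg_eq_0_iff)
  qed
  \<comment> \<open>At a zero of the nonnegative \<open>x\<close>, all summands of Kirchhoff's
    condition have the same sign, so each of them vanishes.\<close>
  have vert_zero: "fst a \<notin> F'"
    if v: "v \<in> verts G - dirichlet G" "ends_at G v \<subseteq> F \<times> UNIV" "x (Inl v) = 0" and a: "a \<in> ends_at G v" for v a
  proof -
    have "(\<Sum>a\<in>ends_at G v. x (Inr (fst a)) / (sin (k * (len G (fst a) / 2)) / k)) = 0"
      using vert[OF v(1,2)] v(3) by (simp add: sum_negf)
    moreover have nn: "0 \<le> x (Inr (fst b)) / (sin (k * (len G (fst b) / 2)) / k)" if "b \<in> ends_at G v" for b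
    proof -
      have "fst b \<in> F" using that v by auto
      then show ?thesis using x(3) spos[of "fst b"] k(1) by (simp add: less_imp_le)
    qed
    ultimately have "x (Inr (fst a)) / (sin (k * (len G (fst a) / 2)) / k) = 0"
      using a sum_nonneg_eq_0_iff[OF ends_at_finite[OF comp, of v],
          of "\<lambda>a. x (Inr (fst a)) / (sin (k * (len G (fst a) / 2)) / k)"] by simp
    moreover have "fst a \<in> F" using a v by auto
    ultimately show ?thesis using spos[of "fst a"] k(1) by (auto simp: F'_def)
  qed
  have sep: "separated_edges G F'"
    unfolding separated_edges_def
  proof (intro conjI ballI)
    show "F' \<subseteq> edges G" using FE by (auto simp: F'_def)
    fix v assume v: "v \<in> verts G - dirichlet G"
    then consider "ends_at G v \<inter> F \<times> UNIV = {}" | "ends_at G v \<subseteq> F \<times> UNIV"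
      using F by (auto simp: separated_edges_def)
    then show "ends_at G v \<subseteq> F' \<times> UNIV \<or> ends_at G v \<inter> F' \<times> UNIV = {}"
    proof cases
      case 1
      then show ?thesis by (auto simp: F'_def)
    next
      case 2
      show ?thesis
      proof (cases "x (Inl v) = 0")
        case True
        then show ?thesis using vert_zero[OF v 2 True] by fastforce
      next
        case False
        have "e \<in> F'" if "(e, b) \<in> ends_at G v" for e b
          using that mid_zero[of e b] False 2 by (auto simp: ends_at_def)
        then show ?thesis by auto
      qed
    qed
  qed
  have ne: "F' \<noteq> {}"
  proof
    assume "F' = {}"
    obtain n where n: "x n \<noteq> 0" using x(2) by auto
    then have nF: "n \<in> free_nodes G F" using x(1) by (auto simp: supported_on_def)
    show False
    proof (cases n)
      case (Inl v)
      then obtain e b where "e \<in> F" "end_vertex G e b = v" using nF by (auto simp: free_nodes_def)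
      then show ?thesis using mid_zero[of e b] \<open>F' = {}\<close> n Inl by auto
    next
      case (Inr e)
      then have "e \<in> F'" using n nF x(3)[of n] by (auto simp: F'_def free_nodes_def)
      then show ?thesis using \<open>F' = {}\<close> by simp
    qed
  qed
  have "\<forall>e\<in>F'. \<exists>A r r'. 0 < A \<and> 0 \<le> r \<and> 0 \<le> r' \<and> r + r' + 2 * (k * (len G e / 2)) = pi \<and>
    x (Inl (src G e)) = A * sin r \<and> x (Inl (tgt G e)) = A * sin r' \<and>
    x (Inr e) = A * sin (r + k * (len G e / 2)) \<and> x (Inr e) = A * sin (r' + k * (len G e / 2))"
    using x(3) th mid by (intro ballI sine_arch) (auto simp: F'_def)
  then obtain A r r' where arch: "\<And>e. e \<in> F' \<Longrightarrow> 0 < A e \<and> 0 \<le> r e \<and> 0 \<le> r' e \<and> r e + r' e + 2 * (k * (len G e / 2)) = pi \<and>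
    x (Inl (src G e)) = A e * sin (r e) \<and> x (Inl (tgt G e)) = A e * sin (r' e) \<and>
    x (Inr e) = A e * sin (r e + k * (len G e / 2)) \<and> x (Inr e) = A e * sin (r' e + k * (len G e / 2))"
    by metis
  define ph where "ph = (\<lambda>(e, b). if b then r' e else r e)"
  have val: "x (Inl (end_vertex G (fst a) (snd a))) = A (fst a) * sin (ph a)"
    and xm: "x (Inr (fst a)) = A (fst a) * sin (ph a + k * (len G (fst a) / 2))"
    and ph0: "0 \<le> ph a" "ph a < pi" if "fst a \<in> F'" for a
  proof -
    have "0 < k * (len G (fst a) / 2)" using th[of "fst a"] that by (auto simp: F'_def)
    then show "x (Inl (end_vertex G (fst a) (snd a))) = A (fst a) * sin (ph a)"
      "x (Inr (fst a)) = A (fst a) * sin (ph a + k * (len G (fst a) / 2))" "0 \<le> ph a" "ph a < pi"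
      using arch[OF that] by (cases a; cases "snd a"; force simp: ph_def end_vertex_def)+
  qed
  have "phase_data G k F' A ph"
    unfolding phase_data_def
  proof (intro conjI ballI impI)
    show "0 < k" "F' \<noteq> {}" "separated_edges G F'" by fact+
    fix e assume "e \<in> F'"
    then show "0 < A e" "0 \<le> ph (e, False)" "0 \<le> ph (e, True)" "ph (e, False) + ph (e, True) + k * len G e = pi"
      using arch by (auto simp: ph_def)
  next
    fix v a assume v: "v \<in> dirichlet G" "a \<in> ends_at G v" "fst a \<in> F'"
    then have "x (Inl v) = 0" using x(1) by (auto simp: supported_on_def free_nodes_def)
    then have "A (fst a) * sin (ph a) = 0" using v val[OF v(3)] by (auto simp: ends_at_def)
    then have "sin (ph a) = 0" using arch[OF v(3)] by simp
    then show "ph a = 0" using ph0[OF v(3)] sin_gt_zero[of "ph a"] by force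
  next
    fix v assume v: "v \<in> verts G - dirichlet G" and sub: "ends_at G v \<subseteq> F' \<times> UNIV"
    then have sub': "ends_at G v \<subseteq> F \<times> UNIV" by (auto simp: F'_def)
    have inF': "fst a \<in> F'" if "a \<in> ends_at G v" for a using that sub by auto
    have v_eq: "x (Inl v) = A (fst a) * sin (ph a)" if "a \<in> ends_at G v" for a
      using val[OF inF'[OF that]] that by (auto simp: ends_at_def)
    show "\<exists>c>0. \<forall>a\<in>ends_at G v. A (fst a) * sin (ph a) = c"
    proof (cases "ends_at G v = {}")
      case False
      then have "x (Inl v) \<noteq> 0" using vert_zero[OF v sub'] inF' by blast
      then have "0 < x (Inl v)" using x(3)[of "Inl v"] by simp
      then show ?thesis using v_eq by metis
    qed (auto intro: exI[of _ 1])
    have "(\<Sum>a\<in>ends_at G v. - k * (A (fst a) * cos (ph a))) = 0"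
    proof -
      have "(x (Inl v) * cos (k * (len G (fst a) / 2)) - x (Inr (fst a))) / (sin (k * (len G (fst a) / 2)) / k)
        = - k * (A (fst a) * cos (ph a))" if a: "a \<in> ends_at G v" for a
      proof -
        have s: "sin (k * (len G (fst a) / 2)) \<noteq> 0"
          using spos[of "fst a"] sub' a by fastforce
        have "x (Inl v) * cos (k * (len G (fst a) / 2)) - x (Inr (fst a)) =
            - (A (fst a) * cos (ph a)) * sin (k * (len G (fst a) / 2))"
          unfolding v_eq[OF a] xm[OF inF'[OF a]] sin_add by (simp add: algebra_simps)
        then show ?thesis using s k(1) by simp
      qed
      then show ?thesis using vert[OF v sub'] by simp
    qed
    then show "(\<Sum>a\<in>ends_at G v. A (fst a) * cos (ph a)) = 0"
      using k(1) unfolding sum_distrib_left[symmetric] by simp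
  qed
  then show ?thesis by (intro that[of F' A ph]) (auto simp: F'_def)
qed

text \<open>Sampling an eigenfunction with a positive eigenvalue \<open>k'^2 < k^2\<close> at
  vertices and midpoints gives a null vector of the form at \<open>k'\<close>. By definiteness the
  samples are zero, and with them the eigenfunction. Eigenvalues \<open>m \<le> 0\<close> are
  excluded separately by the energy identity.\<close>

lemma eigenvalue_lower_bound:
  fixes G :: "('v, 'e) metric_graph"
  assumes conn: "connected_graph G" and comp: "compact_metric_graph G" and D: "dirichlet G \<noteq> {}"
    and k: "0 < k" "\<And>e. e \<in> edges G \<Longrightarrow> k * len G e \<le> pi"
    and below: "\<And>k' y. 0 \<le> k' \<Longrightarrow> k' < k \<Longrightarrow> supported_on (free_nodes G (edges G)) y \<Longrightarrow> y \<noteq> (\<lambda>_. 0) \<Longrightarrow>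
       0 < graph_form G (edges G) k' y y"
    and ev: "laplacian_eigenvalue G m"
  shows "k\<^sup>2 \<le> m"
proof (rule ccontr)
  assume "\<not> k\<^sup>2 \<le> m"
  obtain u u1 u2 e1 where H: "\<And>e. e \<in> edges G \<Longrightarrow> H2_derivs (len G e) (u e) (u1 e) (u2 e)"
    and vc: "vertex_conditions G u u1"
    and ae: "\<And>e. e \<in> edges G \<Longrightarrow> AE x in lebesgue_on {0..len G e}. m * u e x = - u2 e x"
    and e1: "e1 \<in> edges G" "\<not> (AE x in lebesgue_on {0..len G e1}. u e1 x = 0)"
    using ev unfolding laplacian_eigenvalue_def laplacian_def by blast
  have fin: "finite (edges G)" "finite (verts G)" and lenpos: "\<And>e. e \<in> edges G \<Longrightarrow> 0 < len G e"
    and endv: "\<And>e b. e \<in> edges G \<Longrightarrow> end_vertex G e b \<in> verts G"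
    using comp by (auto simp: compact_metric_graph_def end_vertex_def)
  note d = H2_derivs_classical[OF H ae]
  \<comment> \<open>Continuity at the vertices makes the value independent of the edge end that
    \<open>SOME\<close> picks; a vertex without ends gets the default \<open>0\<close>.\<close>
  define x :: "'v + 'e \<Rightarrow> real" where "x = (\<lambda>n. case n of
      Inl v \<Rightarrow> if ends_at G v = {} then 0 else end_value G u (SOME a. a \<in> ends_at G v)
    | Inr e \<Rightarrow> if e \<in> edges G then u e (len G e / 2) else 0)"
  have val: "x (Inl v) = end_value G u a" if a: "a \<in> ends_at G v" for a v
  proof -
    have *: "(SOME a. a \<in> ends_at G v) \<in> ends_at G v" using a by (rule someI)
    have "v \<in> verts G" using a endv by (auto simp: ends_at_def)
    then have "\<exists>c. \<forall>a\<in>ends_at G v. end_value G u a = c"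
      using vc unfolding vertex_conditions_def by blast
    then show ?thesis using * a by (auto simp: x_def)
  qed
  have supp: "supported_on (free_nodes G (edges G)) x"
    unfolding supported_on_def
  proof (intro allI impI)
    fix n assume n: "n \<notin> free_nodes G (edges G)"
    show "x n = 0"
    proof (cases n)
      case (Inl v)
      show ?thesis
      proof (cases "ends_at G v = {}")
        case False
        then obtain e b where a: "(e, b) \<in> ends_at G v" by auto
        then have "v \<in> dirichlet G" using n Inl endv[of e b] by (auto simp: free_nodes_def ends_at_def)
        then show ?thesis using vc a val[OF a] Inl by (auto simp: vertex_conditions_def)
      qed (simp add: Inl x_def)
    next
      case (Inr e)
      then show ?thesis using n by (auto simp: x_def free_nodes_def)
    qed
  qed
  have nonzero: "\<exists>t\<in>{0..len G e1}. u e1 t \<noteq> 0"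
  proof (rule ccontr)
    assume "\<not> ?thesis"
    then have "AE x in lebesgue_on {0..len G e1}. u e1 x = 0"
      by (intro AE_I2) (auto simp: space_restrict_space)
    then show False using e1 by simp
  qed
  show False
  proof (cases "m \<le> 0")
    case True
    \<comment> \<open>These are the boundary terms of the product of \<open>u\<close> and its
      derivative, pointing into the edges. They cancel at each vertex, so on every edge the
      inequality of \<open>wave_nonpos\<close> is an equality and \<open>u\<close> is constant
      there.\<close>
    define g where "g = (\<lambda>a. end_value G u a * normal_deriv G u1 a)"
    have "(\<Sum>a\<in>ends_at G v. g a) = 0" if v: "v \<in> verts G" for v
    proof (cases "v \<in> dirichlet G")
      case True
      then show ?thesis using vc by (intro sum.neutral) (auto simp: g_def vertex_conditions_def)
    next
      case False
      then have "(\<Sum>a\<in>ends_at G v. normal_deriv G u1 a) = 0" using vc v by (auto simp: vertex_conditions_def)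
      moreover have "(\<Sum>a\<in>ends_at G v. g a) = (\<Sum>a\<in>ends_at G v. x (Inl v) * normal_deriv G u1 a)"
        by (rule sum.cong) (auto simp: g_def val)
      ultimately show ?thesis unfolding sum_distrib_left[symmetric] by simp
    qed
    then have "(\<Sum>e\<in>edges G. g (e, False) + g (e, True)) = 0"
      unfolding sum_edge_ends[OF comp, symmetric] by simp
    then have s: "(\<Sum>e\<in>edges G. - (g (e, False) + g (e, True))) = 0"
      unfolding sum_negf by simp
    have "0 \<le> - (g (e, False) + g (e, True))" if e: "e \<in> edges G" for e
      using wave_nonpos(1)[OF True less_imp_le[OF lenpos[OF e]] d(1)[OF e e] d(2)[OF e e]]
      by (simp add: g_def end_value_def normal_deriv_def)
    then have "- (g (e, False) + g (e, True)) = 0" if "e \<in> edges G" for e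
      using s fin(1) that by (subst (asm) sum_nonneg_eq_0_iff) auto
    then have eq: "u e 0 * u1 e 0 = u e (len G e) * u1 e (len G e)" if "e \<in> edges G" for e
      using that by (simp add: g_def end_value_def normal_deriv_def)
    have const: "u e t = u e 0" if e: "e \<in> edges G" and t: "t \<in> {0..len G e}" for e t
      using wave_nonpos(2)[OF True less_imp_le[OF lenpos[OF e]] d(1)[OF e e] d(2)[OF e e] eq[OF e] t] .
    have "x = (\<lambda>_. 0)"
    proof (rule const_on_links_zero[OF conn comp D separated_edges_all supp])
      fix a :: "'e \<times> bool" assume a: "a \<in> edges G \<times> UNIV"
      obtain e b where ab: "a = (e, b)" by (cases a)
      have e: "e \<in> edges G" using a ab by auto
      have l: "0 < len G e" by (rule lenpos[OF e])
      have "x (node_end G a) = end_value G u a"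
        unfolding node_end_def using val[of a "end_vertex G (fst a) (snd a)"] e by (simp add: ends_at_def ab)
      also have "\<dots> = u e 0"
        using const[OF e, of "len G e"] l by (auto simp: ab end_value_def)
      also have "u e 0 = u e (len G e / 2)"
        using const[OF e, of "len G e / 2"] l by simp
      finally show "x (node_end G a) = x (node_mid a)"
        using e by (simp add: node_mid_def ab x_def)
    qed
    then have "x (Inr e1) = 0" by (rule fun_cong)
    then have "u e1 (len G e1 / 2) = 0" using e1 by (simp add: x_def)
    then have "u e1 0 = 0" using const[OF e1(1), of "len G e1 / 2"] lenpos[OF e1(1)] by simp
    moreover obtain t where "t \<in> {0..len G e1}" "u e1 t \<noteq> 0" using nonzero by blast
    ultimately show False using const[OF e1(1), of t] by simp
  next
    case False
    define k' where "k' = sqrt m"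
    have k': "0 < k'" "k'\<^sup>2 = m" using False by (auto simp: k'_def)
    have "k' < k" using \<open>\<not> k\<^sup>2 \<le> m\<close> k' k(1) by (metis linorder_not_less power_mono less_imp_le)
    have wave: "u e t = u e 0 * cos (k' * t) + u1 e 0 / k' * sin (k' * t)"
      "u1 e t = u1 e 0 * cos (k' * t) - k' * u e 0 * sin (k' * t)"
      if e: "e \<in> edges G" and t: "t \<in> {0..len G e}" for e t
      using wave_classical[of k' "len G e" "u e" "u1 e" t] d(1)[OF e e] d(2)[OF e e] k' lenpos[OF e] t by auto
    \<comment> \<open>The solution formula started at either end with the derivative pointing
      inwards. It identifies each summand of the form at a vertex with minus a normal
      derivative.\<close>
    have half: "x (Inr (fst a)) = x (Inl (end_vertex G (fst a) (snd a))) * half_cos G k' a + normal_deriv G u1 a * half_sin G k' a"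
      if a: "fst a \<in> edges G" for a
    proof -
      obtain e b where ab: "a = (e, b)" by (cases a)
      define h where "h = len G e / 2"
      have e: "e \<in> edges G" and l: "0 < len G e" and lh: "len G e = h + h"
        using a lenpos by (auto simp: ab h_def)
      have v: "x (Inl (end_vertex G e b)) = end_value G u (e, b)"
        using val[of "(e, b)" "end_vertex G e b"] e by (simp add: ends_at_def)
      have cs: "cos (k' * h) * cos (k' * h) + sin (k' * h) * sin (k' * h) = 1"
        by (metis power2_eq_square sin_cos_squared_add2)
      have um: "u e h = u e 0 * cos (k' * h) + u1 e 0 / k' * sin (k' * h)"
        by (rule wave(1)[OF e]) (use l lh in auto)
      have m: "h + h \<in> {0..len G e}" using l lh by simp
      have kh: "k' * (h + h) = k' * h + k' * h" by (rule distrib_left)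
      have ul: "u e (h + h) = u e 0 * cos (k' * h + k' * h) + u1 e 0 / k' * sin (k' * h + k' * h)"
        "u1 e (h + h) = u1 e 0 * cos (k' * h + k' * h) - k' * u e 0 * sin (k' * h + k' * h)"
        by (rule wave(1)[OF e m, unfolded kh] wave(2)[OF e m, unfolded kh])+
      have "u e h = u e (h + h) * cos (k' * h) - u1 e (h + h) * (sin (k' * h) / k')"
      proof -
        define c where "c = 1 / k'"
        have ck: "c * k' = 1" using k' by (simp add: c_def)
        have "u e 0 * cos (k' * h) + u1 e 0 * c * sin (k' * h) =
          (u e 0 * cos (k' * h + k' * h) + u1 e 0 * c * sin (k' * h + k' * h)) * cos (k' * h)
          - (u1 e 0 * cos (k' * h + k' * h) - k' * u e 0 * sin (k' * h + k' * h)) * (sin (k' * h) * c)"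
          unfolding cos_add sin_add using cs ck by algebra
        then show ?thesis unfolding um ul by (simp add: c_def)
      qed
      with um show ?thesis
        unfolding ab fst_conv snd_conv v
        using e k' by (cases b) (auto simp: x_def half_cos_def half_sin_def h_def[symmetric] end_value_def normal_deriv_def lh)
    qed
    have spos: "0 < half_sin G k' a" if a: "fst a \<in> edges G" for a
    proof -
      have "k' * len G (fst a) < k * len G (fst a)" using \<open>k' < k\<close> lenpos[OF a] by simp
      then have "k' * len G (fst a) < pi" using k(2)[OF a] by linarith
      then have "0 < sin (k' * (len G (fst a) / 2))"
        using k' lenpos[OF a] pi_gt_zero by (intro sin_gt_zero) (auto intro: less_trans)
      then show ?thesis using k' by (simp add: half_sin_def)
    qed
    have null: "graph_form G (edges G) k' x (unit_at n) = 0" if n: "n \<in> free_nodes G (edges G)" for n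
    proof (cases n)
      case (Inl v)
      then have v: "v \<in> verts G - dirichlet G" using n by (auto simp: free_nodes_def)
      have sub: "ends_at G v \<subseteq> edges G \<times> UNIV" by (auto simp: ends_at_def)
      have "(x (Inl v) * half_cos G k' a - x (Inr (fst a))) / half_sin G k' a = - normal_deriv G u1 a"
        if a: "a \<in> ends_at G v" for a
      proof -
        have "fst a \<in> edges G" "end_vertex G (fst a) (snd a) = v" using a by (auto simp: ends_at_def)
        then show ?thesis using half[of a] spos[of a] by (simp add: field_simps)
      qed
      then have "graph_form G (edges G) k' x (unit_at n) = (\<Sum>a\<in>ends_at G v. - normal_deriv G u1 a)"
        unfolding Inl graph_form_end[OF fin(1) order_refl sub] by simp
      also have "\<dots> = 0" using vc v by (auto simp: vertex_conditions_def sum_negf)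
      finally show ?thesis .
    next
      case (Inr e)
      then have e: "e \<in> edges G" using n by (auto simp: free_nodes_def)
      define h where "h = len G e / 2"
      have l: "0 < len G e" and lh: "len G e = h + h" using lenpos[OF e] by (auto simp: h_def)
      have um: "u e h = u e 0 * cos (k' * h) + u1 e 0 / k' * sin (k' * h)"
        by (rule wave(1)[OF e]) (use l lh in auto)
      have m: "h + h \<in> {0..len G e}" using l lh by simp
      have kh: "k' * (h + h) = k' * h + k' * h" by (rule distrib_left)
      have ul: "u e (h + h) = u e 0 * cos (k' * h + k' * h) + u1 e 0 / k' * sin (k' * h + k' * h)"
        by (rule wave(1)[OF e m, unfolded kh])
      have cs: "cos (k' * h) * cos (k' * h) + sin (k' * h) * sin (k' * h) = 1"
        by (metis power2_eq_square sin_cos_squared_add2)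
      have "2 * u e h * cos (k' * h) = u e 0 + u e (h + h)"
        unfolding um ul cos_add sin_add using cs by algebra
      moreover have "x (Inl (src G e)) = u e 0" "x (Inl (tgt G e)) = u e (h + h)"
        using val[of "(e, False)" "src G e"] val[of "(e, True)" "tgt G e"] e lh
        by (auto simp: ends_at_def end_vertex_def end_value_def)
      ultimately show ?thesis
        unfolding Inr graph_form_mid[OF fin(1) e] using e by (simp add: half_cos_def x_def h_def[symmetric])
    qed
    have finN: "finite (free_nodes G (edges G))" using fin by (simp add: free_nodes_def)
    have "graph_form G (edges G) k' x x = 0"
      unfolding vform_expand[OF finN supp] using null by simp
    then have x0: "x = (\<lambda>_. 0)" using below[of k' x] k' \<open>k' < k\<close> supp by fastforce
    have "u e1 t = 0" if t: "t \<in> {0..len G e1}" for t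
    proof -
      have "x (Inl (src G e1)) = u e1 0"
        using val[of "(e1, False)" "src G e1"] e1 by (auto simp: ends_at_def end_vertex_def end_value_def)
      then have "u e1 0 = 0" by (simp add: x0)
      moreover have "normal_deriv G u1 (e1, False) * half_sin G k' (e1, False) = 0"
        using half[of "(e1, False)"] e1 by (simp add: x0)
      then have "u1 e1 0 = 0" using spos[of "(e1, False)"] e1 by (simp add: normal_deriv_def)
      ultimately show ?thesis using wave(1)[OF e1(1) t] by simp
    qed
    then show False using nonzero by blast
  qed
qed

lemma lambda1_eqI:
  assumes "laplacian_eigenvalue G m" "\<And>m'. laplacian_eigenvalue G m' \<Longrightarrow> m \<le> m'"
  shows "lambda1 G = m"
  unfolding lambda1_def by (rule Least_equality) (use assms in auto)

text \<open>The edge \<open>e0\<close> is prescribed because a nonnegative eigenfunction of the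
  whole graph may vanish near the edges of interest. The one constructed here lives on the smallest
  separated set containing \<open>e0\<close>; its frequency can exceed the lowest one, whence only
  an inequality for \<open>lambda1 G\<close> in general.\<close>

theorem lambda1_phase_data:
  assumes conn: "connected_graph G" and comp: "compact_metric_graph G" and D: "dirichlet G \<noteq> {}"
    and e0: "e0 \<in> edges G"
  obtains k F A ph where "phase_data G k F A ph" "e0 \<in> F" "lambda1 G \<le> k\<^sup>2" "F = edges G \<longrightarrow> lambda1 G = k\<^sup>2"
proof -
  have all: "\<exists>k F' A ph. F' \<subseteq> F \<and> phase_data G k F' A ph \<and>
     (F = edges G \<longrightarrow> lambda1 G = k\<^sup>2 \<and> (\<forall>m. laplacian_eigenvalue G m \<longrightarrow> k\<^sup>2 \<le> m))"
    if F: "separated_edges G F" "F \<noteq> {}" for F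
  proof (rule first_frequency[OF conn comp D F])
    fix k x assume kx: "0 < k" "\<And>e. e \<in> F \<Longrightarrow> k * len G e \<le> pi"
      "supported_on (free_nodes G F) x" "x \<noteq> (\<lambda>_. 0)" "\<And>n. 0 \<le> x n"
      "\<And>n. n \<in> free_nodes G F \<Longrightarrow> graph_form G F k x (unit_at n) = 0"
      "\<And>k' y. 0 \<le> k' \<Longrightarrow> k' < k \<Longrightarrow> supported_on (free_nodes G F) y \<Longrightarrow> y \<noteq> (\<lambda>_. 0) \<Longrightarrow>
       0 < graph_form G F k' y y"
    obtain F' A ph where pd: "F' \<subseteq> F" "phase_data G k F' A ph"
      by (rule phase_data_of_null_vector[OF comp F(1) kx(1,2,3,4,5,6)])
    have "lambda1 G = k\<^sup>2 \<and> (\<forall>m. laplacian_eigenvalue G m \<longrightarrow> k\<^sup>2 \<le> m)" if FE: "F = edges G"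
    proof -
      have "k\<^sup>2 \<le> m" if "laplacian_eigenvalue G m" for m
        by (rule eigenvalue_lower_bound[OF conn comp D kx(1,2,7)[unfolded FE] that])
      then show ?thesis using lambda1_eqI[OF phase_data_eigenvalue[OF pd(2) comp]] by blast
    qed
    with pd show ?thesis by (intro exI[of _ k] exI[of _ F'] exI[of _ A] exI[of _ ph]) simp
  qed
  define F where "F = edges G \<inter> \<Inter>{F. separated_edges G F \<and> e0 \<in> F}"
  have "fst b \<in> F" if v: "v \<in> verts G - dirichlet G" and ab: "a \<in> ends_at G v" "b \<in> ends_at G v" "fst a \<in> F" for v a b
  proof -
    have "fst b \<in> edges G" using ab by (auto simp: ends_at_def)
    moreover have "fst b \<in> F'" if F': "separated_edges G F'" "e0 \<in> F'" for F'
    proof -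
      have "fst a \<in> F'" using ab(3) F' unfolding F_def by blast
      then show ?thesis using F'(1)[unfolded separated_edges_iff] v ab(1,2) by blast
    qed
    ultimately show ?thesis unfolding F_def by blast
  qed
  moreover have "F \<subseteq> edges G" unfolding F_def by (rule Int_lower1)
  ultimately have F: "separated_edges G F" unfolding separated_edges_iff by blast
  have e0F: "e0 \<in> F" using e0 by (simp add: F_def)
  obtain k F' A ph where 1: "F' \<subseteq> F" "phase_data G k F' A ph" "F = edges G \<longrightarrow> lambda1 G = k\<^sup>2"
    using all[OF F] e0F by blast
  have F': "separated_edges G F'" "F' \<noteq> {}" using 1 by (auto simp: phase_data_def)
  \<comment> \<open>If the support \<open>F'\<close> missed \<open>e0\<close>, then
    \<open>F - F'\<close> would be a smaller separated set containing \<open>e0\<close>.\<close>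
  have "e0 \<in> F'"
  proof (rule ccontr)
    assume "e0 \<notin> F'"
    have "separated_edges G (F - F')"
      using F F'(1) 1(1) unfolding separated_edges_iff by blast
    then have "\<Inter>{F. separated_edges G F \<and> e0 \<in> F} \<subseteq> F - F'"
      using \<open>e0 \<notin> F'\<close> e0F by (intro Inter_lower) simp
    then have "F \<subseteq> F - F'" unfolding F_def by blast
    then show False using F' 1(1) by blast
  qed
  then have "\<Inter>{F. separated_edges G F \<and> e0 \<in> F} \<subseteq> F'"
    using F' by (intro Inter_lower) simp
  then have "F' = F" using 1(1) unfolding F_def by blast
  have "lambda1 G \<le> k\<^sup>2"
  proof -
    obtain k0 where "lambda1 G = k0\<^sup>2" "\<forall>m. laplacian_eigenvalue G m \<longrightarrow> k0\<^sup>2 \<le> m"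
      using all[OF separated_edges_all] e0 by blast
    then show ?thesis using phase_data_eigenvalue[OF 1(2) comp] by simp
  qed
  then show ?thesis using that[OF 1(2) \<open>e0 \<in> F'\<close>] 1(3) \<open>F' = F\<close> by simp
qed

section \<open>Descents\<close>

text \<open>An eigenfunction cut into monotone pieces: the link \<open>a\<close> runs from
  \<open>lo a\<close> up to \<open>up a\<close>, and \<open>tl a\<close>, \<open>tu a\<close> are
  the phases at its ends, counted from the zero of its sine arch of amplitude \<open>R a\<close>.
  Then \<open>balance\<close> is Kirchhoff's condition: the slopes arriving from below add up to the
  slopes leaving upwards.\<close>

locale arch_network =
  fixes L :: "'l set" and lo up :: "'l \<Rightarrow> 'n" and Dn :: "'n set"
    and R tl tu h :: "'l \<Rightarrow> real" and val :: "'n \<Rightarrow> real" and k :: real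
  assumes finite_links: "finite L" and k_pos: "0 < k"
    and R_pos: "a \<in> L \<Longrightarrow> 0 < R a" and h_pos: "a \<in> L \<Longrightarrow> 0 < h a"
    and tl_nonneg: "a \<in> L \<Longrightarrow> 0 \<le> tl a" and tu_eq: "a \<in> L \<Longrightarrow> tu a = tl a + k * h a"
    and tu_le: "a \<in> L \<Longrightarrow> tu a \<le> pi / 2"
    and val_lo: "a \<in> L \<Longrightarrow> val (lo a) = R a * sin (tl a)"
    and val_up: "a \<in> L \<Longrightarrow> val (up a) = R a * sin (tu a)"
    and val_dir: "n \<in> Dn \<Longrightarrow> val n = 0"
    and lo_dir: "a \<in> L \<Longrightarrow> tl a = 0 \<Longrightarrow> lo a \<in> Dn"
    and balance: "n \<notin> Dn \<Longrightarrow> (\<Sum>a\<in>{a\<in>L. up a = n}. R a * cos (tu a)) = (\<Sum>a\<in>{a\<in>L. lo a = n}. R a * cos (tl a))"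
begin

lemma tl_less: "a \<in> L \<Longrightarrow> tl a < tu a"
  using tu_eq h_pos k_pos by simp

lemma cos_tl: "a \<in> L \<Longrightarrow> 0 < R a * cos (tl a)"
  using tl_less[of a] tl_nonneg[of a] tu_le[of a] R_pos[of a] by (intro mult_pos_pos cos_gt_zero_pi) auto

lemma val_less: assumes "a \<in> L" shows "val (lo a) < val (up a)"
proof -
  have "sin (tl a) < sin (tu a)"
    using tl_less[OF assms] tl_nonneg[OF assms] tu_le[OF assms] by (intro sin_monotone_2pi) auto
  then show ?thesis using R_pos[OF assms] by (simp add: val_lo[OF assms] val_up[OF assms])
qed

lemma val_lo_nonneg: assumes "a \<in> L" shows "0 \<le> val (lo a)"
  unfolding val_lo[OF assms]
  using tl_less[OF assms] tl_nonneg[OF assms] tu_le[OF assms] R_pos[OF assms]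
  by (intro mult_nonneg_nonneg sin_ge_zero) auto

lemma val_up_pos: "a \<in> L \<Longrightarrow> 0 < val (up a)"
  using val_less val_lo_nonneg by fastforce

lemma up_free: "a \<in> L \<Longrightarrow> up a \<notin> Dn"
  using val_up_pos val_dir by fastforce

text \<open>The slope with which \<open>a\<close> leaves its lower node is strictly positive, so the
  balance there needs something arriving from below.\<close>

lemma descending_link_exists:
  assumes "a \<in> L" "lo a \<notin> Dn"
  shows "\<exists>b\<in>L. up b = lo a"
proof (rule ccontr)
  assume "\<not> ?thesis"
  then have "{b \<in> L. up b = lo a} = {}" by auto
  then have "(\<Sum>b\<in>{b\<in>L. lo b = lo a}. R b * cos (tl b)) = 0"
    using balance[OF assms(2)] by (metis sum.empty)
  moreover have "0 < (\<Sum>b\<in>{b\<in>L. lo b = lo a}. R b * cos (tl b))"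
    using assms finite_links cos_tl by (intro sum_pos) auto
  ultimately show False by simp
qed

text \<open>Passing a node downwards, further links joining from above can only decrease the phase.\<close>

lemma phase_step:
  assumes c: "c \<in> L" and d: "d \<in> L" and eq: "lo c = up d"
    and uniq: "\<And>b. b \<in> L \<Longrightarrow> up b = up d \<Longrightarrow> b = d"
  shows "tu d \<le> tl c" and "tu d = tl c \<Longrightarrow> b \<in> L \<Longrightarrow> lo b = up d \<Longrightarrow> b = c"
proof -
  have set: "{a \<in> L. up a = up d} = {d}" using d uniq by auto
  have fin: "finite {a \<in> L. lo a = up d}" using finite_links by simp
  have bal: "R d * cos (tu d) = (\<Sum>a\<in>{a\<in>L. lo a = up d}. R a * cos (tl a))"
    using balance[OF up_free[OF d]] by (simp add: set)
  have v: "R c * sin (tl c) = R d * sin (tu d)" using val_lo[OF c] val_up[OF d] eq by simp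
  have le: "R c * cos (tl c) \<le> R d * cos (tu d)"
    unfolding bal using c eq cos_tl fin by (intro member_le_sum) (auto intro: less_imp_le)
  show 1: "tu d \<le> tl c"
  proof (rule ccontr)
    \<comment> \<open>The same value at a smaller phase needs a larger amplitude and comes with a
      larger cosine, so \<open>c\<close> alone would carry off more slope than \<open>d\<close>
      supplies.\<close>
    assume "\<not> tu d \<le> tl c"
    then have lt: "tl c < tu d" by simp
    have "sin (tl c) < sin (tu d)"
      using lt tl_nonneg[OF c] tu_le[OF d] by (intro sin_monotone_2pi) auto
    moreover have "0 < sin (tu d)"
      using lt tl_nonneg[OF c] tu_le[OF d] pi_gt_zero by (intro sin_gt_zero) linarith+
    ultimately have "R d < R c"
      using v R_pos[OF c] R_pos[OF d] by (smt (verit) mult_less_cancel_left_pos mult_right_mono)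
    moreover have "cos (tu d) < cos (tl c)"
      using lt tl_nonneg[OF c] tu_le[OF d] pi_gt_zero by (intro cos_monotone_0_pi) linarith+
    moreover have "0 \<le> cos (tu d)" using tu_le[OF d] lt tl_nonneg[OF c] by (intro cos_ge_zero) auto
    ultimately have "R d * cos (tu d) < R c * cos (tl c)"
      using R_pos[OF d] by (intro mult_strict_mono') auto
    then show False using le by simp
  qed
  assume e: "tu d = tl c" and b: "b \<in> L" "lo b = up d"
  show "b = c"
  proof (rule ccontr)
    assume "b \<noteq> c"
    \<comment> \<open>Equal phases and equal values give \<open>R c = R d\<close>. Then
      \<open>c\<close> already absorbs the whole slope of \<open>d\<close>, and nothing is left for
      a further link \<open>b\<close>.\<close>
    have "0 < tl c" using e tl_less[OF d] tl_nonneg[OF d] by simp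
    then have "0 < sin (tl c)"
      using tl_less[OF c] tu_le[OF c] pi_gt_zero by (intro sin_gt_zero) linarith+
    then have "R c = R d" using v e by simp
    have "R c * cos (tl c) + R b * cos (tl b) = (\<Sum>a\<in>{c, b}. R a * cos (tl a))"
      using \<open>b \<noteq> c\<close> by simp
    also have "\<dots> \<le> (\<Sum>a\<in>{a\<in>L. lo a = up d}. R a * cos (tl a))"
      using b c eq fin cos_tl by (intro sum_mono2) (auto intro: less_imp_le)
    also have "\<dots> = R c * cos (tl c)" using bal \<open>R c = R d\<close> e by simp
    finally show False using cos_tl[OF b(1)] by simp
  qed
qed

primrec dpath :: "'n \<Rightarrow> 'l list \<Rightarrow> 'n \<Rightarrow> bool" where
  "dpath n [] m \<longleftrightarrow> n = m"
| "dpath n (a # as) m \<longleftrightarrow> a \<in> L \<and> up a = n \<and> dpath (lo a) as m"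

text \<open>Below the height \<open>c\<close> descents never branch. In the application
  \<open>c\<close> is the height of the lowest node with two descending links.\<close>

definition unique_below :: "real \<Rightarrow> bool" where
  "unique_below c \<longleftrightarrow> (\<forall>a\<in>L. \<forall>b\<in>L. up a = up b \<longrightarrow> val (up a) < c \<longrightarrow> a = b)"

lemma unique_belowD: "unique_below c \<Longrightarrow> a \<in> L \<Longrightarrow> b \<in> L \<Longrightarrow> up a = up b \<Longrightarrow> val (up a) < c \<Longrightarrow> a = b"
  unfolding unique_below_def by blast

lemma unique_below_mono: "unique_below c \<Longrightarrow> d \<le> c \<Longrightarrow> unique_below d"
  unfolding unique_below_def by (meson less_le_trans)

lemma dpath_links: "dpath n as m \<Longrightarrow> set as \<subseteq> L"
  by (induction as arbitrary: n) auto

lemma dpath_val: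
  "dpath n as m \<Longrightarrow> val m \<le> val n \<and> (\<forall>a\<in>set as. (up a = n \<or> val (up a) < val n) \<and> val m < val (up a))"
proof (induction as arbitrary: n)
  case (Cons a as)
  then have a: "a \<in> L" "up a = n" "dpath (lo a) as m" by auto
  have "val (lo a) < val n" using val_less a by auto
  moreover have "val m \<le> val (lo a)" "\<forall>b\<in>set as. (up b = lo a \<or> val (up b) < val (lo a)) \<and> val m < val (up b)"
    using Cons.IH[OF a(3)] by auto
  ultimately show ?case using a by (auto; force)
qed simp

lemma dpath_end: "dpath n as m \<Longrightarrow> m = n \<or> val m < val n"
proof (cases as)
  case (Cons a bs)
  assume "dpath n as m"
  then have "a \<in> L" "up a = n" "dpath (lo a) bs m" using Cons by auto
  then show ?thesis using val_less[of a] dpath_val[of "lo a" bs m] by auto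
qed simp

lemma dpath_distinct: "dpath n as m \<Longrightarrow> distinct (map up as)"
proof (induction as arbitrary: n)
  case (Cons a as)
  then have a: "a \<in> L" "dpath (lo a) as m" by auto
  then have "val (up b) < val (up a)" if "b \<in> set as" for b
    using dpath_val[OF a(2)] that val_less[OF a(1)] by force
  then show ?case using Cons.IH[OF a(2)] by force
qed simp

text \<open>The phase drops by \<open>k * h\<close> along each link and, by
  \<open>phase_step\<close>, never rises at a node in between, so the lengths telescope. Uniqueness
  is required only strictly below the start, which may itself branch.\<close>

lemma dpath_length:
  assumes "c \<in> L" "dpath (lo c) as m" "unique_below (val (up c))"
  shows "k * (h c + sum_list (map h as)) \<le> tu c - tl (last (c # as))"
  using assms
proof (induction as arbitrary: c)
  case Nil
  then show ?case using tu_eq by simp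
next
  case (Cons d as)
  then have d: "d \<in> L" "up d = lo c" "dpath (lo d) as m" by auto
  have lt: "val (up d) < val (up c)" using d val_less Cons.prems by auto
  then have ub: "unique_below (val (up d))" using unique_below_mono[OF Cons.prems(3)] by simp
  have "tu d \<le> tl c"
    using phase_step(1)[OF Cons.prems(1) d(1) d(2)[symmetric]] unique_belowD[OF Cons.prems(3) _ d(1)] lt by metis
  then show ?case
    using Cons.IH[OF d(1,3) ub] tu_eq[OF Cons.prems(1)] by (simp add: algebra_simps)
qed

lemma last_link: "c \<in> L \<Longrightarrow> dpath (lo c) as m \<Longrightarrow> last (c # as) \<in> L \<and> lo (last (c # as)) = m"
  by (induction as arbitrary: c) auto

text \<open>If the length exhausts the initial phase, equality holds in \<open>phase_step\<close> at
  every intermediate node, which excludes all links other than those of the descent.\<close>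

lemma dpath_tight:
  assumes "c \<in> L" "dpath (lo c) as m" "unique_below (val (up c))"
    and "k * (h c + sum_list (map h as)) = tu c"
    and "b \<in> L" "lo b \<in> up ` set as \<or> up b \<in> up ` set as"
  shows "b \<in> set (c # as)"
  using assms
proof (induction as arbitrary: c)
  case (Cons d as)
  then have d: "d \<in> L" "up d = lo c" "dpath (lo d) as m" by auto
  have lt: "val (up d) < val (up c)" using d val_less Cons.prems by auto
  then have ub: "unique_below (val (up d))" using unique_below_mono[OF Cons.prems(3)] by simp
  have un: "b = d" if "b \<in> L" "up b = up d" for b
    using unique_belowD[OF Cons.prems(3) that(1) d(1) that(2)] lt that(2) by simp
  have 1: "tu d \<le> tl c"
    using phase_step(1)[OF Cons.prems(1) d(1) d(2)[symmetric]] un by blast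
  have 2: "k * (h d + sum_list (map h as)) \<le> tu d"
    using dpath_length[OF d(1,3) ub] last_link[OF d(1,3)] tl_nonneg by force
  have 3: "k * h c + k * (h d + sum_list (map h as)) = tu c"
    using Cons.prems(4) by (simp add: algebra_simps)
  have e: "tu d = tl c" "k * (h d + sum_list (map h as)) = tu d"
    using 1 2 3 tu_eq[OF Cons.prems(1)] by linarith+
  show ?case
  proof (cases "lo b = up d \<or> up b = up d")
    case True
    then show ?thesis
      using phase_step(2)[OF Cons.prems(1) d(1) d(2)[symmetric] un e(1) Cons.prems(5)] un[OF Cons.prems(5)] by auto
  next
    case False
    then have "lo b \<in> up ` set as \<or> up b \<in> up ` set as" using Cons.prems(6) by auto
    then show ?thesis using Cons.IH[OF d(1,3) ub e(2) Cons.prems(5)] by auto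
  qed
qed simp

lemma dpath_unique:
  assumes "dpath n as w" "dpath n bs w'" "w \<in> Dn" "w' \<in> Dn" "unique_below c" "val n < c"
  shows "as = bs \<and> w = w'"
  using assms
proof (induction as arbitrary: n bs)
  case Nil
  then have "n \<in> Dn" by simp
  then show ?case using Nil up_free by (cases bs) auto
next
  case (Cons a as)
  then have a: "a \<in> L" "up a = n" "dpath (lo a) as w" by auto
  then obtain b cs where bs: "bs = b # cs" using Cons.prems up_free by (cases bs) auto
  then have b: "b \<in> L" "up b = n" "dpath (lo b) cs w'" using Cons.prems by auto
  then have "a = b" using unique_belowD[OF Cons.prems(5) a(1) b(1)] a Cons.prems(6) by simp
  moreover have "val (lo a) < c" using val_less[OF a(1)] a Cons.prems(6) by auto
  ultimately show ?case
    using Cons.IH[OF a(3) _ Cons.prems(3,4,5)] b bs by blast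
qed

definition disjoint_descents :: "'n \<Rightarrow> 'n \<Rightarrow> 'l list \<Rightarrow> 'l list \<Rightarrow> 'n \<Rightarrow> 'n \<Rightarrow> bool" where
  "disjoint_descents n m as bs w w' \<longleftrightarrow> dpath n as w \<and> dpath m bs w' \<and>
     (w = w' \<and> w \<notin> Dn \<or> w \<in> Dn \<and> w' \<in> Dn) \<and> up ` set as \<inter> up ` set bs = {} \<and>
     w \<notin> up ` set bs \<and> w' \<notin> up ` set as"

lemma disjoint_descents_sym: "disjoint_descents n m as bs w w' \<Longrightarrow> disjoint_descents m n bs as w' w"
  by (auto simp: disjoint_descents_def)

definition proper_node :: "'n \<Rightarrow> bool" where
  "proper_node n \<longleftrightarrow> n \<in> Dn \<or> (\<exists>a\<in>L. up a = n)"

lemma proper_lo: "a \<in> L \<Longrightarrow> proper_node (lo a)"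
  using descending_link_exists by (auto simp: proper_node_def)

text \<open>The higher of the two nodes takes a step down. The other descent stays at or below its
  own start, so it cannot hit the node just left. The number of links at or below the two nodes
  decreases until they meet or both are Dirichlet nodes.\<close>

lemma disjoint_descents_exist:
  assumes "proper_node n" "proper_node m" "n \<noteq> m \<or> n \<in> Dn"
  shows "\<exists>as bs w w'. disjoint_descents n m as bs w w'"
  using assms
proof (induction "card {a\<in>L. val (up a) \<le> val n} + card {a\<in>L. val (up a) \<le> val m}"
    arbitrary: n m rule: less_induct)
  case less
  have main: "\<exists>as bs w w'. disjoint_descents n m as bs w w'"
    if nm: "proper_node n" "proper_node m" "n \<noteq> m \<or> n \<in> Dn" "val m \<le> val n"
      and IH: "\<And>n'. card {a\<in>L. val (up a) \<le> val n'} < card {a\<in>L. val (up a) \<le> val n} \<Longrightarrow>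
          proper_node n' \<Longrightarrow> n' \<noteq> m \<or> n' \<in> Dn \<Longrightarrow> \<exists>as bs w w'. disjoint_descents n' m as bs w w'" for n m
  proof (cases "n \<in> Dn")
    case True
    \<comment> \<open>If the higher node is a Dirichlet node, then so is the lower one, since any
      other proper node has a positive value.\<close>
    then have "val m \<le> 0" using nm val_dir by auto
    then have "m \<in> Dn" using nm(2) val_up_pos by (force simp: proper_node_def)
    then have "disjoint_descents n m [] [] n m" using True by (simp add: disjoint_descents_def)
    then show ?thesis by blast
  next
    case False
    then obtain d where d: "d \<in> L" "up d = n" using nm by (auto simp: proper_node_def)
    have lt: "val (lo d) < val n" using val_less d by auto
    show ?thesis
    proof (cases "lo d = m \<and> lo d \<notin> Dn")
      case True
      then have "disjoint_descents n m [d] [] m m"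
        using d nm False by (auto simp: disjoint_descents_def)
      then show ?thesis by blast
    next
      case no: False
      have "{a\<in>L. val (up a) \<le> val (lo d)} \<subset> {a\<in>L. val (up a) \<le> val n}"
        using lt d by force
      then have "card {a\<in>L. val (up a) \<le> val (lo d)} < card {a\<in>L. val (up a) \<le> val n}"
        using finite_links by (intro psubset_card_mono) auto
      then obtain as bs w w' where *: "disjoint_descents (lo d) m as bs w w'"
        using IH[OF _ proper_lo[OF d(1)]] no by blast
      have m: "dpath m bs w'" using * by (simp add: disjoint_descents_def)
      have "n \<noteq> m" using nm False by auto
      then have "n \<notin> up ` set bs" using dpath_val[OF m] nm(4) by force
      moreover have "w' \<noteq> n" using dpath_end[OF m] \<open>n \<noteq> m\<close> nm(4) by auto
      ultimately have "disjoint_descents n m (d # as) bs w w'"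
        using * d by (auto simp: disjoint_descents_def)
      then show ?thesis by blast
    qed
  qed
  show ?case
  proof (cases "val m \<le> val n")
    case True
    show ?thesis
    proof (rule main[OF less.prems True])
      fix n' assume "card {a\<in>L. val (up a) \<le> val n'} < card {a\<in>L. val (up a) \<le> val n}"
        "proper_node n'" "n' \<noteq> m \<or> n' \<in> Dn"
      then show "\<exists>as bs w w'. disjoint_descents n' m as bs w w'"
        using less.prems by (intro less.hyps) auto
    qed
  next
    case False
    then have nm: "n \<noteq> m" by auto
    have "\<exists>as bs w w'. disjoint_descents m n as bs w w'"
    proof (rule main)
      fix n' assume a: "card {a\<in>L. val (up a) \<le> val n'} < card {a\<in>L. val (up a) \<le> val m}"
        "proper_node n'" "n' \<noteq> n \<or> n' \<in> Dn"
      have "\<exists>as bs w w'. disjoint_descents n' n as bs w w'"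
        using a less.prems by (intro less.hyps) auto
      then show "\<exists>as bs w w'. disjoint_descents n' n as bs w w'" .
    qed (use less.prems nm False in auto)
    then show ?thesis using disjoint_descents_sym by blast
  qed
qed

text \<open>Take the link whose upper node is highest. That node is not a Dirichlet node, so another
  link of \<open>L'\<close> has an end there, and it cannot lead further up.\<close>

lemma collision_exists:
  assumes sub: "L' \<subseteq> L" "L' \<noteq> {}"
    and deg: "\<And>a n. a \<in> L' \<Longrightarrow> n = lo a \<or> n = up a \<Longrightarrow> n \<notin> Dn \<Longrightarrow> \<exists>b\<in>L'. b \<noteq> a \<and> (lo b = n \<or> up b = n)"
  shows "\<exists>a\<in>L. \<exists>b\<in>L. a \<noteq> b \<and> up a = up b"
proof -
  have "finite L'" using sub finite_links finite_subset by blast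
  then have "Max ((\<lambda>a. val (up a)) ` L') \<in> (\<lambda>a. val (up a)) ` L'" using sub(2) by (intro Max_in) auto
  then obtain a where a: "a \<in> L'" "Max ((\<lambda>a. val (up a)) ` L') = val (up a)" by auto
  have max: "val (up b) \<le> val (up a)" if "b \<in> L'" for b
    unfolding a(2)[symmetric] using that \<open>finite L'\<close> by (intro Max_ge) auto
  obtain b where b: "b \<in> L'" "b \<noteq> a" "lo b = up a \<or> up b = up a"
    using deg[OF a(1), of "up a"] up_free a(1) sub by blast
  have "up b = up a" using b max[OF b(1)] val_less[of b] sub by force
  then show ?thesis using a b sub by (metis subsetD)
qed

lemma lowest_collision:
  assumes "\<exists>a\<in>L. \<exists>b\<in>L. a \<noteq> b \<and> up a = up b"
  obtains a b where "a \<in> L" "b \<in> L" "a \<noteq> b" "up a = up b" "unique_below (val (up a))"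
proof -
  define X where "X = {val (up a) | a. a \<in> L \<and> (\<exists>b\<in>L. a \<noteq> b \<and> up a = up b)}"
  have "X \<subseteq> (\<lambda>a. val (up a)) ` L" by (auto simp: X_def)
  then have "finite X" using finite_links by (meson finite_imageI finite_subset)
  moreover have "X \<noteq> {}" using assms by (auto simp: X_def)
  ultimately have "Min X \<in> X" "\<And>x. x \<in> X \<Longrightarrow> Min X \<le> x" by auto
  then obtain a b where ab: "a \<in> L" "b \<in> L" "a \<noteq> b" "up a = up b" "val (up a) = Min X"
    by (auto simp: X_def)
  have "unique_below (val (up a))"
    unfolding unique_below_def
  proof (intro ballI impI, rule ccontr)
    fix c d assume "c \<in> L" "d \<in> L" "up c = up d" "val (up c) < val (up a)" "c \<noteq> d"
    then have "val (up c) \<in> X" unfolding X_def by blast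
    then show False using \<open>\<And>x. x \<in> X \<Longrightarrow> Min X \<le> x\<close> ab \<open>val (up c) < val (up a)\<close> by force
  qed
  with ab show ?thesis by (intro that[of a b])
qed

text \<open>The second alternative is the case that the two links rejoin at once. A common end that
  is not a Dirichlet node has a positive phase, which makes the length bound strict.\<close>

lemma two_descents:
  assumes ab: "a \<in> L" "b \<in> L" "a \<noteq> b" "up a = up b" "unique_below (val (up a))"
  obtains as bs w w' where
    "(disjoint_descents (lo a) (lo b) as bs w w') \<or> (as = [] \<and> bs = [] \<and> w = lo a \<and> w' = lo a \<and> lo a = lo b \<and> lo a \<notin> Dn)"
    "k * (h a + sum_list (map h as)) \<le> tu a" "k * (h b + sum_list (map h bs)) \<le> tu b"
    "w \<notin> Dn \<Longrightarrow> k * (h a + sum_list (map h as)) < tu a"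
proof -
  obtain as bs w w' where *:
    "(disjoint_descents (lo a) (lo b) as bs w w') \<or> (as = [] \<and> bs = [] \<and> w = lo a \<and> w' = lo a \<and> lo a = lo b \<and> lo a \<notin> Dn)"
    using disjoint_descents_exist[OF proper_lo[OF ab(1)] proper_lo[OF ab(2)]] by blast
  then have d: "dpath (lo a) as w" "dpath (lo b) bs w'"
    by (auto simp: disjoint_descents_def)
  have ub: "unique_below (val (up b))" using ab by simp
  have la: "last (a # as) \<in> L" "lo (last (a # as)) = w" "last (b # bs) \<in> L"
    using last_link[OF ab(1) d(1)] last_link[OF ab(2) d(2)] by auto
  have 1: "k * (h a + sum_list (map h as)) \<le> tu a - tl (last (a # as))"
    by (rule dpath_length[OF ab(1) d(1) ab(5)])
  have 2: "k * (h b + sum_list (map h bs)) \<le> tu b - tl (last (b # bs))"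
    by (rule dpath_length[OF ab(2) d(2) ub])
  show ?thesis
  proof (rule that[OF *])
    show "k * (h a + sum_list (map h as)) \<le> tu a" using 1 tl_nonneg[OF la(1)] by linarith
    show "k * (h b + sum_list (map h bs)) \<le> tu b" using 2 tl_nonneg[OF la(3)] by linarith
    assume "w \<notin> Dn"
    then have "tl (last (a # as)) \<noteq> 0" using lo_dir[OF la(1)] la(2) by auto
    then show "k * (h a + sum_list (map h as)) < tu a" using 1 tl_nonneg[OF la(1)] by linarith
  qed
qed

text \<open>By \<open>tight\<close>, two descents from \<open>T\<close> have total length at least
  \<open>pi / k\<close>, while each has at most \<open>pi / (2 * k)\<close>. So all of them have
  exactly this length, end in Dirichlet nodes and are disjoint. The last clause, that their union
  absorbs every link sharing a free node with it, prepares a connectedness argument.\<close>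

lemma star_structure:
  assumes ab0: "a0 \<in> L" "b0 \<in> L" "a0 \<noteq> b0" "up a0 = T" "up b0 = T" "unique_below (val T)"
    and tight: "\<And>a b as bs w w'. a \<in> L \<Longrightarrow> b \<in> L \<Longrightarrow> a \<noteq> b \<Longrightarrow> up a = T \<Longrightarrow> up b = T \<Longrightarrow>
       (disjoint_descents (lo a) (lo b) as bs w w') \<or> (as = [] \<and> bs = [] \<and> w = lo a \<and> w' = lo a \<and> lo a = lo b \<and> lo a \<notin> Dn) \<Longrightarrow>
       pi \<le> k * (h a + sum_list (map h as) + (h b + sum_list (map h bs)))"
  obtains P where
    "\<And>a. a \<in> L \<Longrightarrow> up a = T \<Longrightarrow> \<exists>w\<in>Dn. dpath (lo a) (P a) w"
    "\<And>a. a \<in> L \<Longrightarrow> up a = T \<Longrightarrow> k * (h a + sum_list (map h (P a))) = pi / 2"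
    "\<And>a b. a \<in> L \<Longrightarrow> b \<in> L \<Longrightarrow> up a = T \<Longrightarrow> up b = T \<Longrightarrow> a \<noteq> b \<Longrightarrow> up ` set (P a) \<inter> up ` set (P b) = {}"
    "\<And>b c n. c \<in> L \<Longrightarrow> n = lo c \<or> n = up c \<Longrightarrow> n \<notin> Dn \<Longrightarrow> b \<in> L \<Longrightarrow> n = lo b \<or> n = up b \<Longrightarrow>
        \<exists>a. a \<in> L \<and> up a = T \<and> b \<in> set (a # P a) \<Longrightarrow> \<exists>a. a \<in> L \<and> up a = T \<and> c \<in> set (a # P a)"
proof -
  have pair: "\<exists>as bs w w'. disjoint_descents (lo a) (lo b) as bs w w' \<and> w \<in> Dn \<and> w' \<in> Dn \<and> tu a = pi / 2 \<and>
      k * (h a + sum_list (map h as)) = pi / 2"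
    if ab: "a \<in> L" "b \<in> L" "a \<noteq> b" "up a = T" "up b = T" for a b
  proof -
    obtain as bs w w' where *:
      "(disjoint_descents (lo a) (lo b) as bs w w') \<or> (as = [] \<and> bs = [] \<and> w = lo a \<and> w' = lo a \<and> lo a = lo b \<and> lo a \<notin> Dn)"
      "k * (h a + sum_list (map h as)) \<le> tu a" "k * (h b + sum_list (map h bs)) \<le> tu b"
      "w \<notin> Dn \<Longrightarrow> k * (h a + sum_list (map h as)) < tu a"
      using two_descents[OF ab(1-3)] ab ab0(6) by metis
    have "pi \<le> k * (h a + sum_list (map h as)) + k * (h b + sum_list (map h bs))"
      using tight[OF ab *(1)] by (simp add: algebra_simps)
    then have e: "k * (h a + sum_list (map h as)) = tu a" "tu a = pi / 2"
      using *(2,3) tu_le[OF ab(1)] tu_le[OF ab(2)] by linarith+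
    then have w: "w \<in> Dn" using *(4) by auto
    then have "disjoint_descents (lo a) (lo b) as bs w w'" using *(1) by auto
    moreover have "w' \<in> Dn" using calculation w by (auto simp: disjoint_descents_def)
    ultimately show ?thesis using w e by auto
  qed
  define P where "P = (\<lambda>a. SOME as. \<exists>w\<in>Dn. dpath (lo a) as w)"
  have partner: "\<exists>b. b \<in> L \<and> b \<noteq> a \<and> up b = T" if "a \<in> L" "up a = T" for a
    using ab0 that by metis
  have ex: "\<exists>as. (\<exists>w\<in>Dn. dpath (lo a) as w) \<and> k * (h a + sum_list (map h as)) = pi / 2 \<and> tu a = pi / 2"
    if a: "a \<in> L" "up a = T" for a
  proof -
    obtain b where b: "b \<in> L" "b \<noteq> a" "up b = T" using partner[OF a] by blast
    show ?thesis using pair[OF a(1) b(1) b(2)[symmetric] a(2) b(3)] unfolding disjoint_descents_def by blast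
  qed
  have P: "\<exists>w\<in>Dn. dpath (lo a) (P a) w" if a: "a \<in> L" "up a = T" for a
  proof -
    have "\<exists>as. \<exists>w\<in>Dn. dpath (lo a) as w" using ex[OF a] by blast
    then show ?thesis unfolding P_def by (rule someI_ex)
  qed
  have Puniq: "as = P a" if a: "a \<in> L" "up a = T" "dpath (lo a) as w" "w \<in> Dn" for a as w
  proof -
    obtain w' where "w' \<in> Dn" "dpath (lo a) (P a) w'" using P[OF a(1,2)] by blast
    then show ?thesis using dpath_unique[OF a(3) _ a(4) _ ab0(6)] val_less[OF a(1)] a(2) by blast
  qed
  have Plen: "k * (h a + sum_list (map h (P a))) = pi / 2" "tu a = pi / 2" if a: "a \<in> L" "up a = T" for a
    using ex[OF a] Puniq[OF a] by blast+
  \<comment> \<open>The phase at \<open>T\<close> is \<open>pi / 2\<close> on every link below it,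
    so no slope arrives there and no link can leave upwards.\<close>
  have no_lo: "lo b \<noteq> T" if "b \<in> L" for b
  proof
    assume "lo b = T"
    have TD: "T \<notin> Dn" using up_free ab0 by auto
    have "(\<Sum>a\<in>{a\<in>L. up a = T}. R a * cos (tu a)) = 0"
    proof (rule sum.neutral, intro ballI)
      fix a assume "a \<in> {a \<in> L. up a = T}"
      then have "tu a = pi / 2" using Plen(2) by blast
      then show "R a * cos (tu a) = 0" by (simp only: cos_pi_half mult_zero_right)
    qed
    then have "(\<Sum>a\<in>{a\<in>L. lo a = T}. R a * cos (tl a)) = 0" using balance[OF TD] by simp
    moreover have "0 < (\<Sum>a\<in>{a\<in>L. lo a = T}. R a * cos (tl a))"
      using that \<open>lo b = T\<close> finite_links cos_tl by (intro sum_pos) auto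
    ultimately show False by simp
  qed
  show ?thesis
  proof (rule that[of P])
    show "\<exists>w\<in>Dn. dpath (lo a) (P a) w" "k * (h a + sum_list (map h (P a))) = pi / 2" if "a \<in> L" "up a = T" for a
      using P Plen that by auto
    show "up ` set (P a) \<inter> up ` set (P b) = {}" if ab: "a \<in> L" "b \<in> L" "up a = T" "up b = T" "a \<noteq> b" for a b
    proof -
      obtain as bs w w' where *: "disjoint_descents (lo a) (lo b) as bs w w'" "w \<in> Dn" "w' \<in> Dn"
        using pair[OF ab(1,2,5,3,4)] by blast
      then have "as = P a" "bs = P b"
        using Puniq[OF ab(1,3)] Puniq[OF ab(2,4)] by (auto simp: disjoint_descents_def)
      then show ?thesis using * by (auto simp: disjoint_descents_def)
    qed
    fix b c n
    assume c: "c \<in> L" "n = lo c \<or> n = up c" and n: "n \<notin> Dn" and b: "b \<in> L" "n = lo b \<or> n = up b"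
      and "\<exists>a. a \<in> L \<and> up a = T \<and> b \<in> set (a # P a)"
    then obtain a where a: "a \<in> L" "up a = T" "b \<in> set (a # P a)" by blast
    obtain w where w: "w \<in> Dn" "dpath (lo a) (P a) w" using P[OF a(1,2)] by blast
    have next_node: "lo x \<in> up ` set as \<or> lo x = w" if "dpath m as w" "x \<in> set as" for x as m
      using that
    proof (induction as arbitrary: m)
      case (Cons y ys)
      then show ?case by (cases ys) auto
    qed simp
    have "n = T \<or> n \<in> up ` set (P a)"
    proof (cases "n = up b")
      case True
      then show ?thesis using a by auto
    next
      case False
      then have nlo: "n = lo b" using b by simp
      have "dpath T (a # P a) w" using a w by simp
      then have "lo b \<in> up ` set (a # P a) \<or> lo b = w" using next_node a(3) by blast
      then show ?thesis using nlo n w a by auto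
    qed
    then show "\<exists>a. a \<in> L \<and> up a = T \<and> c \<in> set (a # P a)"
    proof
      assume "n = T"
      then have "up c = T" using c no_lo by auto
      then show ?thesis using c by auto
    next
      assume nP: "n \<in> up ` set (P a)"
      have ub: "unique_below (val (up a))" using a ab0 by simp
      have "c \<in> set (a # P a)"
      proof (rule dpath_tight[OF a(1) w(2) ub _ c(1)])
        show "k * (h a + sum_list (map h (P a))) = tu a" using Plen[OF a(1,2)] by simp
        show "lo c \<in> up ` set (P a) \<or> up c \<in> up ` set (P a)" using c(2) nP by blast
      qed
      then show ?thesis using a by blast
    qed
  qed
qed

end

section \<open>The monotone links of an eigenfunction\<close>

text \<open>
  Every edge is cut at the maximum of its sine arch, or at its midpoint if the arch is monotone.
  On both links \<open>(e, b)\<close> of the edge \<open>e\<close> the eigenfunction is then monotone.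
\<close>

definition rising :: "('e \<times> bool \<Rightarrow> real) \<Rightarrow> 'e \<times> bool \<Rightarrow> bool" where
  "rising ph a \<longleftrightarrow> ph a < pi / 2"

text \<open>A maximum inside the edge occurs exactly if the arch rises from both ends; its distance
  from the end \<open>a\<close> is \<open>(pi / 2 - ph a) / k\<close>. Phase \<open>pi / 2\<close>
  at an end counts as not rising, because the edge is then monotone.\<close>

definition link_len :: "('v, 'e) metric_graph \<Rightarrow> real \<Rightarrow> ('e \<times> bool \<Rightarrow> real) \<Rightarrow> 'e \<times> bool \<Rightarrow> real" where
  "link_len G k ph a =
     (if rising ph (fst a, False) \<and> rising ph (fst a, True) then (pi / 2 - ph a) / k else len G (fst a) / 2)"

definition end_node :: "('v, 'e) metric_graph \<Rightarrow> 'e \<times> bool \<Rightarrow> 'v + 'e" where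
  "end_node G a = Inl (end_vertex G (fst a) (snd a))"

definition link_lo :: "('v, 'e) metric_graph \<Rightarrow> ('e \<times> bool \<Rightarrow> real) \<Rightarrow> 'e \<times> bool \<Rightarrow> 'v + 'e" where
  "link_lo G ph a = (if rising ph a then end_node G a else Inr (fst a))"

definition link_up :: "('v, 'e) metric_graph \<Rightarrow> ('e \<times> bool \<Rightarrow> real) \<Rightarrow> 'e \<times> bool \<Rightarrow> 'v + 'e" where
  "link_up G ph a = (if rising ph a then Inr (fst a) else end_node G a)"

text \<open>A link on which the arch falls away from its end \<open>a\<close> has that end as its
  upper one. Reflection at the maximum turns the phase \<open>ph a\<close> there into
  \<open>pi - ph a\<close>.\<close>

definition link_tl :: "('v, 'e) metric_graph \<Rightarrow> real \<Rightarrow> ('e \<times> bool \<Rightarrow> real) \<Rightarrow> 'e \<times> bool \<Rightarrow> real" where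
  "link_tl G k ph a = (if rising ph a then ph a else pi - ph a - k * link_len G k ph a)"

definition link_tu :: "('v, 'e) metric_graph \<Rightarrow> real \<Rightarrow> ('e \<times> bool \<Rightarrow> real) \<Rightarrow> 'e \<times> bool \<Rightarrow> real" where
  "link_tu G k ph a = (if rising ph a then ph a + k * link_len G k ph a else pi - ph a)"

definition node_val :: "('v, 'e) metric_graph \<Rightarrow> real \<Rightarrow> ('e \<Rightarrow> real) \<Rightarrow> ('e \<times> bool \<Rightarrow> real) \<Rightarrow> 'v + 'e \<Rightarrow> real" where
  "node_val G k A ph n = (case n of
     Inl v \<Rightarrow> if v \<in> dirichlet G then 0 else (let a = SOME a. a \<in> ends_at G v in A (fst a) * sin (ph a))
   | Inr e \<Rightarrow> A e * sin (ph (e, False) + k * link_len G k ph (e, False)))"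

lemma link_len_facts:
  assumes pd: "phase_data G k F A ph" and comp: "compact_metric_graph G" and e: "e \<in> F"
  shows "0 < link_len G k ph (e, b)"
    and "link_len G k ph (e, False) + link_len G k ph (e, True) = len G e"
    and "link_len G k ph (e, b) < len G e"
    and "ph (e, False) + k * link_len G k ph (e, False) + (ph (e, True) + k * link_len G k ph (e, True)) = pi"
    and "rising ph (e, b) \<Longrightarrow> ph (e, b) + k * link_len G k ph (e, b) \<le> pi / 2"
proof -
  have k: "0 < k" and p: "0 \<le> ph (e, False)" "0 \<le> ph (e, True)" "ph (e, False) + ph (e, True) + k * len G e = pi"
    using pd e by (auto simp: phase_data_def)
  have l: "0 < len G e"
    using pd e comp by (auto simp: phase_data_def separated_edges_def compact_metric_graph_def)
  have sum: "link_len G k ph (e, False) + link_len G k ph (e, True) = len G e"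
  proof (cases "rising ph (e, False) \<and> rising ph (e, True)")
    case True
    have "(pi / 2 - ph (e, False)) / k + (pi / 2 - ph (e, True)) / k = (k * len G e) / k"
    proof -
      have "(pi / 2 - ph (e, False)) + (pi / 2 - ph (e, True)) = k * len G e" using p(3) by linarith
      then show ?thesis unfolding add_divide_distrib[symmetric] by simp
    qed
    then show ?thesis using True k by (simp add: link_len_def)
  next
    case False
    show ?thesis unfolding link_len_def fst_conv if_not_P[OF False] by simp
  qed
  show pos: "0 < link_len G k ph (e, b)" for b
    using k l by (cases b) (auto simp: link_len_def rising_def)
  show "link_len G k ph (e, False) + link_len G k ph (e, True) = len G e" by (rule sum)
  show "link_len G k ph (e, b) < len G e"
    using sum pos[of False] pos[of True] by (cases b) auto
  have "k * link_len G k ph (e, False) + k * link_len G k ph (e, True) = k * len G e"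
    using sum by (simp add: distrib_left[symmetric])
  then show "ph (e, False) + k * link_len G k ph (e, False) + (ph (e, True) + k * link_len G k ph (e, True)) = pi"
    using p by linarith
  assume r: "rising ph (e, b)"
  show "ph (e, b) + k * link_len G k ph (e, b) \<le> pi / 2"
  proof (cases "rising ph (e, False) \<and> rising ph (e, True)")
    case True
    then show ?thesis using k by (simp add: link_len_def)
  next
    case False
    then have "\<not> rising ph (e, \<not> b)" using r by (cases b) auto
    then have "pi / 2 \<le> ph (e, \<not> b)" by (simp add: rising_def)
    then have "ph (e, b) + k * len G e \<le> pi / 2" using p by (cases b) auto
    moreover have "k * link_len G k ph (e, b) \<le> k * len G e"
      using \<open>link_len G k ph (e, b) < len G e\<close> k by simp
    ultimately show ?thesis by linarith
  qed
qed

text \<open>At an end vertex the balance is Kirchhoff's sum split by the sign of the cosine. At a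
  cut point the two links of the edge see phases adding up to \<open>pi\<close>, so their slopes
  cancel.\<close>

lemma phase_data_network:
  fixes G :: "('v, 'e) metric_graph"
  assumes pd: "phase_data G k F A ph" and comp: "compact_metric_graph G"
  shows "arch_network (F \<times> UNIV) (link_lo G ph) (link_up G ph) (Inl ` dirichlet G) (\<lambda>a. A (fst a))
    (link_tl G k ph) (link_tu G k ph) (link_len G k ph) (node_val G k A ph) k"
proof -
  have k: "0 < k" and FE: "F \<subseteq> edges G" and A: "\<And>e. e \<in> F \<Longrightarrow> 0 < A e"
    using pd by (auto simp: phase_data_def separated_edges_def)
  have finF: "finite F" using FE comp by (auto simp: compact_metric_graph_def intro: finite_subset)
  have p0: "0 \<le> ph a" if "fst a \<in> F" for a
    using pd that by (cases a; cases "snd a") (auto simp: phase_data_def)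
  note facts = link_len_facts[OF pd comp]
  have other: "ph (e, b) + k * link_len G k ph (e, b) = pi - (ph (e, \<not> b) + k * link_len G k ph (e, \<not> b))"
    if "e \<in> F" for e b
    using facts(4)[OF that] by (cases b) auto
  have endV: "end_vertex G e b \<in> verts G" if "e \<in> F" for e b
    using that FE comp by (auto simp: compact_metric_graph_def end_vertex_def)
  have free: "(\<exists>c>0. \<forall>a\<in>ends_at G v. A (fst a) * sin (ph a) = c) \<and> (\<Sum>a\<in>ends_at G v. A (fst a) * cos (ph a)) = 0
     \<and> ends_at G v \<subseteq> F \<times> UNIV"
    if "v \<in> verts G" "v \<notin> dirichlet G" "a \<in> ends_at G v" "fst a \<in> F" for v a
  proof -
    have "ends_at G v \<subseteq> F \<times> UNIV"
    proof -
      have "a \<in> ends_at G v \<inter> F \<times> UNIV" using that by (cases a) auto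
      then show ?thesis using pd that unfolding phase_data_def separated_edges_def by blast
    qed
    then show ?thesis using pd that unfolding phase_data_def by blast
  qed
  have val_end: "node_val G k A ph (end_node G a) = A (fst a) * sin (ph a)" if a: "fst a \<in> F" for a
  proof -
    define v where "v = end_vertex G (fst a) (snd a)"
    have av: "a \<in> ends_at G v" using a FE by (cases a) (auto simp: ends_at_def v_def)
    show ?thesis
    proof (cases "v \<in> dirichlet G")
      case True
      then have "ph a = 0" using pd av a by (auto simp: phase_data_def)
      then show ?thesis using True by (simp add: node_val_def end_node_def v_def)
    next
      case False
      have "(SOME a. a \<in> ends_at G v) \<in> ends_at G v" using av by (rule someI)
      moreover obtain c where "\<forall>a\<in>ends_at G v. A (fst a) * sin (ph a) = c"
        using free[OF _ False av a] endV[OF a] by (auto simp: v_def)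
      ultimately show ?thesis using False av by (simp add: node_val_def end_node_def v_def[symmetric] Let_def)
    qed
  qed
  have val_mid: "node_val G k A ph (Inr (fst a)) = A (fst a) * sin (ph a + k * link_len G k ph a)" if a: "fst a \<in> F" for a
  proof -
    obtain e b where ab: "a = (e, b)" by (cases a)
    have "sin (ph (e, True) + k * link_len G k ph (e, True)) = sin (ph (e, False) + k * link_len G k ph (e, False))"
      using other[of e True] a unfolding ab by (simp add: sin_pi_minus del: mult.commute)
    then show ?thesis unfolding ab by (cases b) (simp_all add: node_val_def)
  qed
  show ?thesis
  proof
    show "finite (F \<times> (UNIV :: bool set))" using finF by simp
    show "0 < k" by (rule k)
  next
    fix a :: "'e \<times> bool" assume "a \<in> F \<times> UNIV"
    then have aF: "fst a \<in> F" by auto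
    obtain e b where ab: "a = (e, b)" by (cases a)
    have e: "e \<in> F" using aF ab by simp
    show "0 < A (fst a)" by (rule A[OF aF])
    show "0 < link_len G k ph a" using facts(1)[OF e] ab by simp
    show "0 \<le> link_tl G k ph a"
    proof -
      have "0 \<le> k * link_len G k ph (e, \<not> b)" using facts(1)[OF e, of "\<not> b"] k by simp
      then show ?thesis
        using p0[OF aF] p0[of "(e, \<not> b)"] other[OF e, of b] e by (simp add: link_tl_def ab)
    qed
    show "link_tu G k ph a = link_tl G k ph a + k * link_len G k ph a"
      by (simp add: link_tu_def link_tl_def)
    show "link_tu G k ph a \<le> pi / 2"
      using facts(5)[OF e, of b] by (auto simp: link_tu_def ab rising_def)
    show "node_val G k A ph (link_lo G ph a) = A (fst a) * sin (link_tl G k ph a)"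
      using val_end[OF aF] val_mid[OF aF] sin_pi_minus[of "ph a + k * link_len G k ph a"]
      by (simp add: link_lo_def link_tl_def algebra_simps)
    show "node_val G k A ph (link_up G ph a) = A (fst a) * sin (link_tu G k ph a)"
      using val_end[OF aF] val_mid[OF aF] by (simp add: link_up_def link_tu_def)
    assume z: "link_tl G k ph a = 0"
    \<comment> \<open>Where the arch falls away from the end, it continues beyond the cut point on a
      link of positive length, so the phase cannot be zero there yet.\<close>
    have r: "rising ph a"
    proof (rule ccontr)
      assume "\<not> rising ph a"
      then have "ph (e, \<not> b) + k * link_len G k ph (e, \<not> b) = 0"
        using z other[OF e, of b] by (simp add: link_tl_def ab)
      then show False using p0[of "(e, \<not> b)"] facts(1)[OF e, of "\<not> b"] k e
        by (simp add: add_nonneg_eq_0_iff)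
    qed
    then have p: "ph a = 0" using z by (simp add: link_tl_def)
    define v where "v = end_vertex G (fst a) (snd a)"
    have av: "a \<in> ends_at G v" using aF FE by (cases a) (auto simp: ends_at_def v_def)
    have "v \<in> dirichlet G"
    proof (rule ccontr)
      assume v: "v \<notin> dirichlet G"
      obtain c where "c > 0" "\<forall>a\<in>ends_at G v. A (fst a) * sin (ph a) = c"
        using free[OF _ v av aF] endV[OF aF] by (auto simp: v_def)
      then show False using av p by force
    qed
    then show "link_lo G ph a \<in> Inl ` dirichlet G"
      using r by (simp add: link_lo_def end_node_def v_def)
  next
    fix n assume "n \<in> (Inl ` dirichlet G :: ('v + 'e) set)"
    then show "node_val G k A ph n = 0" by (auto simp: node_val_def)
  next
    fix n :: "'v + 'e" assume n: "n \<notin> Inl ` dirichlet G"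
    show "(\<Sum>a | a \<in> F \<times> UNIV \<and> link_up G ph a = n. A (fst a) * cos (link_tu G k ph a)) =
         (\<Sum>a | a \<in> F \<times> UNIV \<and> link_lo G ph a = n. A (fst a) * cos (link_tl G k ph a))"
    proof (cases n)
      case (Inr e)
      have *: "(\<Sum>a | a \<in> F \<times> UNIV \<and> link_up G ph a = n. A (fst a) * cos (link_tu G k ph a)) -
         (\<Sum>a | a \<in> F \<times> UNIV \<and> link_lo G ph a = n. A (fst a) * cos (link_tl G k ph a))
        = (\<Sum>a\<in>{a \<in> F \<times> UNIV. fst a = e}. A e * cos (ph a + k * link_len G k ph a))"
      proof -
        have "{a \<in> F \<times> UNIV. fst a = e} = {a \<in> F \<times> UNIV. link_up G ph a = n} \<union> {a \<in> F \<times> UNIV. link_lo G ph a = n}"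
          by (auto simp: Inr link_up_def link_lo_def end_node_def)
        moreover have "{a \<in> F \<times> UNIV. link_up G ph a = n} \<inter> {a \<in> F \<times> UNIV. link_lo G ph a = n} = {}"
          by (auto simp: Inr link_up_def link_lo_def end_node_def)
        moreover have "(\<Sum>a | a \<in> F \<times> UNIV \<and> link_up G ph a = n. A (fst a) * cos (link_tu G k ph a)) =
            (\<Sum>a | a \<in> F \<times> UNIV \<and> link_up G ph a = n. A e * cos (ph a + k * link_len G k ph a))"
          by (rule sum.cong) (auto simp: Inr link_up_def link_tu_def end_node_def split: if_splits)
        moreover have "cos (pi - ph a - k * link_len G k ph a) = - cos (ph a + k * link_len G k ph a)" for a
          using cos_pi_minus[of "ph a + k * link_len G k ph a"] by (simp add: algebra_simps)
        then have "(\<Sum>a | a \<in> F \<times> UNIV \<and> link_lo G ph a = n. A (fst a) * cos (link_tl G k ph a)) =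
            (\<Sum>a | a \<in> F \<times> UNIV \<and> link_lo G ph a = n. - (A e * cos (ph a + k * link_len G k ph a)))"
          by (intro sum.cong) (auto simp: Inr link_lo_def link_tl_def end_node_def split: if_splits)
        ultimately show ?thesis
          using finF by (simp add: sum.union_disjoint sum_negf)
      qed
      also have "\<dots> = 0"
      proof (cases "e \<in> F")
        case True
        then have "{a \<in> F \<times> UNIV. fst a = e} = {(e, False), (e, True)}" by auto
        moreover have "cos (ph (e, True) + k * link_len G k ph (e, True)) = - cos (ph (e, False) + k * link_len G k ph (e, False))"
          using other[OF True, of True] cos_pi_minus by simp
        ultimately show ?thesis by simp
      qed (auto intro: sum.neutral)
      finally show ?thesis by simp
    next
      case (Inl v)
      show ?thesis
      proof (cases "\<exists>a. a \<in> ends_at G v \<and> fst a \<in> F")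
        case False
        then have "{a \<in> F \<times> UNIV. link_up G ph a = n} = {}" "{a \<in> F \<times> UNIV. link_lo G ph a = n} = {}"
          using FE by (auto simp: Inl link_up_def link_lo_def end_node_def ends_at_def split: if_splits)
        then show ?thesis by (metis sum.empty)
      next
        case True
        then obtain a0 where a0: "a0 \<in> ends_at G v" "fst a0 \<in> F" by blast
        have "v \<in> verts G" using a0 endV by (auto simp: ends_at_def)
        moreover have "v \<notin> dirichlet G" using n Inl by auto
        ultimately have z: "(\<Sum>a\<in>ends_at G v. A (fst a) * cos (ph a)) = 0" "ends_at G v \<subseteq> F \<times> UNIV"
          using free[OF _ _ a0] by auto
        have "ends_at G v = {a \<in> F \<times> UNIV. link_up G ph a = n} \<union> {a \<in> F \<times> UNIV. link_lo G ph a = n}"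
          using z(2) FE by (auto simp: Inl link_up_def link_lo_def end_node_def ends_at_def)
        moreover have "{a \<in> F \<times> UNIV. link_up G ph a = n} \<inter> {a \<in> F \<times> UNIV. link_lo G ph a = n} = {}"
          by (auto simp: Inl link_up_def link_lo_def end_node_def)
        ultimately have "(\<Sum>a\<in>ends_at G v. A (fst a) * cos (ph a)) =
           (\<Sum>a | a \<in> F \<times> UNIV \<and> link_up G ph a = n. A (fst a) * cos (ph a)) +
           (\<Sum>a | a \<in> F \<times> UNIV \<and> link_lo G ph a = n. A (fst a) * cos (ph a))"
          using finF by (simp add: sum.union_disjoint)
        moreover have "(\<Sum>a | a \<in> F \<times> UNIV \<and> link_up G ph a = n. A (fst a) * cos (link_tu G k ph a)) =
            (\<Sum>a | a \<in> F \<times> UNIV \<and> link_up G ph a = n. - (A (fst a) * cos (ph a)))"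
          by (rule sum.cong) (auto simp: Inl link_up_def link_tu_def split: if_splits)
        moreover have "(\<Sum>a | a \<in> F \<times> UNIV \<and> link_lo G ph a = n. A (fst a) * cos (link_tl G k ph a)) =
            (\<Sum>a | a \<in> F \<times> UNIV \<and> link_lo G ph a = n. A (fst a) * cos (ph a))"
          by (rule sum.cong) (auto simp: Inl link_lo_def link_tl_def split: if_splits)
        ultimately show ?thesis using z(1) by (simp add: sum_negf)
      qed
    qed
  qed
qed

section \<open>The topology of a metric graph\<close>

lemma chart_in_points:
  "compact_metric_graph M \<Longrightarrow> e \<in> edges M \<Longrightarrow> chart M e t \<in> points M"
  by (auto simp: chart_def points_def compact_metric_graph_def)

lemma chart_ends: "e \<in> edges M \<Longrightarrow> compact_metric_graph M \<Longrightarrow>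
   chart M e 0 = Vertex (src M e) \<and> chart M e (len M e) = Vertex (tgt M e)"
  by (auto simp: chart_def compact_metric_graph_def)

lemma continuous_map_chart:
  assumes "compact_metric_graph M" "e \<in> edges M"
  shows "continuous_map (top_of_set {0..len M e}) (mg_topology M) (chart M e)"
  unfolding continuous_map_def
  using assms by (auto simp: openin_mg_topology topspace_mg_topology chart_in_points)

text \<open>The universal property of the quotient topology.\<close>

lemma continuous_map_mg_iff:
  assumes "compact_metric_graph M"
  shows "continuous_map (mg_topology M) Y f \<longleftrightarrow> f \<in> points M \<rightarrow> topspace Y \<and>
    (\<forall>e\<in>edges M. continuous_map (top_of_set {0..len M e}) Y (\<lambda>t. f (chart M e t)))"
proof (intro iffI conjI ballI)
  assume c: "continuous_map (mg_topology M) Y f"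
  then show "f \<in> points M \<rightarrow> topspace Y" by (auto simp: continuous_map_def topspace_mg_topology[OF assms])
  show "continuous_map (top_of_set {0..len M e}) Y (\<lambda>t. f (chart M e t))" if "e \<in> edges M" for e
    using continuous_map_compose[OF continuous_map_chart[OF assms that] c] by (simp add: o_def)
next
  assume a: "f \<in> points M \<rightarrow> topspace Y \<and>
    (\<forall>e\<in>edges M. continuous_map (top_of_set {0..len M e}) Y (\<lambda>t. f (chart M e t)))"
  show "continuous_map (mg_topology M) Y f"
    unfolding continuous_map_def topspace_mg_topology[OF assms] openin_mg_topology
  proof (intro conjI allI impI ballI)
    fix U e assume U: "openin Y U" and e: "e \<in> edges M"
    have "openin (top_of_set {0..len M e}) {t \<in> topspace (top_of_set {0..len M e}). f (chart M e t) \<in> U}"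
      using a e U unfolding continuous_map_def by blast
    moreover have "{t \<in> topspace (top_of_set {0..len M e}). f (chart M e t) \<in> U} =
        {t \<in> {0..len M e}. chart M e t \<in> {x \<in> points M. f x \<in> U}}"
      using chart_in_points[OF assms e] by auto
    ultimately show "openin (top_of_set {0..len M e}) {t \<in> {0..len M e}. chart M e t \<in> {x \<in> points M. f x \<in> U}}"
      by simp
  qed (use a in auto)
qed

text \<open>With the Hausdorff property below, this makes a continuous bijection between metric
  graphs a homeomorphism.\<close>

lemma compact_space_mg:
  fixes M :: "('v, 'e) metric_graph"
  assumes comp: "compact_metric_graph M"
  shows "compact_space (mg_topology M)"
proof -
  have "points M = Vertex ` verts M \<union> (\<Union>e\<in>edges M. chart M e ` {0..len M e})"
  proof (intro equalityI subsetI)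
    fix p assume "p \<in> points M"
    then consider v where "p = Vertex v" "v \<in> verts M"
      | e t where "p = Inner e t" "e \<in> edges M" "0 < t" "t < len M e"
      by (auto simp: points_def)
    then show "p \<in> Vertex ` verts M \<union> (\<Union>e\<in>edges M. chart M e ` {0..len M e})"
    proof cases
      case 2
      then have "p = chart M e t" "t \<in> {0..len M e}" by (auto simp: chart_def)
      then show ?thesis using 2 by blast
    qed auto
  next
    fix p assume "p \<in> Vertex ` verts M \<union> (\<Union>e\<in>edges M. chart M e ` {0..len M e})"
    then show "p \<in> points M" using chart_in_points[OF comp] by (auto simp: points_def)
  qed
  moreover have "compactin (mg_topology M) (Vertex ` verts M)"
    by (rule finite_imp_compactin)
      (use comp in \<open>auto simp: topspace_mg_topology[OF comp] points_def compact_metric_graph_def\<close>)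
  moreover have "compactin (mg_topology M) (\<Union>e\<in>edges M. chart M e ` {0..len M e})"
  proof (rule compactin_Union)
    show "finite ((\<lambda>e. chart M e ` {0..len M e}) ` edges M)"
      using comp by (simp add: compact_metric_graph_def)
    fix S assume "S \<in> (\<lambda>e. chart M e ` {0..len M e}) ` edges M"
    then obtain e where e: "e \<in> edges M" "S = chart M e ` {0..len M e}" by blast
    have "compactin (top_of_set {0..len M e}) {0..len M e}"
      by (simp add: compactin_subtopology compactin_euclidean_iff)
    then show "compactin (mg_topology M) S"
      unfolding e(2) using image_compactin continuous_map_chart[OF comp e(1)] by blast
  qed
  ultimately show ?thesis
    unfolding compact_space_def topspace_mg_topology[OF comp] by (simp add: compactin_Un)
qed

text \<open>Any two points are separated by a real function that is polynomial on every edge.\<close>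

lemma Hausdorff_space_mg:
  fixes M :: "('v, 'e) metric_graph"
  assumes comp: "compact_metric_graph M"
  shows "Hausdorff_space (mg_topology M)"
proof -
  have sep: "\<exists>f. continuous_map (mg_topology M) euclideanreal f \<and> f p \<noteq> f q"
    if pq: "p \<in> points M" "q \<in> points M" "p \<noteq> q" for p q
  proof -
    \<comment> \<open>The factor \<open>t * (len M e - t)\<close> vanishes at both ends, so the
      extension by zero is continuous. With \<open>g = 1\<close> it detects the inner points of
      \<open>e\<close>; dividing the case \<open>g = t\<close> by it recovers the position.\<close>
    define bump :: "'e \<Rightarrow> (real \<Rightarrow> real) \<Rightarrow> ('v, 'e) point \<Rightarrow> real" where "bump = (\<lambda>e g p. case p of Vertex v \<Rightarrow> 0
      | Inner e' t \<Rightarrow> if e' = e then t * (len M e - t) * g t else (0::real))"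
    \<comment> \<open>The piecewise linear interpolation of the indicator of the vertex
      \<open>v\<close>.\<close>
    define hat :: "'v \<Rightarrow> ('v, 'e) point \<Rightarrow> real" where "hat = (\<lambda>v p. case p of Vertex w \<Rightarrow> (if w = v then 1 else 0)
      | Inner e t \<Rightarrow> (1 - t / len M e) * (if src M e = v then 1 else 0) +
          t / len M e * (if tgt M e = v then 1 else (0::real)))"
    have len: "0 < len M e" if "e \<in> edges M" for e
      using comp that by (auto simp: compact_metric_graph_def)
    have bump: "continuous_map (mg_topology M) euclideanreal (bump e g)"
      if "continuous_on UNIV g" for e g
      unfolding continuous_map_mg_iff[OF comp]
    proof (intro conjI ballI)
      fix e' assume e': "e' \<in> edges M"
      have "continuous_on {0..len M e'} g" using that continuous_on_subset by blast
      then have "continuous_on {0..len M e'} (\<lambda>t. if e' = e then t * (len M e - t) * g t else 0)"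
        by (cases "e' = e") (auto intro!: continuous_intros)
      moreover have "bump e g (chart M e' t) = (if e' = e then t * (len M e - t) * g t else 0)"
        if "t \<in> {0..len M e'}" for t
        using that by (auto simp: bump_def chart_def)
      ultimately have "continuous_on {0..len M e'} (\<lambda>t. bump e g (chart M e' t))"
        by (subst continuous_on_cong[OF refl])
      then show "continuous_map (top_of_set {0..len M e'}) euclideanreal (\<lambda>t. bump e g (chart M e' t))"
        by simp
    qed simp
    have hat: "continuous_map (mg_topology M) euclideanreal (hat v)" for v
      unfolding continuous_map_mg_iff[OF comp]
    proof (intro conjI ballI)
      fix e assume e: "e \<in> edges M"
      have "continuous_on {0..len M e} (\<lambda>t. (1 - t / len M e) * (if src M e = v then 1 else 0) +
          t / len M e * (if tgt M e = v then 1 else 0))"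
        using len[OF e] by (intro continuous_intros) auto
      moreover have "hat v (chart M e t) = (1 - t / len M e) * (if src M e = v then 1 else 0) +
          t / len M e * (if tgt M e = v then 1 else 0)" if "t \<in> {0..len M e}" for t
        using that len[OF e] by (auto simp: hat_def chart_def)
      ultimately have "continuous_on {0..len M e} (\<lambda>t. hat v (chart M e t))"
        by (subst continuous_on_cong[OF refl])
      then show "continuous_map (top_of_set {0..len M e}) euclideanreal (\<lambda>t. hat v (chart M e t))"
        by simp
    qed simp
    have inner: "\<exists>f. continuous_map (mg_topology M) euclideanreal f \<and> f (Inner e t) \<noteq> f q'"
      if e: "e \<in> edges M" "0 < t" "t < len M e" and q': "Inner e t \<noteq> q'" "q' \<in> points M" for e t q'
    proof (cases "bump e (\<lambda>_. 1) q' = bump e (\<lambda>_. 1) (Inner e t)")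
      case False
      then show ?thesis using bump[OF continuous_on_const, of e 1] by (intro exI[of _ "bump e (\<lambda>_. 1)"]) auto
    next
      case True
      then have "bump e (\<lambda>_. 1) q' \<noteq> 0" using e by (simp add: bump_def)
      then obtain t' where t': "q' = Inner e t'" by (auto simp: bump_def split: point.splits if_splits)
      then have "bump e (\<lambda>t. t) q' \<noteq> bump e (\<lambda>t. t) (Inner e t)"
        using True q' e by (simp add: bump_def)
      then show ?thesis using bump[OF continuous_on_id, of e] by (intro exI[of _ "bump e (\<lambda>t. t)"]) auto
    qed
    show ?thesis
    proof (cases p)
      case (Inner e t)
      then show ?thesis using inner[of e t q] pq by (auto simp: points_def)
    next
      case p: (Vertex v)
      show ?thesis
      proof (cases q)
        case (Inner e t)
        then obtain f where "continuous_map (mg_topology M) euclideanreal f" "f q \<noteq> f p"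
          using inner[of e t p] pq by (auto simp: points_def)
        then show ?thesis by (intro exI[of _ f]) auto
      next
        case (Vertex w)
        then show ?thesis using p pq hat[of v] by (intro exI[of _ "hat v"]) (auto simp: hat_def)
      qed
    qed
  qed
  show ?thesis
    unfolding Hausdorff_space_def topspace_mg_topology[OF comp]
  proof (intro allI impI, elim conjE)
    fix p q assume pq: "p \<in> points M" "q \<in> points M" "p \<noteq> q"
    obtain f where f: "continuous_map (mg_topology M) euclideanreal f" "f p \<noteq> f q" using sep[OF pq] by blast
    obtain U V where UV: "open U" "open V" "f p \<in> U" "f q \<in> V" "U \<inter> V = {}"
      using hausdorff[OF f(2)] by blast
    have "openin (mg_topology M) {x \<in> points M. f x \<in> U}" "openin (mg_topology M) {x \<in> points M. f x \<in> V}"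
      using f(1) UV unfolding continuous_map_def topspace_mg_topology[OF comp] by auto
    then show "\<exists>U V. openin (mg_topology M) U \<and> openin (mg_topology M) V \<and> p \<in> U \<and> q \<in> V \<and> disjnt U V"
      using UV pq by (intro exI[of _ "{x \<in> points M. f x \<in> U}"] exI[of _ "{x \<in> points M. f x \<in> V}"])
        (auto simp: disjnt_iff)
  qed
qed

section \<open>Unit-speed arcs\<close>

lemma isometric_image_lebesgue:
  fixes W :: "real set"
  assumes "W \<in> sets lebesgue" "r = 1 \<or> r = - 1"
  shows "(\<lambda>t. c + r * t) ` W \<in> sets lebesgue" "measure lebesgue ((\<lambda>t. c + r * t) ` W) = measure lebesgue W"
proof -
  have m: "(\<lambda>t. - (r * c) + r * t) \<in> lebesgue \<rightarrow>\<^sub>M lebesgue"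
    using lebesgue_affine_measurable[of "\<lambda>_. r" "- (r * c)"] assms(2) by auto
  have inv: "x = c + r * t \<longleftrightarrow> t = - (r * c) + r * x" for x t
    using assms(2) by auto
  have "(\<lambda>t. c + r * t) ` W = (\<lambda>t. - (r * c) + r * t) -` W \<inter> space lebesgue"
    unfolding set_eq_iff image_iff inv by simp
  then show "(\<lambda>t. c + r * t) ` W \<in> sets lebesgue"
    using measurable_sets[OF m assms(1)] by simp
  show "measure lebesgue ((\<lambda>t. c + r * t) ` W) = measure lebesgue W"
    using measure_lebesgue_affine[of r c W] assms(2) by (auto simp: add.commute)
qed

definition inner_params :: "('v, 'e) metric_graph \<Rightarrow> 'e \<Rightarrow> ('v, 'e) point set \<Rightarrow> real set" where
  "inner_params M e X = {t \<in> {0<..<len M e}. Inner e t \<in> X}"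

text \<open>\<open>total_length\<close> is defined for every set, but additivity is available only
  for sets with measurable traces on the edges.\<close>

definition measurable_part :: "('v, 'e) metric_graph \<Rightarrow> ('v, 'e) point set \<Rightarrow> bool" where
  "measurable_part M X \<longleftrightarrow> (\<forall>e\<in>edges M. inner_params M e X \<in> sets lebesgue)"

lemma total_length_inner: "total_length M X = (\<Sum>e\<in>edges M. measure lebesgue (inner_params M e X))"
  by (simp add: total_length_def inner_params_def)

lemma inner_params_fmeasurable:
  "measurable_part M X \<Longrightarrow> e \<in> edges M \<Longrightarrow> inner_params M e X \<in> fmeasurable lebesgue"
  by (rule fmeasurableI2[of "{0<..<len M e}"]) (auto simp: measurable_part_def inner_params_def)

lemma measurable_part_Un:
  "measurable_part M X \<Longrightarrow> measurable_part M Y \<Longrightarrow> measurable_part M (X \<union> Y)"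
proof -
  assume a: "measurable_part M X" "measurable_part M Y"
  have "inner_params M e (X \<union> Y) = inner_params M e X \<union> inner_params M e Y" for e
    by (auto simp: inner_params_def)
  then show ?thesis using a by (auto simp: measurable_part_def)
qed

lemma total_length_Un:
  assumes X: "measurable_part M X" and Y: "measurable_part M Y" and fin: "finite (X \<inter> Y)"
  shows "total_length M (X \<union> Y) = total_length M X + total_length M Y"
proof -
  have "measure lebesgue (inner_params M e (X \<union> Y)) =
      measure lebesgue (inner_params M e X) + measure lebesgue (inner_params M e Y)" if e: "e \<in> edges M" for e
  proof -
    have "inner_params M e X \<inter> inner_params M e Y \<subseteq> (\<lambda>p. case p of Inner e t \<Rightarrow> t | Vertex v \<Rightarrow> 0) ` (X \<inter> Y)"
      by (force simp: inner_params_def image_iff)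
    then have "finite (inner_params M e X \<inter> inner_params M e Y)"
      using fin by (meson finite_imageI finite_subset)
    then have "AE t in lebesgue. t \<notin> inner_params M e X \<inter> inner_params M e Y"
      by (intro AE_not_in) (simp add: negligible_iff_null_sets[symmetric] negligible_finite)
    then have "AE t in lebesgue. t \<notin> inner_params M e X \<or> t \<notin> inner_params M e Y" by simp
    moreover have "inner_params M e (X \<union> Y) = inner_params M e X \<union> inner_params M e Y"
      by (auto simp: inner_params_def)
    ultimately show ?thesis
      using measure_Un_AE inner_params_fmeasurable[OF X e] inner_params_fmeasurable[OF Y e] by metis
  qed
  then show ?thesis by (simp add: total_length_inner sum.distrib)
qed

text \<open>For cycles the total length of the image would be enough. All measurable parameter sets
  are required since \<open>same_metric_graph\<close> compares the lengths of arbitrary open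
  sets.\<close>

definition unit_arc ::
    "('v, 'e) metric_graph \<Rightarrow> real \<Rightarrow> (real \<Rightarrow> ('v, 'e) point) \<Rightarrow> ('v, 'e) point \<Rightarrow> ('v, 'e) point \<Rightarrow> bool" where
  "unit_arc M l P p q \<longleftrightarrow> 0 \<le> l \<and> continuous_map (top_of_set {0..l}) (mg_topology M) P \<and>
     inj_on P {0..l} \<and> P 0 = p \<and> P l = q \<and>
     (\<forall>W\<in>sets lebesgue. W \<subseteq> {0..l} \<longrightarrow> measurable_part M (P ` W) \<and> total_length M (P ` W) = measure lebesgue W)"

text \<open>The bound on \<open>\<bar>x - y\<bar>\<close> excludes the two ends of a loop, which the
  chart identifies.\<close>

lemma chart_inj:
  "chart M e x = chart M e y \<Longrightarrow> x \<in> {0..len M e} \<Longrightarrow> y \<in> {0..len M e} \<Longrightarrow> \<bar>x - y\<bar> < len M e \<Longrightarrow> x = y"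
  by (auto simp: chart_def split: if_splits)

text \<open>The strict bound \<open>l < len M e\<close> keeps the arc injective even on a loop.
  Links satisfy it because each edge consists of two of them.\<close>

lemma unit_arc_edge:
  fixes M :: "('v, 'e) metric_graph"
  assumes comp: "compact_metric_graph M" and e: "e \<in> edges M" and r: "r = 1 \<or> r = - 1" and l: "0 < l" "l < len M e"
    and sub: "c \<in> {0..len M e}" "c + r * l \<in> {0..len M e}"
  shows "unit_arc M l (\<lambda>t. chart M e (c + r * t)) (chart M e c) (chart M e (c + r * l))"
    "(\<lambda>t. chart M e (c + r * t)) ` {0<..<l} = {Inner e t | t. min c (c + r * l) < t \<and> t < max c (c + r * l)}"
proof -
  have in_edge: "c + r * t \<in> {0..len M e}" if "t \<in> {0..l}" for t
    using r sub that by auto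
  have inside: "0 < c + r * t \<and> c + r * t < len M e" if "t \<in> {0<..<l}" for t
    using r sub that by auto
  have "continuous_map (top_of_set {0..l}) (top_of_set {0..len M e}) (\<lambda>t. c + r * t)"
    using in_edge by (auto intro!: continuous_intros)
  from continuous_map_compose[OF this continuous_map_chart[OF comp e]]
  have cont: "continuous_map (top_of_set {0..l}) (mg_topology M) (\<lambda>t. chart M e (c + r * t))"
    by (simp add: o_def)
  have inj: "inj_on (\<lambda>t. chart M e (c + r * t)) {0..l}"
  proof (rule inj_onI)
    fix s t assume st: "s \<in> {0..l}" "t \<in> {0..l}" and eq: "chart M e (c + r * s) = chart M e (c + r * t)"
    have d: "\<bar>(c + r * s) - (c + r * t)\<bar> < len M e" using r st l by auto
    have "c + r * s = c + r * t"
      by (rule chart_inj[OF eq in_edge[OF st(1)] in_edge[OF st(2)] d])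
    then show "s = t" using r by auto
  qed
  have meas: "measurable_part M ((\<lambda>t. chart M e (c + r * t)) ` W) \<and>
      total_length M ((\<lambda>t. chart M e (c + r * t)) ` W) = measure lebesgue W"
    if W: "W \<in> sets lebesgue" "W \<subseteq> {0..l}" for W
  proof -
    let ?X = "(\<lambda>t. chart M e (c + r * t)) ` W"
    have other: "inner_params M e' ?X = {}" if "e' \<noteq> e" for e'
      using that by (auto simp: inner_params_def chart_def split: if_splits)
    have this_edge: "inner_params M e ?X = (\<lambda>t. c + r * t) ` W - {0, len M e}"
    proof (intro equalityI subsetI)
      fix x assume "x \<in> inner_params M e ?X"
      then obtain t where "t \<in> W" "Inner e x = chart M e (c + r * t)" "0 < x" "x < len M e"
        by (auto simp: inner_params_def)
      then show "x \<in> (\<lambda>t. c + r * t) ` W - {0, len M e}"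
        by (auto simp: chart_def split: if_splits)
    next
      fix x assume x: "x \<in> (\<lambda>t. c + r * t) ` W - {0, len M e}"
      then obtain t where t: "t \<in> W" "x = c + r * t" "x \<noteq> 0" "x \<noteq> len M e" by auto
      then have "0 < x" "x < len M e" using in_edge[of t] W by auto
      then show "x \<in> inner_params M e ?X"
        using t by (auto simp: inner_params_def chart_def intro!: image_eqI[of _ _ t])
    qed
    note img = isometric_image_lebesgue[OF W(1) r, of c]
    have s: "inner_params M e ?X \<in> sets lebesgue"
      unfolding this_edge using img(1) by auto
    have "measure lebesgue (inner_params M e ?X) = measure lebesgue ((\<lambda>t. c + r * t) ` W)"
      unfolding this_edge using img(1) by (intro measure_Diff_null_set) (auto simp: negligible_iff_null_sets[symmetric])
    then have m: "measure lebesgue (inner_params M e ?X) = measure lebesgue W" using img(2) by simp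
    have "measurable_part M ?X" unfolding measurable_part_def using s other by (metis sets.empty_sets)
    moreover have "total_length M ?X = measure lebesgue W"
    proof -
      have "total_length M ?X = (\<Sum>e'\<in>edges M. if e' = e then measure lebesgue W else 0)"
        unfolding total_length_inner by (rule sum.cong) (auto simp: other m)
      also have "\<dots> = measure lebesgue W"
        using e comp by (simp add: compact_metric_graph_def)
      finally show ?thesis .
    qed
    ultimately show ?thesis by blast
  qed
  show "unit_arc M l (\<lambda>t. chart M e (c + r * t)) (chart M e c) (chart M e (c + r * l))"
    unfolding unit_arc_def using l cont inj meas by auto
  show "(\<lambda>t. chart M e (c + r * t)) ` {0<..<l} = {Inner e t | t. min c (c + r * l) < t \<and> t < max c (c + r * l)}"
  proof (intro equalityI subsetI)
    fix p :: "('v, 'e) point" assume "p \<in> (\<lambda>t. chart M e (c + r * t)) ` {0<..<l}"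
    then obtain t where t: "t \<in> {0<..<l}" "p = chart M e (c + r * t)" by blast
    then have "p = Inner e (c + r * t)" using inside[OF t(1)] by (simp add: chart_def)
    then show "p \<in> {Inner e t | t. min c (c + r * l) < t \<and> t < max c (c + r * l)}" using r t by auto
  next
    fix p :: "('v, 'e) point" assume "p \<in> {Inner e t | t. min c (c + r * l) < t \<and> t < max c (c + r * l)}"
    then obtain x where x: "p = Inner e x" "min c (c + r * l) < x" "x < max c (c + r * l)" by blast
    define t where "t = r * (x - c)"
    have t: "t \<in> {0<..<l}" "c + r * t = x" using x r l by (auto simp: t_def min_def max_def split: if_splits)
    then have "p = chart M e (c + r * t)" using inside[OF t(1)] x(1) by (simp add: chart_def)
    then show "p \<in> (\<lambda>t. chart M e (c + r * t)) ` {0<..<l}" using t by blast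
  qed
qed

definition join_arcs :: "real \<Rightarrow> (real \<Rightarrow> 'p) \<Rightarrow> (real \<Rightarrow> 'p) \<Rightarrow> real \<Rightarrow> 'p" where
  "join_arcs l P Q t = (if t \<le> l then P t else Q (t - l))"

lemma join_arcs_image:
  assumes "0 \<le> l" "0 \<le> l'" "P l = Q 0" "W \<subseteq> {0..l + l'}"
  shows "join_arcs l P Q ` W = P ` (W \<inter> {0..l}) \<union> Q ` ((\<lambda>t. - l + 1 * t) ` (W \<inter> {l..l + l'}))"
  using assms by (force simp: join_arcs_def image_iff)

lemma unit_arc_join:
  assumes P: "unit_arc M l P p q" and Q: "unit_arc M l' Q q z"
    and int: "P ` {0..l} \<inter> Q ` {0..l'} = {q}"
  shows "unit_arc M (l + l') (join_arcs l P Q) p z"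
    "join_arcs l P Q ` {0..l + l'} = P ` {0..l} \<union> Q ` {0..l'}"
proof -
  have l: "0 \<le> l" "0 \<le> l'" and eq: "P l = Q 0" and inj: "inj_on P {0..l}" "inj_on Q {0..l'}"
    and ends: "P 0 = p" "Q 0 = q" "Q l' = z"
    and cont: "continuous_map (top_of_set {0..l}) (mg_topology M) P"
      "continuous_map (top_of_set {0..l'}) (mg_topology M) Q"
    using P Q by (auto simp: unit_arc_def)
  have img: "join_arcs l P Q ` W = P ` (W \<inter> {0..l}) \<union> Q ` ((\<lambda>t. - l + 1 * t) ` (W \<inter> {l..l + l'}))"
    if "W \<subseteq> {0..l + l'}" for W
    by (rule join_arcs_image[where P = P and Q = Q, OF l eq that])
  have "(\<lambda>t. - l + 1 * t) ` ({0..l + l'} \<inter> {l..l + l'}) = {0..l'}"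
    using l by (auto simp: image_iff intro!: bexI[of _ "l + _"])
  then show im: "join_arcs l P Q ` {0..l + l'} = P ` {0..l} \<union> Q ` {0..l'}"
    using img[of "{0..l + l'}"] l by (simp add: Int_absorb1 Int_commute)
  have cross: "s = l \<and> t = 0" if "s \<in> {0..l}" "t \<in> {0..l'}" "P s = Q t" for s t
  proof -
    have "P s \<in> P ` {0..l}" "P s \<in> Q ` {0..l'}" unfolding that(3) using that by (metis imageI)+
    then have "P s = q" using int by blast
    then show ?thesis using that inj l eq ends by (metis atLeastAtMost_iff inj_onD order_refl)
  qed
  have "inj_on (join_arcs l P Q) {0..l + l'}"
  proof (rule inj_onI)
    fix s t assume st: "s \<in> {0..l + l'}" "t \<in> {0..l + l'}" and e: "join_arcs l P Q s = join_arcs l P Q t"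
    consider "s \<le> l" "t \<le> l" | "s \<le> l" "l < t" | "l < s" "t \<le> l" | "l < s" "l < t" by linarith
    then show "s = t"
    proof cases
      case 1
      then show ?thesis using e st by (intro inj_onD[OF inj(1)]) (auto simp: join_arcs_def)
    next
      case 2
      then have "P s = Q (t - l)" "s \<in> {0..l}" "t - l \<in> {0..l'}" using e st by (auto simp: join_arcs_def)
      then show ?thesis using cross 2 by fastforce
    next
      case 3
      then have "P t = Q (s - l)" "t \<in> {0..l}" "s - l \<in> {0..l'}" using e st by (auto simp: join_arcs_def)
      then show ?thesis using cross 3 by fastforce
    next
      case 4
      then have "s - l = t - l" using e st by (intro inj_onD[OF inj(2)]) (auto simp: join_arcs_def)
      then show ?thesis by simp
    qed
  qed
  moreover have "continuous_map (top_of_set {0..l + l'}) (mg_topology M) (join_arcs l P Q)"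
    unfolding join_arcs_def
  proof (rule continuous_map_cases_le)
    show "continuous_map (subtopology (top_of_set {0..l + l'}) {x \<in> topspace (top_of_set {0..l + l'}). x \<le> l}) (mg_topology M) P"
      unfolding subtopology_subtopology by (rule continuous_map_from_subtopology_mono[OF cont(1)]) auto
    have "continuous_map (top_of_set {l..l + l'}) (top_of_set {0..l'}) (\<lambda>t. t - l)"
      by (auto intro!: continuous_intros)
    from continuous_map_compose[OF this cont(2)]
    have "continuous_map (top_of_set {l..l + l'}) (mg_topology M) (\<lambda>t. Q (t - l))" by (simp add: o_def)
    then show "continuous_map (subtopology (top_of_set {0..l + l'}) {x \<in> topspace (top_of_set {0..l + l'}). l \<le> x}) (mg_topology M) (\<lambda>t. Q (t - l))"
      unfolding subtopology_subtopology by (rule continuous_map_from_subtopology_mono) auto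
  qed (use eq in auto)
  moreover have "measurable_part M (join_arcs l P Q ` W) \<and> total_length M (join_arcs l P Q ` W) = measure lebesgue W"
    if W: "W \<in> sets lebesgue" "W \<subseteq> {0..l + l'}" for W
  proof -
    define W1 where "W1 = W \<inter> {0..l}"
    define W2 where "W2 = (\<lambda>t. - l + 1 * t) ` (W \<inter> {l..l + l'})"
    have W1: "W1 \<in> sets lebesgue" "W1 \<subseteq> {0..l}" and W2': "W \<inter> {l..l + l'} \<in> sets lebesgue"
      using W by (auto simp: W1_def)
    have W2: "W2 \<in> sets lebesgue" "measure lebesgue W2 = measure lebesgue (W \<inter> {l..l + l'})"
      unfolding W2_def using isometric_image_lebesgue[OF W2', of 1 "- l"] by auto
    have W2s: "W2 \<subseteq> {0..l'}" by (auto simp: W2_def)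
    have 1: "measurable_part M (P ` W1)" "total_length M (P ` W1) = measure lebesgue W1"
      using P W1 by (auto simp: unit_arc_def)
    have 2: "measurable_part M (Q ` W2)" "total_length M (Q ` W2) = measure lebesgue W2"
      using Q W2 W2s by (auto simp: unit_arc_def)
    have "P ` W1 \<inter> Q ` W2 \<subseteq> {q}" using int W1 W2s by blast
    then have fin: "finite (P ` W1 \<inter> Q ` W2)" by (rule finite_subset) simp
    have "W = W1 \<union> (W \<inter> {l..l + l'})" using W(2) l by (auto simp: W1_def)
    moreover have "measure lebesgue (W1 \<union> (W \<inter> {l..l + l'})) = measure lebesgue W1 + measure lebesgue (W \<inter> {l..l + l'})"
    proof (rule measure_Un_AE)
      have "AE t in lebesgue. t \<notin> {l}"
        by (intro AE_not_in) (simp add: negligible_iff_null_sets[symmetric])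
      then show "AE t in lebesgue. t \<notin> W1 \<or> t \<notin> W \<inter> {l..l + l'}"
        by (rule eventually_mono) (auto simp: W1_def)
      show "W1 \<in> lmeasurable" by (rule fmeasurableI2[of "{0..l}"]) (use W1 in auto)
      show "W \<inter> {l..l + l'} \<in> lmeasurable" by (rule fmeasurableI2[of "{l..l + l'}"]) (use W2' in auto)
    qed
    ultimately have m: "measure lebesgue W = measure lebesgue W1 + measure lebesgue W2" using W2 by simp
    show ?thesis
      using measurable_part_Un[OF 1(1) 2(1)] total_length_Un[OF 1(1) 2(1) fin] m 1(2) 2(2)
      unfolding img[OF W(2)] W1_def[symmetric] W2_def[symmetric] by simp
  qed
  ultimately show "unit_arc M (l + l') (join_arcs l P Q) p z"
    unfolding unit_arc_def using l ends eq by (auto simp: join_arcs_def)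
qed

lemma is_cycle_of_arcs:
  assumes P: "unit_arc M l P p q" and Q: "unit_arc M l' Q p q" and l: "0 < l" "0 < l'"
    and int: "P ` {0..l} \<inter> Q ` {0..l'} = {p, q}"
  shows "is_cycle M (P ` {0..l} \<union> Q ` {0..l'})"
    "total_length M (P ` {0..l} \<union> Q ` {0..l'}) = l + l'"
proof -
  have inj: "inj_on P {0..l}" "inj_on Q {0..l'}"
    and ends: "P 0 = p" "Q 0 = p" "Q l' = q" "P l = q"
    and cont: "continuous_map (top_of_set {0..l}) (mg_topology M) P"
      "continuous_map (top_of_set {0..l'}) (mg_topology M) Q"
    using P Q by (auto simp: unit_arc_def)
  \<comment> \<open>The first half runs through \<open>P\<close> forwards, the second through
    \<open>Q\<close> backwards; they join at \<open>1 / 2\<close> in the common end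
    \<open>q\<close>.\<close>
  define g where "g = (\<lambda>t::real. if t \<le> 1 / 2 then P (2 * l * t) else Q (l' * (2 - 2 * t)))"
  have a: "2 * l * t \<in> {0..l}" if "t \<in> {0..1 / 2}" for t using that l by (auto simp: mult_left_le)
  have b: "l' * (2 - 2 * t) \<in> {0..l'}" if "t \<in> {1 / 2..1}" for t using that l by (auto simp: mult_left_le)
  have "pathin (mg_topology M) g"
    unfolding pathin_def g_def
  proof (rule continuous_map_cases_le)
    have "continuous_map (top_of_set {0..1 / 2}) (top_of_set {0..l}) (\<lambda>t. 2 * l * t)"
      using a by (auto intro!: continuous_intros)
    from continuous_map_compose[OF this cont(1)]
    have "continuous_map (top_of_set {0..1 / 2}) (mg_topology M) (\<lambda>t. P (2 * l * t))" by (simp add: o_def)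
    then show "continuous_map (subtopology (top_of_set {0..1}) {x \<in> topspace (top_of_set {0..1}). x \<le> 1 / 2}) (mg_topology M) (\<lambda>t. P (2 * l * t))"
      unfolding subtopology_subtopology by (rule continuous_map_from_subtopology_mono) auto
    have "continuous_map (top_of_set {1 / 2..1}) (top_of_set {0..l'}) (\<lambda>t. l' * (2 - 2 * t))"
      using b by (auto intro!: continuous_intros)
    from continuous_map_compose[OF this cont(2)]
    have "continuous_map (top_of_set {1 / 2..1}) (mg_topology M) (\<lambda>t. Q (l' * (2 - 2 * t)))" by (simp add: o_def)
    then show "continuous_map (subtopology (top_of_set {0..1}) {x \<in> topspace (top_of_set {0..1}). 1 / 2 \<le> x}) (mg_topology M) (\<lambda>t. Q (l' * (2 - 2 * t)))"
      unfolding subtopology_subtopology by (rule continuous_map_from_subtopology_mono) auto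
    show "P (2 * l * t) = Q (l' * (2 - 2 * t))" if "t = 1 / 2" for t
      unfolding that using ends by simp
  qed auto
  moreover have "g 0 = g 1" using ends by (simp add: g_def)
  moreover have "inj_on g {0..<1}"
  proof (rule inj_onI)
    have cross: "False" if "x \<in> {0..1 / 2}" "y \<in> {1 / 2<..<1}" "P (2 * l * x) = Q (l' * (2 - 2 * y))" for x y
    proof -
      have y: "l' * (2 - 2 * y) \<in> {0..l'}" by (rule b) (use that in auto)
      have "P (2 * l * x) \<in> P ` {0..l}" by (rule imageI, rule a[OF that(1)])
      moreover have "P (2 * l * x) \<in> Q ` {0..l'}" unfolding that(3) by (rule imageI, rule y)
      ultimately have "P (2 * l * x) \<in> P ` {0..l} \<inter> Q ` {0..l'}" by blast
      then have "Q (l' * (2 - 2 * y)) = Q 0 \<or> Q (l' * (2 - 2 * y)) = Q l'" using int ends that(3) by auto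
      then have "l' * (2 - 2 * y) = 0 \<or> l' * (2 - 2 * y) = l'"
        using inj_onD[OF inj(2) _ y] l by (metis atLeastAtMost_iff order_refl less_imp_le)
      then show False using that(2) l by auto
    qed
    fix x y :: real assume xy: "x \<in> {0..<1}" "y \<in> {0..<1}" and e: "g x = g y"
    consider "x \<le> 1 / 2" "y \<le> 1 / 2" | "x \<le> 1 / 2" "1 / 2 < y" | "1 / 2 < x" "y \<le> 1 / 2" | "1 / 2 < x" "1 / 2 < y"
      by linarith
    then show "x = y"
    proof cases
      case 1
      then have "P (2 * l * x) = P (2 * l * y)" using e by (simp add: g_def)
      then have "2 * l * x = 2 * l * y"
        by (rule inj_onD[OF inj(1)]) (rule a, use 1 xy in simp)+
      then show ?thesis using l by simp
    next
      case 2
      then show ?thesis using cross[of x y] e xy by (auto simp: g_def)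
    next
      case 3
      then show ?thesis using cross[of y x] e xy by (auto simp: g_def)
    next
      case 4
      then have "Q (l' * (2 - 2 * x)) = Q (l' * (2 - 2 * y))" using e by (simp add: g_def)
      then have "l' * (2 - 2 * x) = l' * (2 - 2 * y)"
        by (rule inj_onD[OF inj(2)]) (rule b, use 4 xy in simp)+
      then show ?thesis using l by simp
    qed
  qed
  moreover have "P ` {0..l} \<union> Q ` {0..l'} = g ` {0..1}"
  proof (intro equalityI subsetI)
    fix z assume "z \<in> P ` {0..l} \<union> Q ` {0..l'}"
    then show "z \<in> g ` {0..1}"
    proof
      assume "z \<in> P ` {0..l}"
      then obtain t where t: "t \<in> {0..l}" "z = P t" by blast
      then have "g (t / (2 * l)) = z" "t / (2 * l) \<in> {0..1}" using l by (auto simp: g_def field_simps)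
      then show ?thesis by blast
    next
      assume "z \<in> Q ` {0..l'}"
      then obtain t where t: "t \<in> {0..l'}" "z = Q t" by blast
      show ?thesis
      proof (cases "t = l'")
        case True
        then have "z = g (1 / 2)" using t ends by (simp add: g_def)
        then show ?thesis by auto
      next
        case False
        then have "1 - t / (2 * l') > 1 / 2" "l' * (2 - 2 * (1 - t / (2 * l'))) = t" "1 - t / (2 * l') \<in> {0..1}"
          using t l by (auto simp: field_simps)
        then have "g (1 - t / (2 * l')) = z" using t by (simp add: g_def)
        then show ?thesis using \<open>1 - t / (2 * l') \<in> {0..1}\<close> by blast
      qed
    qed
  next
    fix z assume "z \<in> g ` {0..1}"
    then obtain t where t: "t \<in> {0..1}" "z = g t" by blast
    then show "z \<in> P ` {0..l} \<union> Q ` {0..l'}"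
      using a[of t] b[of t] by (cases "t \<le> 1 / 2") (auto simp: g_def)
  qed
  ultimately show "is_cycle M (P ` {0..l} \<union> Q ` {0..l'})" unfolding is_cycle_def by blast
  have 1: "measurable_part M (P ` {0..l})" "total_length M (P ` {0..l}) = l"
    using P l by (auto simp: unit_arc_def)
  have 2: "measurable_part M (Q ` {0..l'})" "total_length M (Q ` {0..l'}) = l'"
    using Q l by (auto simp: unit_arc_def)
  show "total_length M (P ` {0..l} \<union> Q ` {0..l'}) = l + l'"
    using total_length_Un[OF 1(1) 2(1)] int 1 2 by simp
qed

section \<open>Descents as arcs of a reglued graph\<close>

text \<open>
  \<open>M\<close> arises from \<open>G\<close> by regluing the edge ends at Dirichlet vertices; \<open>f\<close> is the map on the
  remaining vertices.
\<close>

locale cut_graph =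
  fixes G :: "('v, 'e) metric_graph" and M :: "('w, 'e) metric_graph" and f :: "'v \<Rightarrow> 'w"
    and k :: real and F :: "'e set" and A :: "'e \<Rightarrow> real" and ph :: "'e \<times> bool \<Rightarrow> real"
  assumes pd: "phase_data G k F A ph" and comp: "compact_metric_graph G" and compM: "compact_metric_graph M"
    and edges_eq: "edges M = edges G" and len_eq: "len M = len G"
    and inj_f: "inj_on f (verts G - dirichlet G)"
    and end_free: "e \<in> edges G \<Longrightarrow> end_vertex G e b \<notin> dirichlet G \<Longrightarrow> end_vertex M e b = f (end_vertex G e b)"
    and end_dir: "e \<in> edges G \<Longrightarrow> end_vertex G e b \<in> dirichlet G \<Longrightarrow> end_vertex M e b \<notin> f ` (verts G - dirichlet G)"
begin

sublocale arch_network "F \<times> UNIV" "link_lo G ph" "link_up G ph" "Inl ` dirichlet G" "\<lambda>a. A (fst a)"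
  "link_tl G k ph" "link_tu G k ph" "link_len G k ph" "node_val G k A ph" k
  by (rule phase_data_network[OF pd comp])

abbreviation lk :: "'e \<times> bool \<Rightarrow> real" where "lk \<equiv> link_len G k ph"

definition mid_pt :: "'e \<Rightarrow> ('w, 'e) point" where
  "mid_pt e = Inner e (lk (e, False))"

definition end_pt :: "'e \<times> bool \<Rightarrow> ('w, 'e) point" where
  "end_pt a = Vertex (end_vertex M (fst a) (snd a))"

definition up_pt :: "'e \<times> bool \<Rightarrow> ('w, 'e) point" where
  "up_pt a = (if rising ph a then mid_pt (fst a) else end_pt a)"

definition lo_pt :: "'e \<times> bool \<Rightarrow> ('w, 'e) point" where
  "lo_pt a = (if rising ph a then end_pt a else mid_pt (fst a))"

definition link_interior :: "'e \<times> bool \<Rightarrow> ('w, 'e) point set" where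
  "link_interior a = {Inner (fst a) t | t.
     if snd a then lk (fst a, False) < t \<and> t < len G (fst a) else 0 < t \<and> t < lk (fst a, False)}"

definition node_pt :: "'v + 'e \<Rightarrow> ('w, 'e) point" where
  "node_pt n = (case n of Inl v \<Rightarrow> Vertex (f v) | Inr e \<Rightarrow> mid_pt e)"

lemma F_edges: "F \<subseteq> edges G"
  using pd by (auto simp: phase_data_def separated_edges_def)

lemma lk_facts:
  assumes "e \<in> F"
  shows "0 < lk (e, b)" "lk (e, False) + lk (e, True) = len G e" "lk (e, b) < len G e"
  using link_len_facts[OF pd comp assms] by auto

lemma link_arc:
  assumes a: "a \<in> F \<times> UNIV"
  shows "\<exists>P. unit_arc M (lk a) P (up_pt a) (lo_pt a) \<and> P ` {0..lk a} = {up_pt a, lo_pt a} \<union> link_interior a"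
proof -
  obtain e b where ab: "a = (e, b)" by (cases a)
  have e: "e \<in> F" "e \<in> edges M" using a ab F_edges edges_eq by auto
  note lf = lk_facts[OF e(1)]
  have len: "0 < len G e" using lf(1)[of False] lf(3)[of False] by simp
  have image: "P ` {0..l} = {P 0, P l} \<union> P ` {0<..<l}" if "0 < l" for P :: "real \<Rightarrow> ('w, 'e) point" and l
  proof -
    have "{0..l} = {0, l} \<union> {0<..<l}" using that by auto
    then show ?thesis by (metis image_Un image_insert image_empty)
  qed
  have ch: "chart M e (lk (e, False)) = mid_pt e" "chart M e 0 = end_pt (e, False)" "chart M e (len G e) = end_pt (e, True)"
    using lf(1)[of False] lf(3)[of False] len by (auto simp: chart_def mid_pt_def end_pt_def end_vertex_def len_eq)
  have arc: "\<exists>P. unit_arc M (lk a) P (up_pt a) (lo_pt a) \<and> P ` {0..lk a} = {up_pt a, lo_pt a} \<union> link_interior a"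
    if r: "r = 1 \<or> r = - 1" and c: "c \<in> {0..len G e}" "c + r * lk a \<in> {0..len G e}"
      and p: "chart M e c = up_pt a" "chart M e (c + r * lk a) = lo_pt a"
      and i: "{Inner e t | t. min c (c + r * lk a) < t \<and> t < max c (c + r * lk a)} = link_interior a" for r c
  proof -
    note ar = unit_arc_edge[OF compM e(2) r, of "lk a" c, unfolded len_eq]
    have l: "0 < lk a" "lk a < len G e" using lf ab by auto
    have "unit_arc M (lk a) (\<lambda>t. chart M e (c + r * t)) (up_pt a) (lo_pt a)"
      using ar(1)[OF l c] unfolding p .
    moreover have "(\<lambda>t. chart M e (c + r * t)) ` {0..lk a} = {up_pt a, lo_pt a} \<union> link_interior a"
      unfolding image[OF l(1)] ar(2)[OF l c] i using p by simp
    ultimately show ?thesis by blast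
  qed
  show ?thesis
  proof (cases "rising ph a")
    case True
    show ?thesis
    proof (cases b)
      case bT: True
      have *: "lk (e, False) + 1 * lk a = len G e" using lf(2) ab bT by simp
      show ?thesis
        by (rule arc[of 1 "lk (e, False)"])
          (use True bT * ch lf(1)[of False] lf(3)[of False] len in \<open>auto simp: up_pt_def lo_pt_def link_interior_def ab\<close>)
    next
      case bF: False
      have *: "lk (e, False) + - 1 * lk a = 0" using ab bF by simp
      show ?thesis
        by (rule arc[of "- 1" "lk (e, False)"])
          (use True bF * ch lf(1)[of False] lf(3)[of False] len in \<open>auto simp: up_pt_def lo_pt_def link_interior_def ab\<close>)
    qed
  next
    case False
    show ?thesis
    proof (cases b)
      case bT: True
      have *: "len G e + - 1 * lk a = lk (e, False)" using lf(2) ab bT by simp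
      show ?thesis
        by (rule arc[of "- 1" "len G e"], simp_all only: *)
          (use False bT ch lf(1)[of False] lf(3)[of False] len in \<open>auto simp: up_pt_def lo_pt_def link_interior_def ab\<close>)
    next
      case bF: False
      have *: "0 + 1 * lk a = lk (e, False)" using ab bF by simp
      show ?thesis
        by (rule arc[of 1 0], simp_all only: *)
          (use False bF ch lf(1)[of False] lf(3)[of False] len in \<open>auto simp: up_pt_def lo_pt_def link_interior_def ab\<close>)
    qed
  qed
qed

lemma link_interior_disjoint:
  assumes "a \<in> F \<times> UNIV" "b \<in> F \<times> UNIV"
  shows "a \<noteq> b \<Longrightarrow> link_interior a \<inter> link_interior b = {}"
    "up_pt a \<notin> link_interior b" "lo_pt a \<notin> link_interior b"
  using assms by (cases a; cases b; auto simp: link_interior_def up_pt_def lo_pt_def mid_pt_def end_pt_def split: if_splits)+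

lemma end_verts: "e \<in> edges G \<Longrightarrow> end_vertex G e b \<in> verts G"
  using comp by (auto simp: compact_metric_graph_def end_vertex_def)

lemma node_pt_up: "a \<in> F \<times> UNIV \<Longrightarrow> up_pt a = node_pt (link_up G ph a)"
  using up_free[of a] F_edges
  by (auto simp: up_pt_def node_pt_def link_up_def end_node_def end_pt_def image_iff intro!: end_free)

lemma node_pt_lo: "a \<in> F \<times> UNIV \<Longrightarrow> link_lo G ph a \<notin> Inl ` dirichlet G \<Longrightarrow> lo_pt a = node_pt (link_lo G ph a)"
  using F_edges
  by (auto simp: lo_pt_def node_pt_def link_lo_def end_node_def end_pt_def image_iff intro!: end_free split: if_splits)

text \<open>On these nodes \<open>node_pt\<close> gives the true position and is injective. The
  point of a Dirichlet end depends on how that end is reglued, so it is only known to differ from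
  all points of \<open>fnodes\<close>.\<close>

definition fnodes :: "('v + 'e) set" where
  "fnodes = Inl ` (verts G - dirichlet G) \<union> Inr ` F"

lemma inj_node_pt: "inj_on node_pt fnodes"
  using inj_f by (auto simp: inj_on_def fnodes_def node_pt_def mid_pt_def)

lemma up_fnodes: "a \<in> F \<times> UNIV \<Longrightarrow> link_up G ph a \<in> fnodes"
  using up_free[of a] F_edges end_verts[of "fst a" "snd a"]
  by (auto simp: fnodes_def link_up_def end_node_def image_iff)

lemma lo_fnodes: "a \<in> F \<times> UNIV \<Longrightarrow> link_lo G ph a \<notin> Inl ` dirichlet G \<Longrightarrow> link_lo G ph a \<in> fnodes"
  using F_edges end_verts[of "fst a" "snd a"]
  by (auto simp: fnodes_def link_lo_def end_node_def image_iff split: if_splits)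

lemma lo_pt_dirichlet:
  "a \<in> F \<times> UNIV \<Longrightarrow> link_lo G ph a \<in> Inl ` dirichlet G \<Longrightarrow> lo_pt a = end_pt a \<and> lo_pt a \<notin> node_pt ` fnodes"
  using F_edges end_dir[of "fst a" "snd a"]
  by (auto simp: lo_pt_def link_lo_def end_node_def node_pt_def fnodes_def end_pt_def mid_pt_def split: if_splits)

definition path_pts :: "('e \<times> bool) list \<Rightarrow> ('w, 'e) point \<Rightarrow> ('w, 'e) point set" where
  "path_pts as q = insert q (up_pt ` set as) \<union> (\<Union>a\<in>set as. link_interior a)"

text \<open>Values decrease strictly along a descent, so a link put in front meets the remaining arc
  only in their joint.\<close>

lemma descent_arc:
  assumes "a \<in> F \<times> UNIV" "dpath (link_lo G ph a) as w"
  shows "\<exists>P. unit_arc M (lk a + sum_list (map lk as)) P (up_pt a) (lo_pt (last (a # as))) \<and>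
     P ` {0..lk a + sum_list (map lk as)} = path_pts (a # as) (lo_pt (last (a # as)))"
  using assms
proof (induction as arbitrary: a)
  case Nil
  then show ?case using link_arc[OF Nil(1)] by (simp add: path_pts_def insert_commute)
next
  case (Cons b as)
  then have b: "b \<in> F \<times> UNIV" "link_up G ph b = link_lo G ph a" "dpath (link_lo G ph b) as w" by auto
  have dp: "dpath (link_up G ph a) (a # b # as) w" using Cons.prems by simp
  have inF: "set (a # b # as) \<subseteq> F \<times> UNIV" by (rule dpath_links[OF dp])
  have lo_up: "lo_pt a = up_pt b"
    using node_pt_up[OF b(1)] node_pt_lo[OF Cons.prems(1)] up_free[OF b(1)] b(2) by simp
  obtain P where P: "unit_arc M (lk b + sum_list (map lk as)) P (up_pt b) (lo_pt (last (b # as)))"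
    "P ` {0..lk b + sum_list (map lk as)} = path_pts (b # as) (lo_pt (last (b # as)))"
    using Cons.IH[OF b(1,3)] by blast
  obtain Q where Q: "unit_arc M (lk a) Q (up_pt a) (up_pt b)"
    "Q ` {0..lk a} = {up_pt a, up_pt b} \<union> link_interior a"
    using link_arc[OF Cons.prems(1)] lo_up by auto
  have la: "last (b # as) \<in> F \<times> UNIV" "link_lo G ph (last (b # as)) = w"
    using last_link[OF b(1,3)] by auto
  have dist: "distinct (map (link_up G ph) (a # b # as))" by (rule dpath_distinct[OF dp])
  have up_neq: "up_pt a \<noteq> up_pt c" if "c \<in> set (b # as)" for c
  proof -
    have "link_up G ph a \<noteq> link_up G ph c" using dist that by auto
    then show ?thesis
      using node_pt_up inj_onD[OF inj_node_pt _ up_fnodes up_fnodes, of a c] inF that by auto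
  qed
  have q_neq: "up_pt a \<noteq> lo_pt (last (b # as))"
  proof (cases "w \<in> Inl ` dirichlet G")
    case True
    then have "lo_pt (last (b # as)) \<notin> node_pt ` fnodes" using lo_pt_dirichlet[OF la(1)] la(2) by metis
    then show ?thesis
      using node_pt_up[OF Cons.prems(1)] imageI[OF up_fnodes[OF Cons.prems(1)], of node_pt] by metis
  next
    case False
    have "w \<noteq> link_up G ph a" using dpath_val[OF dp] by force
    then show ?thesis
      using node_pt_lo[OF la(1)] lo_fnodes[OF la(1)] la False node_pt_up[OF Cons.prems(1)]
        inj_onD[OF inj_node_pt, of w "link_up G ph a"] up_fnodes[OF Cons.prems(1)] by auto
  qed
  have a_notin: "a \<notin> set (b # as)" using dist by auto
  have "Q ` {0..lk a} \<inter> P ` {0..lk b + sum_list (map lk as)} = {up_pt b}"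
  proof (intro equalityI subsetI)
    fix z assume z: "z \<in> Q ` {0..lk a} \<inter> P ` {0..lk b + sum_list (map lk as)}"
    show "z \<in> {up_pt b}"
    proof (rule ccontr)
      assume nz: "z \<notin> {up_pt b}"
      have zQ: "z = up_pt a \<or> z \<in> link_interior a" using z nz Q by auto
      have zP: "z = lo_pt (last (b # as)) \<or> (\<exists>c\<in>set (b # as). z = up_pt c \<or> z \<in> link_interior c)"
        using z unfolding P(2) path_pts_def by blast
      show False
      proof (cases "z = up_pt a")
        case True
        then show ?thesis
          using zP up_neq q_neq link_interior_disjoint(2)[OF Cons.prems(1)] inF by auto
      next
        case False
        then have zi: "z \<in> link_interior a" using zQ by simp
        from zP show ?thesis
        proof (elim disjE bexE)
          assume "z = lo_pt (last (b # as))"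
          then show False using zi link_interior_disjoint(3)[OF la(1) Cons.prems(1)] by simp
        next
          fix c assume "c \<in> set (b # as)" "z = up_pt c"
          then show False using zi link_interior_disjoint(2)[of c a] inF by auto
        next
          fix c assume c: "c \<in> set (b # as)" "z \<in> link_interior c"
          then have "c \<noteq> a" using a_notin by auto
          then show False using zi c link_interior_disjoint(1)[of c a] inF by auto
        qed
      qed
    qed
  next
    fix z assume "z \<in> {up_pt b}"
    then show "z \<in> Q ` {0..lk a} \<inter> P ` {0..lk b + sum_list (map lk as)}"
      unfolding Q(2) P(2) path_pts_def by auto
  qed
  note j = unit_arc_join[OF Q(1) P(1) this]
  have "Q ` {0..lk a} \<union> P ` {0..lk b + sum_list (map lk as)} = path_pts (a # b # as) (lo_pt (last (a # b # as)))"
    unfolding Q(2) P(2) path_pts_def by auto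
  then show ?case using j by (auto simp: add.assoc)
qed

lemma descents_disjoint:
  assumes ab: "a \<in> F \<times> UNIV" "b \<in> F \<times> UNIV" "a \<noteq> b" "link_up G ph a = link_up G ph b"
    and as: "dpath (link_lo G ph a) as w" and bs: "dpath (link_lo G ph b) bs w'"
    and disj: "link_up G ph ` set as \<inter> link_up G ph ` set bs = {}"
      "w \<notin> link_up G ph ` set bs" "w' \<notin> link_up G ph ` set as"
  shows "path_pts (a # as) (lo_pt (last (a # as))) \<inter> path_pts (b # bs) (lo_pt (last (b # bs)))
     \<subseteq> {up_pt a} \<union> ({lo_pt (last (a # as))} \<inter> {lo_pt (last (b # bs))})"
proof -
  have dpa: "dpath (link_up G ph a) (a # as) w" and dpb: "dpath (link_up G ph a) (b # bs) w'"
    using ab as bs by auto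
  have inF: "set (a # as) \<subseteq> F \<times> UNIV" "set (b # bs) \<subseteq> F \<times> UNIV"
    by (rule dpath_links[OF dpa], rule dpath_links[OF dpb])
  have da: "distinct (map (link_up G ph) (a # as))" and db: "distinct (map (link_up G ph) (b # bs))"
    by (rule dpath_distinct[OF dpa], rule dpath_distinct[OF dpb])
  have la: "last (a # as) \<in> F \<times> UNIV" "link_lo G ph (last (a # as)) = w"
    and lb: "last (b # bs) \<in> F \<times> UNIV" "link_lo G ph (last (b # bs)) = w'"
    using last_link[OF ab(1) as] last_link[OF ab(2) bs] by auto
  have up_eq: "link_up G ph c = link_up G ph d" if "up_pt c = up_pt d" "c \<in> F \<times> UNIV" "d \<in> F \<times> UNIV" for c d
    using that node_pt_up inj_onD[OF inj_node_pt _ up_fnodes up_fnodes, of c d] by simp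
  have ups: "up_pt c = up_pt a" if c: "c \<in> set (a # as)" "d \<in> set (b # bs)" "up_pt c = up_pt d" for c d
  proof -
    have "link_up G ph c = link_up G ph d" using up_eq c inF by blast
    moreover have "c \<in> F \<times> UNIV" using c inF by blast
    ultimately have "link_up G ph c = link_up G ph a" using c disj(1) ab(4) da db by auto
    then show ?thesis using node_pt_up ab(1) \<open>c \<in> F \<times> UNIV\<close> by simp
  qed
  have links: "c \<noteq> d" if c: "c \<in> set (a # as)" "d \<in> set (b # bs)" for c d
  proof
    assume "c = d"
    then have "link_up G ph c = link_up G ph a" using c disj(1) ab(4) da db by auto
    then show False using c \<open>c = d\<close> ab(3,4) da db by (auto simp: image_iff)
  qed
  have end_up: "lo_pt c \<noteq> up_pt d"
    if c: "c \<in> F \<times> UNIV" "d \<in> F \<times> UNIV" "link_lo G ph c \<noteq> link_up G ph d" for c d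
  proof (cases "link_lo G ph c \<in> Inl ` dirichlet G")
    case True
    then show ?thesis
      using lo_pt_dirichlet[OF c(1)] node_pt_up[OF c(2)] imageI[OF up_fnodes[OF c(2)], of node_pt] by metis
  next
    case False
    then show ?thesis
      using node_pt_lo[OF c(1)] lo_fnodes[OF c(1)] c(3) node_pt_up[OF c(2)]
        inj_onD[OF inj_node_pt, of "link_lo G ph c" "link_up G ph d"] up_fnodes[OF c(2)] by auto
  qed
  have wne: "w \<notin> link_up G ph ` set (b # bs)" "w' \<notin> link_up G ph ` set (a # as)"
    using disj dpath_val[OF dpa] dpath_val[OF dpb] ab(4) by force+
  show ?thesis
  proof
    fix z assume z: "z \<in> path_pts (a # as) (lo_pt (last (a # as))) \<inter> path_pts (b # bs) (lo_pt (last (b # bs)))"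
    from z have z1: "z = lo_pt (last (a # as)) \<or> (\<exists>c\<in>set (a # as). z = up_pt c \<or> z \<in> link_interior c)"
      unfolding path_pts_def by blast
    from z have z2: "z = lo_pt (last (b # bs)) \<or> (\<exists>c\<in>set (b # bs). z = up_pt c \<or> z \<in> link_interior c)"
      unfolding path_pts_def by blast
    from z1 show "z \<in> {up_pt a} \<union> ({lo_pt (last (a # as))} \<inter> {lo_pt (last (b # bs))})"
    proof (elim disjE bexE)
      assume e: "z = lo_pt (last (a # as))"
      from z2 show ?thesis
      proof (elim disjE bexE)
        fix d assume "d \<in> set (b # bs)" "z = up_pt d"
        then show ?thesis using e end_up[OF la(1), of d] inF la(2) wne(1) by auto
      next
        fix d assume "d \<in> set (b # bs)" "z \<in> link_interior d"
        then show ?thesis using e link_interior_disjoint(3)[OF la(1), of d] inF by auto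
      qed (use e in auto)
    next
      fix c assume c: "c \<in> set (a # as)" "z = up_pt c"
      from z2 show ?thesis
      proof (elim disjE bexE)
        assume "z = lo_pt (last (b # bs))"
        then show ?thesis using c end_up[OF lb(1), of c] inF lb(2) wne(2) by auto
      next
        fix d assume "d \<in> set (b # bs)" "z = up_pt d"
        then show ?thesis using ups[OF c(1)] c by auto
      next
        fix d assume "d \<in> set (b # bs)" "z \<in> link_interior d"
        then show ?thesis using c link_interior_disjoint(2)[of c d] inF by auto
      qed
    next
      fix c assume c: "c \<in> set (a # as)" "z \<in> link_interior c"
      from z2 show ?thesis
      proof (elim disjE bexE)
        assume "z = lo_pt (last (b # bs))"
        then show ?thesis using c link_interior_disjoint(3)[OF lb(1), of c] inF by auto
      next
        fix d assume "d \<in> set (b # bs)" "z = up_pt d"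
        then show ?thesis using c link_interior_disjoint(2)[of d c] inF by auto
      next
        fix d assume "d \<in> set (b # bs)" "z \<in> link_interior d"
        then show ?thesis using c links[of c d] link_interior_disjoint(1)[of c d] inF by blast
      qed
    qed
  qed
qed

lemma descents_cycle:
  assumes ab: "a \<in> F \<times> UNIV" "b \<in> F \<times> UNIV" "a \<noteq> b" "link_up G ph a = link_up G ph b"
    and as: "dpath (link_lo G ph a) as w" and bs: "dpath (link_lo G ph b) bs w'"
    and disj: "link_up G ph ` set as \<inter> link_up G ph ` set bs = {}"
      "w \<notin> link_up G ph ` set bs" "w' \<notin> link_up G ph ` set as"
    and same: "lo_pt (last (a # as)) = lo_pt (last (b # bs))"
  shows "\<exists>C. is_cycle M C \<and> total_length M C = lk a + sum_list (map lk as) + (lk b + sum_list (map lk bs))"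
proof -
  obtain P where P: "unit_arc M (lk a + sum_list (map lk as)) P (up_pt a) (lo_pt (last (a # as)))"
    "P ` {0..lk a + sum_list (map lk as)} = path_pts (a # as) (lo_pt (last (a # as)))"
    using descent_arc[OF ab(1) as] by blast
  obtain Q where Q: "unit_arc M (lk b + sum_list (map lk bs)) Q (up_pt b) (lo_pt (last (b # bs)))"
    "Q ` {0..lk b + sum_list (map lk bs)} = path_pts (b # bs) (lo_pt (last (b # bs)))"
    using descent_arc[OF ab(2) bs] by blast
  have up: "up_pt b = up_pt a" using node_pt_up ab by simp
  have pos: "0 < lk c + sum_list (map lk cs)" if "dpath n (c # cs) z" for n c cs z
  proof -
    have "set (c # cs) \<subseteq> F \<times> UNIV" by (rule dpath_links[OF that])
    then have "0 < lk c" "\<forall>x\<in>set (map lk cs). 0 \<le> x" using h_pos by (auto intro: less_imp_le)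
    then show ?thesis using sum_list_nonneg[of "map lk cs"] by force
  qed
  have "P ` {0..lk a + sum_list (map lk as)} \<inter> Q ` {0..lk b + sum_list (map lk bs)} = {up_pt a, lo_pt (last (a # as))}"
    unfolding P(2) Q(2)
    using descents_disjoint[OF ab as bs disj] same up by (fastforce simp: path_pts_def)
  from is_cycle_of_arcs[OF P(1) Q(1)[unfolded up same[symmetric]] _ _ this] show ?thesis
    using pos[of "link_up G ph a" a as w] pos[of "link_up G ph b" b bs w'] ab as bs by auto
qed

end

section \<open>Embedded circles\<close>

definition between :: "real \<Rightarrow> real \<Rightarrow> real set" where
  "between s t = {min s t<..<max s t}"

text \<open>The open segment between two inner points and the complement of the closed one are
  disjoint open sets that cover everything but these two points.\<close>

lemma connectedin_edge_segment:
  fixes M :: "('v, 'e) metric_graph"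
  assumes comp: "compact_metric_graph M" and e: "e \<in> edges M"
    and st: "s \<in> {0<..<len M e}" "t \<in> {0<..<len M e}"
    and S: "connectedin (mg_topology M) S" "Inner e s \<notin> S" "Inner e t \<notin> S"
  shows "S \<subseteq> Inner e ` between s t \<or> S \<inter> Inner e ` between s t = {}"
proof -
  define U :: "('v, 'e) point set" where "U = Inner e ` between s t"
  define V where "V = points M - Inner e ` {min s t..max s t}"
  have sub: "S \<subseteq> points M"
    using S(1) connectedin_subset_topspace topspace_mg_topology[OF comp] by metis
  have pre: "{x \<in> {0..len M e'}. chart M e' x \<in> U} = (if e' = e then between s t else {})"
    "{x \<in> {0..len M e'}. chart M e' x \<in> V} = (if e' = e then {0..len M e} - {min s t..max s t} else {0..len M e'})"
    if "e' \<in> edges M" for e'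
    using st chart_in_points[OF comp that] by (auto simp: U_def V_def between_def chart_def)
  have ob: "openin (top_of_set {0..len M e}) (between s t)"
    using st by (intro open_subset) (auto simp: between_def)
  have oc: "openin (top_of_set {0..len M e}) ({0..len M e} - {min s t..max s t})"
    using openin_open_Int[OF open_Compl[OF closed_atLeastAtMost], of "{0..len M e}" "min s t" "max s t"]
    by (simp add: Diff_eq)
  have oU: "openin (mg_topology M) U"
    unfolding openin_mg_topology
  proof (intro conjI ballI)
    show "U \<subseteq> points M" using e st by (auto simp: U_def points_def between_def)
    show "openin (top_of_set {0..len M e'}) {x \<in> {0..len M e'}. chart M e' x \<in> U}" if "e' \<in> edges M" for e'
      unfolding pre[OF that] using ob by simp
  qed
  have oV: "openin (mg_topology M) V"
    unfolding openin_mg_topology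
  proof (intro conjI ballI)
    show "V \<subseteq> points M" by (auto simp: V_def)
    show "openin (top_of_set {0..len M e'}) {x \<in> {0..len M e'}. chart M e' x \<in> V}" if "e' \<in> edges M" for e'
      unfolding pre[OF that] using oc by (simp add: openin_subtopology_refl)
  qed
  have "S \<subseteq> U \<union> V"
  proof
    fix z assume z: "z \<in> S"
    show "z \<in> U \<union> V"
    proof (rule ccontr)
      assume "z \<notin> U \<union> V"
      then obtain x where x: "z = Inner e x" "x \<in> {min s t..max s t}"
        using z sub by (auto simp: V_def)
      have "x \<notin> between s t" using \<open>z \<notin> U \<union> V\<close> x(1) unfolding U_def by blast
      then have "x = s \<or> x = t" using x(2) by (auto simp: between_def min_def max_def split: if_splits)
      then show False using z x S by auto
    qed
  qed
  moreover have "U \<inter> V \<inter> S = {}" by (auto simp: U_def V_def between_def)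
  ultimately have "U \<inter> S = {} \<or> V \<inter> S = {}"
    using S(1) oU oV unfolding connectedin by blast
  then show ?thesis using \<open>S \<subseteq> U \<union> V\<close> unfolding U_def by blast
qed

locale embedded_circle =
  fixes M :: "('v, 'e) metric_graph" and C :: "('v, 'e) point set"
  assumes compM: "compact_metric_graph M" and cycle: "is_cycle M C"
begin

text \<open>The parametrisation is used only here; afterwards it matters that a circle is infinite
  and remains connected when a point is deleted.\<close>

lemma circle_facts:
  shows "connectedin (mg_topology M) C" "p \<in> C \<Longrightarrow> connectedin (mg_topology M) (C - {p})"
    "infinite C" "C \<subseteq> points M"
proof -
  obtain g :: "real \<Rightarrow> ('v, 'e) point" where g0: "continuous_map (top_of_set {0..1}) (mg_topology M) g \<and> g 0 = g 1 \<and>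
    inj_on g {0..<1} \<and> C = g ` {0..1}"
    using cycle[unfolded is_cycle_def pathin_def] ..
  then have g: "continuous_map (top_of_set {0..1}) (mg_topology M) g" "g 0 = g 1"
    "inj_on g {0..<1}" "C = g ` {0..1}" by blast+
  have conn: "connectedin (mg_topology M) (g ` S)" if "connected S" "S \<subseteq> {0..1}" for S
    by (rule connectedin_continuous_map_image[OF g(1)])
      (use that in \<open>simp add: connectedin_subtopology connectedin_iff_connected\<close>)
  show "connectedin (mg_topology M) C" unfolding g(4) by (rule conn) auto
  then show "C \<subseteq> points M" using connectedin_subset_topspace topspace_mg_topology[OF compM] by metis
  have "infinite {0..<1::real}" by (simp add: infinite_Ico)
  then have "infinite (g ` {0..<1})" using finite_imageD g(3) by blast
  then show "infinite C" unfolding g(4) by (rule infinite_super[rotated]) auto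
  assume "p \<in> C"
  then obtain t where t: "t \<in> {0..1}" "p = g t" using g(4) by auto
  \<comment> \<open>The parameter \<open>1\<close> is replaced by \<open>0\<close>, so that
    \<open>s\<close> lies where the parametrisation is injective.\<close>
  have "(if t = 1 then 0 else t) \<in> {0..<1}" "p = g (if t = 1 then 0 else t)"
    using t g(2) by auto
  then obtain s where s: "s \<in> {0..<1}" "p = g s" by blast
  have eq: "g x = p \<longleftrightarrow> x = s" if "x \<in> {0..<1}" for x
    using that s inj_onD[OF g(3)] by auto
  show "connectedin (mg_topology M) (C - {p})"
  proof (cases "s = 0")
    case True
    have "C - {p} = g ` {0<..<1}"
    proof (intro equalityI subsetI)
      fix z assume z: "z \<in> C - {p}"
      then obtain x where x: "x \<in> {0..1}" "z = g x" using g(4) by auto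
      then have "x \<noteq> 0" "x \<noteq> 1" using z s True g(2) by auto
      then show "z \<in> g ` {0<..<1}" using x by auto
    next
      fix z assume "z \<in> g ` {0<..<1}"
      then obtain x where x: "x \<in> {0<..<1}" "z = g x" by blast
      then have "g x \<noteq> p" using eq[of x] True by simp
      then show "z \<in> C - {p}" using x g(4) by simp
    qed
    moreover have "{0<..<1} \<subseteq> {0..1::real}" by auto
    ultimately show ?thesis using conn[of "{0<..<1}"] by simp
  next
    case False
    have "C - {p} = g ` {0..<s} \<union> g ` {s<..1}"
    proof (intro equalityI subsetI)
      fix z assume z: "z \<in> C - {p}"
      then obtain x where x: "x \<in> {0..1}" "z = g x" using g(4) by auto
      then have "x \<noteq> s" using z s by auto
      then have "x \<in> {0..<s} \<union> {s<..1}" using x(1) by auto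
      then show "z \<in> g ` {0..<s} \<union> g ` {s<..1}" unfolding x(2) by blast
    next
      fix z assume "z \<in> g ` {0..<s} \<union> g ` {s<..1}"
      then obtain x where x: "z = g x" "x \<in> {0..<s} \<union> {s<..1}" by blast
      then have x': "x \<in> {0..1}" "x \<noteq> s" using s by auto
      have "g x \<noteq> p"
      proof (cases "x = 1")
        case True
        then show ?thesis using eq[of 0] g(2) \<open>s \<noteq> 0\<close> by simp
      next
        case False
        then show ?thesis using eq[of x] x' by simp
      qed
      then show "z \<in> C - {p}" using x x' g(4) by simp
    qed
    moreover have "connectedin (mg_topology M) (g ` {0..<s} \<union> g ` {s<..1})"
    proof (rule connectedin_Un)
      show "connectedin (mg_topology M) (g ` {0..<s})" by (rule conn) (use s in auto)
      show "connectedin (mg_topology M) (g ` {s<..1})" by (rule conn) (use s in auto)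
      have "0 \<in> {0..<s}" "1 \<in> {s<..1}" using s False by auto
      then have "g 0 \<in> g ` {0..<s} \<inter> g ` {s<..1}" by (metis IntI g(2) imageI)
      then show "g ` {0..<s} \<inter> g ` {s<..1} \<noteq> {}" by blast
    qed
    ultimately show ?thesis by simp
  qed
qed

lemma third_point:
  "\<exists>z\<in>C. z \<noteq> p \<and> z \<noteq> q"
proof (rule ccontr)
  assume "\<not> ?thesis"
  then have "C \<subseteq> {p, q}" by auto
  then show False using circle_facts(3) finite_subset by blast
qed

text \<open>Suppose \<open>s\<close> is missed. If a point of \<open>C\<close> lay between
  \<open>s\<close> and another point \<open>x\<close> of \<open>C\<close> on the edge, then all of
  \<open>C\<close> would lie in the segment from \<open>s\<close> to \<open>x\<close>, where
  deleting a middle point disconnects it. So \<open>C\<close> has only the point \<open>t\<close> on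
  its side of \<open>s\<close>, and points beyond \<open>t\<close> are missed too. This traps
  \<open>C\<close> in a segment that contains no other point of it.\<close>

lemma full_edge:
  assumes e: "e \<in> edges M" and t: "t \<in> {0<..<len M e}" "Inner e t \<in> C"
    and s: "s \<in> {0<..<len M e}"
  shows "Inner e s \<in> C"
proof (rule ccontr)
  assume ns: "Inner e s \<notin> C"
  have seg: "C - {Inner e x} \<subseteq> Inner e ` between s x \<or> (C - {Inner e x}) \<inter> Inner e ` between s x = {}"
    if x: "x \<in> {0<..<len M e}" "Inner e x \<in> C" for x
    by (rule connectedin_edge_segment[OF compM e s x(1) circle_facts(2)[OF x(2)]]) (use ns in auto)
  have clear: "C \<inter> Inner e ` between s x = {}"
    if x: "x \<in> {0<..<len M e}" "Inner e x \<in> C" for x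
  proof (rule ccontr)
    assume "C \<inter> Inner e ` between s x \<noteq> {}"
    moreover have "Inner e x \<notin> Inner e ` between s x" by (auto simp: between_def)
    ultimately have "(C - {Inner e x}) \<inter> Inner e ` between s x \<noteq> {}" by blast
    then have in_x: "C - {Inner e x} \<subseteq> Inner e ` between s x" using seg[OF x] by blast
    obtain y where y: "Inner e y \<in> C" "y \<in> between s x"
      using third_point[of "Inner e x" "Inner e x"] in_x by blast
    have bx: "between s x \<subseteq> {0<..<len M e}" using s x by (auto simp: between_def)
    have yx: "Inner e x \<in> C - {Inner e y}" "Inner e x \<notin> Inner e ` between s y"
      using x y by (auto simp: between_def)
    then have cy: "(C - {Inner e y}) \<inter> Inner e ` between s y = {}"
      using seg[of y] y bx by blast
    obtain z where z: "Inner e z \<in> C" "z \<in> between s x" "z \<noteq> y"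
      using third_point[of "Inner e x" "Inner e y"] in_x by blast
    have "z \<notin> between s y" using cy z by auto
    then have "y \<in> between s z" using y z by (auto simp: between_def min_def max_def split: if_splits)
    then have "(C - {Inner e z}) \<inter> Inner e ` between s z \<noteq> {}" using y z by auto
    then have "C - {Inner e z} \<subseteq> Inner e ` between s z" using seg[of z] z bx by blast
    moreover have "Inner e x \<in> C - {Inner e z}" "Inner e x \<notin> Inner e ` between s z"
      using x z by (auto simp: between_def)
    ultimately show False by blast
  qed
  \<comment> \<open>Halfway between \<open>t\<close> and that end of the edge which lies beyond
    \<open>t\<close> as seen from \<open>s\<close>.\<close>
  define r where "r = (if s < t then (t + len M e) / 2 else t / 2)"
  have "s \<noteq> t" using ns t by auto
  then have r: "r \<in> {0<..<len M e}" "t \<in> between s r"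
    using t s by (auto simp: r_def between_def)
  have only: "x = t" if "Inner e x \<in> C" "x \<in> {0<..<len M e}" "s < t \<and> s < x \<or> t < s \<and> x < s" for x
  proof (rule ccontr)
    assume "x \<noteq> t"
    then have "x \<in> between s t \<or> t \<in> between s x" using that by (auto simp: between_def)
    then show False using clear[OF t] clear[OF that(2,1)] t that by auto
  qed
  have nr: "Inner e r \<notin> C" using only[of r] r \<open>s \<noteq> t\<close> by (auto simp: between_def min_def max_def split: if_splits)
  have "C \<subseteq> Inner e ` between s r \<or> C \<inter> Inner e ` between s r = {}"
    by (rule connectedin_edge_segment[OF compM e s r(1) circle_facts(1) ns nr])
  then have sub: "C \<subseteq> Inner e ` between s r" using t r by blast
  obtain z where z: "z \<in> C" "z \<noteq> Inner e t" using third_point by blast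
  then obtain x where x: "z = Inner e x" "x \<in> between s r" using sub by blast
  then have "x = t" using only[of x] z r s t \<open>s \<noteq> t\<close> by (auto simp: between_def min_def max_def split: if_splits)
  then show False using x z by simp
qed

definition circle_edges :: "'e set" where
  "circle_edges = {e \<in> edges M. \<exists>t\<in>{0<..<len M e}. Inner e t \<in> C}"

lemma circle_edge_inner: "e \<in> circle_edges \<Longrightarrow> t \<in> {0<..<len M e} \<Longrightarrow> Inner e t \<in> C"
  unfolding circle_edges_def using full_edge by blast

lemma circle_edges_nonempty: "circle_edges \<noteq> {}"
proof
  assume "circle_edges = {}"
  have "C \<subseteq> Vertex ` verts M"
  proof
    fix z assume z: "z \<in> C"
    then have "z \<in> points M" using circle_facts(4) by blast
    then show "z \<in> Vertex ` verts M"
      using z \<open>circle_edges = {}\<close> by (auto simp: points_def circle_edges_def)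
  qed
  moreover have "finite (Vertex ` verts M)" using compM by (simp add: compact_metric_graph_def)
  ultimately show False using circle_facts(3) finite_subset by blast
qed

lemma circle_length: "total_length M C = (\<Sum>e\<in>circle_edges. len M e)"
proof -
  have len: "0 < len M e" if "e \<in> edges M" for e
    using compM that by (auto simp: compact_metric_graph_def)
  have "measure lebesgue {t \<in> {0<..<len M e}. Inner e t \<in> C} = (if e \<in> circle_edges then len M e else 0)"
    if e: "e \<in> edges M" for e
  proof -
    have "{t \<in> {0<..<len M e}. Inner e t \<in> C} = (if e \<in> circle_edges then {0<..<len M e} else {})"
    proof (cases "e \<in> circle_edges")
      case True
      then show ?thesis using circle_edge_inner[OF True] by auto
    next
      case False
      then show ?thesis using e unfolding circle_edges_def by auto
    qed
    then show ?thesis using len[OF e] by auto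
  qed
  then have "total_length M C = (\<Sum>e\<in>edges M. if e \<in> circle_edges then len M e else 0)"
    by (simp add: total_length_def)
  also have "\<dots> = (\<Sum>e\<in>{e \<in> edges M. e \<in> circle_edges}. len M e)"
    using compM by (intro sum.inter_filter[symmetric]) (simp add: compact_metric_graph_def)
  also have "{e \<in> edges M. e \<in> circle_edges} = circle_edges" by (auto simp: circle_edges_def)
  finally show ?thesis .
qed

text \<open>Cutting the circle at the midpoint of an edge with a loose end would disconnect it.\<close>

lemma circle_no_loose_end:
  assumes e: "e \<in> circle_edges"
  shows "\<exists>a. a \<noteq> (e, b) \<and> fst a \<in> circle_edges \<and> end_vertex M (fst a) (snd a) = end_vertex M e b"
proof (rule ccontr)
  assume neg: "\<not> ?thesis"
  define v where "v = end_vertex M e b"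
  have eE: "e \<in> edges M" using e by (simp add: circle_edges_def)
  have len: "0 < len M e" if "e \<in> edges M" for e
    using compM that by (auto simp: compact_metric_graph_def)
  \<comment> \<open>\<open>U\<close> consists of \<open>v\<close> and the half-edges at
    \<open>v\<close> without their midpoints, \<open>V\<close> of everything beyond the midpoints.
    Among the edges of the circle only \<open>e\<close> reaches \<open>v\<close>, and only with its
    end \<open>b\<close>, so the midpoint \<open>p\<close> is a cut point.\<close>
  define near :: "(real \<Rightarrow> real \<Rightarrow> bool) \<Rightarrow> ('v, 'e) point set" where "near = (\<lambda>R. {Vertex v} \<union>
     {Inner e' t | e' t. e' \<in> edges M \<and> 0 < t \<and> t < len M e' \<and>
        (src M e' = v \<and> R t (len M e' / 2) \<or> tgt M e' = v \<and> R (len M e' / 2) t)})"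
  define U V where "U = near (<)" and "V = points M - near (\<le>)"
  have vV: "v \<in> verts M" using compM eE by (auto simp: v_def compact_metric_graph_def end_vertex_def)
  have "openin (mg_topology M) U"
    unfolding openin_mg_topology
  proof (intro conjI ballI)
    show "U \<subseteq> points M" using vV by (auto simp: U_def near_def points_def)
    fix e' assume e': "e' \<in> edges M"
    have "{t \<in> {0..len M e'}. chart M e' t \<in> U} = {0..len M e'} \<inter>
      ((if src M e' = v then {..<len M e' / 2} else {}) \<union> (if tgt M e' = v then {len M e' / 2<..} else {}))"
      using len[OF e'] e' by (auto simp: U_def near_def chart_def)
    then show "openin (top_of_set {0..len M e'}) {t \<in> {0..len M e'}. chart M e' t \<in> U}"
      by (auto intro!: openin_open_Int)
  qed
  moreover have "openin (mg_topology M) V"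
    unfolding openin_mg_topology
  proof (intro conjI ballI)
    show "V \<subseteq> points M" by (auto simp: V_def)
    fix e' assume e': "e' \<in> edges M"
    have "{t \<in> {0..len M e'}. chart M e' t \<in> V} = {0..len M e'} \<inter>
      ((if src M e' = v then {len M e' / 2<..} else UNIV) \<inter> (if tgt M e' = v then {..<len M e' / 2} else UNIV))"
      using len[OF e'] e' chart_in_points[OF compM e'] by (auto simp: V_def near_def chart_def)
    then show "openin (top_of_set {0..len M e'}) {t \<in> {0..len M e'}. chart M e' t \<in> V}"
      by (auto intro!: openin_open_Int)
  qed
  moreover
  define p :: "('v, 'e) point" where "p = Inner e (len M e / 2)"
  have pC: "p \<in> C" unfolding p_def by (rule circle_edge_inner[OF e]) (use len[OF eE] in auto)
  have other: "end_vertex M e (\<not> b) \<noteq> v" using neg e by (force simp: v_def)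
  have "C - {p} \<subseteq> U \<union> V"
  proof
    fix z assume z: "z \<in> C - {p}"
    then have zp: "z \<in> points M" using circle_facts(4) by auto
    show "z \<in> U \<union> V"
    proof (cases z)
      case (Vertex w)
      then show ?thesis using zp by (auto simp: U_def V_def near_def)
    next
      case (Inner e' t)
      then have e': "e' \<in> circle_edges" "t \<in> {0<..<len M e'}" "e' \<in> edges M"
        using z zp by (auto simp: circle_edges_def points_def)
      show ?thesis
      proof (cases "e' = e")
        case True
        then have "t \<noteq> len M e / 2" using z Inner by (auto simp: p_def)
        then show ?thesis using zp Inner True other e' by (auto simp: U_def V_def near_def end_vertex_def)
      next
        case False
        then have "end_vertex M e' c \<noteq> v" for c
          using neg e'(1) unfolding v_def by (metis fst_conv snd_conv)
        then have "src M e' \<noteq> v" "tgt M e' \<noteq> v"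
          unfolding end_vertex_def by (metis (full_types))+
        then show ?thesis using zp Inner by (auto simp: V_def near_def)
      qed
    qed
  qed
  moreover have "U \<inter> V \<inter> (C - {p}) = {}" by (auto simp: U_def V_def near_def)
  ultimately have "U \<inter> (C - {p}) = {} \<or> V \<inter> (C - {p}) = {}"
    using circle_facts(2)[OF pC] unfolding connectedin by blast
  moreover have "Inner e (if b then 3 / 4 * len M e else len M e / 4) \<in> U \<inter> (C - {p})"
    using circle_edge_inner[OF e, of "if b then 3 / 4 * len M e else len M e / 4"] len[OF eE] eE
    by (auto simp: U_def near_def p_def v_def end_vertex_def)
  moreover have "Inner e (if b then len M e / 4 else 3 / 4 * len M e) \<in> V \<inter> (C - {p})"
    using circle_edge_inner[OF e, of "if b then len M e / 4 else 3 / 4 * len M e"] len[OF eE] eE other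
    by (auto simp: V_def near_def p_def v_def end_vertex_def points_def split: if_splits)
  ultimately show False by blast
qed

end

section \<open>The girth\<close>

lemma glue_end: "end_vertex (glue_dirichlet G) e b = glue_vertex G (end_vertex G e b)"
  by (simp add: end_vertex_def glue_dirichlet_def)

lemma glue_simps [simp]:
  "edges (glue_dirichlet G) = edges G" "len (glue_dirichlet G) = len G"
  "src (glue_dirichlet G) e = glue_vertex G (src G e)" "tgt (glue_dirichlet G) e = glue_vertex G (tgt G e)"
  "verts (glue_dirichlet G) = glue_vertex G ` verts G"
  by (simp_all add: glue_dirichlet_def)

lemma compact_glue: "compact_metric_graph G \<Longrightarrow> compact_metric_graph (glue_dirichlet G)"
  by (auto simp: compact_metric_graph_def glue_dirichlet_def)

lemma glue_point_chart: "glue_point G (chart G e t) = chart (glue_dirichlet G) e t"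
  by (simp add: chart_def)

lemma glue_point_image: "glue_point G ` points G = points (glue_dirichlet G)"
proof (intro equalityI subsetI)
  fix p assume "p \<in> points (glue_dirichlet G)"
  then consider v where "v \<in> verts G" "p = Vertex (glue_vertex G v)"
    | e t where "e \<in> edges G" "0 < t" "t < len G e" "p = Inner e t"
    by (auto simp: points_def)
  then show "p \<in> glue_point G ` points G"
  proof cases
    case 1
    then show ?thesis by (intro image_eqI[of _ _ "Vertex v"]) (auto simp: points_def)
  next
    case 2
    then show ?thesis by (intro image_eqI[of _ _ "Inner e t"]) (auto simp: points_def)
  qed
qed (auto simp: points_def)

text \<open>Since \<open>is_tree\<close> also asks for connectedness, this is what makes a glued
  graph that is not a tree contain a cycle.\<close>

lemma connected_glue:
  assumes comp: "compact_metric_graph G" and conn: "connected_graph G"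
  shows "connected_graph (glue_dirichlet G)"
proof -
  have "continuous_map (mg_topology G) (mg_topology (glue_dirichlet G)) (glue_point G)"
    unfolding continuous_map_mg_iff[OF comp]
  proof (intro conjI ballI)
    show "glue_point G \<in> points G \<rightarrow> topspace (mg_topology (glue_dirichlet G))"
      using glue_point_image by (auto simp: topspace_mg_topology[OF compact_glue[OF comp]])
    fix e assume "e \<in> edges G"
    then show "continuous_map (top_of_set {0..len G e}) (mg_topology (glue_dirichlet G)) (\<lambda>t. glue_point G (chart G e t))"
      using continuous_map_chart[OF compact_glue[OF comp], of e] by (simp add: glue_point_chart eta_contract_eq)
  qed
  then have "connectedin (mg_topology (glue_dirichlet G)) (glue_point G ` topspace (mg_topology G))"
    by (rule connectedin_continuous_map_image) (use conn in \<open>simp add: connected_graph_def connectedin_topspace\<close>)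
  then show ?thesis
    unfolding topspace_mg_topology[OF comp] glue_point_image connected_graph_def
      topspace_mg_topology[OF compact_glue[OF comp], symmetric] connectedin_topspace .
qed

text \<open>Gluing affects only vertices, which have no length, and every cycle of the glued graph
  is the image of some set of points of \<open>G\<close>.\<close>

lemma girth_glue:
  fixes G :: "('v, 'e) metric_graph"
  assumes comp: "compact_metric_graph G"
  shows "girth G = (if is_tree (glue_dirichlet G) then 0
    else (LEAST L. \<exists>C. is_cycle (glue_dirichlet G) C \<and> L = total_length (glue_dirichlet G) C))"
proof -
  have len: "total_length G C = total_length (glue_dirichlet G) (glue_point G ` C)" for C
  proof -
    have "Inner e t \<in> C \<longleftrightarrow> Inner e t \<in> glue_point G ` C" for e t
    proof -
      have "x = Inner e t" if "glue_point G x = Inner e t" for x using that by (cases x) auto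
      then show ?thesis by (metis glue_point.simps(2) image_iff)
    qed
    then show ?thesis by (simp add: total_length_def)
  qed
  have "(\<exists>C. C \<subseteq> points G \<and> is_cycle (glue_dirichlet G) (glue_point G ` C) \<and> L = total_length G C) \<longleftrightarrow>
     (\<exists>C. is_cycle (glue_dirichlet G) C \<and> L = total_length (glue_dirichlet G) C)" for L
  proof
    assume "\<exists>C. is_cycle (glue_dirichlet G) C \<and> L = total_length (glue_dirichlet G) C"
    then obtain C where C: "is_cycle (glue_dirichlet G) C" "L = total_length (glue_dirichlet G) C" by blast
    interpret embedded_circle "glue_dirichlet G" C
      by unfold_locales (use C compact_glue[OF comp] in auto)
    have "C \<subseteq> glue_point G ` points G" using circle_facts(4) glue_point_image by metis
    then obtain B where "B \<subseteq> points G" "C = glue_point G ` B" by (meson subset_imageE)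
    then show "\<exists>C. C \<subseteq> points G \<and> is_cycle (glue_dirichlet G) (glue_point G ` C) \<and> L = total_length G C"
      using C len by auto
  qed (use len in auto)
  then show ?thesis unfolding girth_def by simp
qed

lemma girth_cases:
  fixes G :: "('v, 'e) metric_graph"
  assumes comp: "compact_metric_graph G" and conn: "connected_graph G"
  obtains "girth G = 0"
  | C where "is_cycle (glue_dirichlet G) C" "0 < girth G"
    "\<And>C'. is_cycle (glue_dirichlet G) C' \<Longrightarrow> girth G \<le> total_length (glue_dirichlet G) C'"
proof (cases "is_tree (glue_dirichlet G)")
  case True
  then show ?thesis using that(1) girth_glue[OF comp] by simp
next
  case False
  let ?H = "glue_dirichlet G"
  define X where "X = {total_length ?H C | C. is_cycle ?H C}"
  have cyc: "\<exists>F. F \<subseteq> edges G \<and> F \<noteq> {} \<and> total_length ?H C = (\<Sum>e\<in>F. len G e)" if "is_cycle ?H C" for C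
  proof -
    interpret embedded_circle ?H C by unfold_locales (use that compact_glue[OF comp] in auto)
    show ?thesis
      using circle_length circle_edges_nonempty by (intro exI[of _ circle_edges]) (auto simp: circle_edges_def)
  qed
  have fin: "finite (edges G)" and len: "\<And>e. e \<in> edges G \<Longrightarrow> 0 < len G e"
    using comp by (auto simp: compact_metric_graph_def)
  \<comment> \<open>Cycles consist of whole edges, so only finitely many lengths occur and
    \<open>LEAST\<close> over the reals is attained.\<close>
  have "X \<subseteq> (\<lambda>F. \<Sum>e\<in>F. len G e) ` Pow (edges G)" using cyc unfolding X_def by blast
  then have "finite X" using fin by (meson finite_Pow_iff finite_imageI finite_subset)
  moreover obtain C0 where C0: "is_cycle ?H C0"
    using False connected_glue[OF comp conn] by (auto simp: is_tree_def)
  then have "X \<noteq> {}" by (auto simp: X_def)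
  ultimately have "Min X \<in> X" "\<And>x. x \<in> X \<Longrightarrow> Min X \<le> x" by auto
  moreover have "girth G = (LEAST L. L \<in> X)"
    unfolding girth_glue[OF comp] X_def using False by (simp add: conj_commute)
  moreover have "(LEAST L. L \<in> X) = Min X"
    by (rule Least_equality) (use calculation in auto)
  ultimately have g: "girth G \<in> X" "\<And>x. x \<in> X \<Longrightarrow> girth G \<le> x" by auto
  obtain C where C: "is_cycle ?H C" "girth G = total_length ?H C" using g(1) by (auto simp: X_def)
  obtain F where F: "F \<subseteq> edges G" "F \<noteq> {}" "total_length ?H C = (\<Sum>e\<in>F. len G e)" using cyc[OF C(1)] by blast
  have "0 < girth G"
    unfolding C(2) F(3) using F fin len by (intro sum_pos) (auto intro: finite_subset)
  then show ?thesis using that(2)[OF C(1)] g(2) unfolding X_def by blast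
qed

lemma glue_vertex_free: "v \<notin> dirichlet G \<Longrightarrow> glue_vertex G w = glue_vertex G v \<longleftrightarrow> w = v"
  by (auto simp: glue_vertex_def)

lemma cut_graph_glue:
  assumes pd: "phase_data G k F A ph" and comp: "compact_metric_graph G"
  shows "cut_graph G (glue_dirichlet G) (glue_vertex G) k F A ph"
proof
  show "phase_data G k F A ph" "compact_metric_graph G" "compact_metric_graph (glue_dirichlet G)"
    using pd comp compact_glue by auto
  show "inj_on (glue_vertex G) (verts G - dirichlet G)"
    by (auto simp: inj_on_def glue_vertex_free)
  show "end_vertex (glue_dirichlet G) e b \<notin> glue_vertex G ` (verts G - dirichlet G)"
    if "end_vertex G e b \<in> dirichlet G" for e b
    using that by (auto simp: glue_end glue_vertex_free)
qed (simp_all add: glue_end)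

section \<open>The bound by the girth\<close>

text \<open>
  The branches of a star: the links with upper node \<open>T\<close>, each followed by the links \<open>P a\<close> met on the
  way down.
\<close>

definition star_network ::
    "'l set \<Rightarrow> ('l \<Rightarrow> 'n) \<Rightarrow> ('l \<Rightarrow> 'n) \<Rightarrow> 'n set \<Rightarrow> ('l \<Rightarrow> real) \<Rightarrow> real \<Rightarrow> 'n \<Rightarrow> ('l \<Rightarrow> 'l list) \<Rightarrow> bool" where
  "star_network L lo up Dn h k T P \<longleftrightarrow>
     (\<exists>a\<in>L. \<exists>b\<in>L. a \<noteq> b \<and> up a = T \<and> up b = T) \<and>
     (\<forall>a\<in>L. up a = T \<longrightarrow> (\<exists>w\<in>Dn. arch_network.dpath L lo up (lo a) (P a) w) \<and>
        k * (h a + sum_list (map h (P a))) = pi / 2) \<and>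
     (\<forall>a\<in>L. \<forall>b\<in>L. up a = T \<longrightarrow> up b = T \<longrightarrow> a \<noteq> b \<longrightarrow> up ` set (P a) \<inter> up ` set (P b) = {}) \<and>
     (\<forall>b\<in>L. \<forall>c\<in>L. \<forall>n. n \<notin> Dn \<longrightarrow> n = lo c \<or> n = up c \<longrightarrow> n = lo b \<or> n = up b \<longrightarrow>
        (\<exists>a. a \<in> L \<and> up a = T \<and> b \<in> set (a # P a)) \<longrightarrow> (\<exists>a. a \<in> L \<and> up a = T \<and> c \<in> set (a # P a)))"

text \<open>The eigenfunction is chosen positive on an edge \<open>e0\<close> of some cycle of the
  glued graph. That cycle need not be short: it only guarantees that two descents from one node
  exist, and these form the cycle with which the girth is compared.\<close>

lemma girth_frequency:
  fixes G :: "('v, 'e) metric_graph"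
  assumes comp: "compact_metric_graph G" and conn: "connected_graph G" and D: "dirichlet G \<noteq> {}"
    and s: "girth G \<noteq> 0"
  obtains k F A ph where "phase_data G k F A ph" "lambda1 G \<le> k\<^sup>2" "0 < girth G" "girth G * k \<le> pi"
    "girth G * k = pi \<Longrightarrow> \<exists>T P. star_network (F \<times> UNIV) (link_lo G ph) (link_up G ph) (Inl ` dirichlet G)
        (link_len G k ph) k T P"
proof -
  obtain C where C: "is_cycle (glue_dirichlet G) C" and s0: "0 < girth G"
    and smin: "\<And>C'. is_cycle (glue_dirichlet G) C' \<Longrightarrow> girth G \<le> total_length (glue_dirichlet G) C'"
    using girth_cases[OF comp conn] s by metis
  interpret embedded_circle "glue_dirichlet G" C
    by unfold_locales (use C compact_glue[OF comp] in auto)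
  obtain e0 where e0: "e0 \<in> circle_edges" using circle_edges_nonempty by blast
  have ce: "circle_edges \<subseteq> edges G" by (auto simp: circle_edges_def)
  obtain k F A ph where pdF: "phase_data G k F A ph" "e0 \<in> F" "lambda1 G \<le> k\<^sup>2"
    using lambda1_phase_data[OF conn comp D] e0 ce by (metis subsetD)
  interpret cut_graph G "glue_dirichlet G" "glue_vertex G" k F A ph
    by (rule cut_graph_glue[OF pdF(1) comp])
  have sepF: "separated_edges G F" using pdF(1) by (simp add: phase_data_def)
  \<comment> \<open>Along the cycle, the next edge at a free vertex again belongs to
    \<open>F\<close>, as \<open>F\<close> is separated; so \<open>L'\<close> has loose ends only at
    Dirichlet nodes.\<close>
  define L' where "L' = (F \<inter> circle_edges) \<times> (UNIV :: bool set)"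
  have "\<exists>a\<in>F \<times> UNIV. \<exists>b\<in>F \<times> UNIV. a \<noteq> b \<and> link_up G ph a = link_up G ph b"
  proof (rule collision_exists)
    show "L' \<subseteq> F \<times> UNIV" "L' \<noteq> {}" using pdF(2) e0 by (auto simp: L'_def)
    fix a n assume a: "a \<in> L'" "n = link_lo G ph a \<or> n = link_up G ph a" "n \<notin> Inl ` dirichlet G"
    obtain e b where ab: "a = (e, b)" by (cases a)
    have e: "e \<in> F" "e \<in> circle_edges" using a(1) by (auto simp: L'_def ab)
    consider "n = Inr e" | "n = end_node G a"
      using a(2) by (auto simp: link_lo_def link_up_def ab split: if_splits)
    then show "\<exists>b\<in>L'. b \<noteq> a \<and> (link_lo G ph b = n \<or> link_up G ph b = n)"
    proof cases
      case 1
      then show ?thesis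
        using e by (intro bexI[of _ "(e, \<not> b)"]) (auto simp: L'_def ab link_lo_def link_up_def)
    next
      case 2
      define v where "v = end_vertex G e b"
      have v: "v \<notin> dirichlet G" using a(3) 2 by (auto simp: end_node_def v_def ab)
      obtain a' where a': "a' \<noteq> a" "fst a' \<in> circle_edges"
        "glue_vertex G (end_vertex G (fst a') (snd a')) = glue_vertex G v"
        using circle_no_loose_end[OF e(2), of b] unfolding glue_end v_def ab by metis
      then have ev: "end_vertex G (fst a') (snd a') = v" using glue_vertex_free[OF v] by simp
      have "v \<in> verts G" using end_verts e(1) F_edges by (auto simp: v_def)
      moreover have "a \<in> ends_at G v" "a' \<in> ends_at G v"
        using e a' ev ce by (auto simp: ends_at_def ab v_def)
      ultimately have "fst a' \<in> F"
        using sepF[unfolded separated_edges_iff] v e(1) ab by (metis DiffI fst_conv)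
      then have "a' \<in> L'" using a' by (auto simp: L'_def mem_Times_iff)
      moreover have "end_node G a' = n" using 2 ev by (simp add: end_node_def ab v_def)
      ultimately show ?thesis using a'(1) by (intro bexI[of _ a']) (auto simp: link_lo_def link_up_def)
    qed
  qed
  then obtain a0 b0 where ab0: "a0 \<in> F \<times> UNIV" "b0 \<in> F \<times> UNIV" "a0 \<noteq> b0" "link_up G ph a0 = link_up G ph b0"
    "unique_below (node_val G k A ph (link_up G ph a0))"
    by (rule lowest_collision)
  have bound: "girth G \<le> lk a + sum_list (map lk as) + (lk b + sum_list (map lk bs))"
    if ab: "a \<in> F \<times> UNIV" "b \<in> F \<times> UNIV" "a \<noteq> b" "link_up G ph a = link_up G ph b"
      and *: "disjoint_descents (link_lo G ph a) (link_lo G ph b) as bs w w' \<or>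
        (as = [] \<and> bs = [] \<and> w = link_lo G ph a \<and> w' = link_lo G ph a \<and> link_lo G ph a = link_lo G ph b \<and>
         link_lo G ph a \<notin> Inl ` dirichlet G)" for a b as bs w w'
  proof -
    have d: "dpath (link_lo G ph a) as w" "dpath (link_lo G ph b) bs w'"
      "link_up G ph ` set as \<inter> link_up G ph ` set bs = {}" "w \<notin> link_up G ph ` set bs" "w' \<notin> link_up G ph ` set as"
      "w = w' \<and> w \<notin> Inl ` dirichlet G \<or> w \<in> Inl ` dirichlet G \<and> w' \<in> Inl ` dirichlet G"
      using * by (auto simp: disjoint_descents_def)
    have la: "last (a # as) \<in> F \<times> UNIV" "link_lo G ph (last (a # as)) = w"
      and lb: "last (b # bs) \<in> F \<times> UNIV" "link_lo G ph (last (b # bs)) = w'"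
      using last_link[OF ab(1) d(1)] last_link[OF ab(2) d(2)] by auto
    \<comment> \<open>In the glued graph all Dirichlet ends sit at the one vertex
      \<open>dirichlet G\<close>, so two descents to different Dirichlet nodes close up as
      well.\<close>
    have end_d: "lo_pt c = Vertex (dirichlet G)"
      if c: "c \<in> F \<times> UNIV" "link_lo G ph c \<in> Inl ` dirichlet G" for c
    proof -
      have "end_vertex G (fst c) (snd c) \<in> dirichlet G"
        using c(2) by (auto simp: link_lo_def end_node_def split: if_splits)
      then show ?thesis
        using lo_pt_dirichlet[OF c] by (simp add: end_pt_def glue_end glue_vertex_def)
    qed
    have "lo_pt (last (a # as)) = lo_pt (last (b # bs))"
      using d(6) node_pt_lo[OF la(1)] node_pt_lo[OF lb(1)] end_d[OF la(1)] end_d[OF lb(1)]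
      unfolding la(2) lb(2) by metis
    then obtain C' where "is_cycle (glue_dirichlet G) C'"
      "total_length (glue_dirichlet G) C' = lk a + sum_list (map lk as) + (lk b + sum_list (map lk bs))"
      using descents_cycle[OF ab d(1-5)] by blast
    then show ?thesis using smin by metis
  qed
  have "girth G * k \<le> pi"
  proof -
    obtain as bs w w' where *:
      "disjoint_descents (link_lo G ph a0) (link_lo G ph b0) as bs w w' \<or>
        (as = [] \<and> bs = [] \<and> w = link_lo G ph a0 \<and> w' = link_lo G ph a0 \<and> link_lo G ph a0 = link_lo G ph b0 \<and>
         link_lo G ph a0 \<notin> Inl ` dirichlet G)"
      "k * (lk a0 + sum_list (map lk as)) \<le> link_tu G k ph a0"
      "k * (lk b0 + sum_list (map lk bs)) \<le> link_tu G k ph b0"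
      using two_descents[OF ab0] by metis
    have "k * girth G \<le> k * (lk a0 + sum_list (map lk as) + (lk b0 + sum_list (map lk bs)))"
      using bound[OF ab0(1-4) *(1)] k_pos by (intro mult_left_mono) auto
    also have "\<dots> \<le> pi"
      using *(2,3) tu_le[OF ab0(1)] tu_le[OF ab0(2)] by (simp add: algebra_simps)
    finally show ?thesis by (simp add: mult.commute)
  qed
  moreover have "\<exists>T P. star_network (F \<times> UNIV) (link_lo G ph) (link_up G ph) (Inl ` dirichlet G) lk k T P"
    if e: "girth G * k = pi"
  proof -
    define T where "T = link_up G ph a0"
    show ?thesis
    proof (rule star_structure[of a0 b0 T])
      show "a0 \<in> F \<times> UNIV" "b0 \<in> F \<times> UNIV" "a0 \<noteq> b0" "link_up G ph a0 = T" "link_up G ph b0 = T"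
        "unique_below (node_val G k A ph T)"
        using ab0 by (simp_all add: T_def)
      show "pi \<le> k * (lk a + sum_list (map lk as) + (lk b + sum_list (map lk bs)))"
        if "a \<in> F \<times> UNIV" "b \<in> F \<times> UNIV" "a \<noteq> b" "link_up G ph a = T" "link_up G ph b = T"
         "disjoint_descents (link_lo G ph a) (link_lo G ph b) as bs w w' \<or>
        (as = [] \<and> bs = [] \<and> w = link_lo G ph a \<and> w' = link_lo G ph a \<and> link_lo G ph a = link_lo G ph b \<and>
         link_lo G ph a \<notin> Inl ` dirichlet G)" for a b as bs w w'
      proof -
        have "girth G * k \<le> (lk a + sum_list (map lk as) + (lk b + sum_list (map lk bs))) * k"
          using bound[OF that(1-3) _ that(6)] that(4,5) k_pos by (intro mult_right_mono) auto
        then show ?thesis using e by (simp add: mult.commute)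
      qed
      fix P
      assume P: "\<And>a. a \<in> F \<times> UNIV \<Longrightarrow> link_up G ph a = T \<Longrightarrow> \<exists>w\<in>Inl ` dirichlet G. dpath (link_lo G ph a) (P a) w"
        "\<And>a. a \<in> F \<times> UNIV \<Longrightarrow> link_up G ph a = T \<Longrightarrow> k * (lk a + sum_list (map lk (P a))) = pi / 2"
        "\<And>a b. a \<in> F \<times> UNIV \<Longrightarrow> b \<in> F \<times> UNIV \<Longrightarrow> link_up G ph a = T \<Longrightarrow> link_up G ph b = T \<Longrightarrow> a \<noteq> b \<Longrightarrow>
           link_up G ph ` set (P a) \<inter> link_up G ph ` set (P b) = {}"
        "\<And>b c n. c \<in> F \<times> UNIV \<Longrightarrow> n = link_lo G ph c \<or> n = link_up G ph c \<Longrightarrow> n \<notin> Inl ` dirichlet G \<Longrightarrow>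
           b \<in> F \<times> UNIV \<Longrightarrow> n = link_lo G ph b \<or> n = link_up G ph b \<Longrightarrow>
           \<exists>a. a \<in> F \<times> UNIV \<and> link_up G ph a = T \<and> b \<in> set (a # P a) \<Longrightarrow>
           \<exists>a. a \<in> F \<times> UNIV \<and> link_up G ph a = T \<and> c \<in> set (a # P a)"
      show ?thesis
        unfolding star_network_def
      proof (rule exI[of _ T], rule exI[of _ P], intro conjI)
        show "\<exists>a\<in>F \<times> UNIV. \<exists>b\<in>F \<times> UNIV. a \<noteq> b \<and> link_up G ph a = T \<and> link_up G ph b = T"
          using ab0 unfolding T_def by metis
      qed (intro ballI impI allI conjI; (rule P; assumption))+
    qed
  qed
  ultimately show ?thesis by (rule that[OF pdF(1,3) s0])
qed

lemma lambda1_le: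
  fixes G :: "('v, 'e) metric_graph"
  assumes comp: "compact_metric_graph G" and conn: "connected_graph G" and D: "dirichlet G \<noteq> {}"
    and s: "girth G \<noteq> 0"
  shows "lambda1 G \<le> pi\<^sup>2 / (girth G)\<^sup>2"
proof (rule girth_frequency[OF assms])
  fix k F A ph
  assume *: "phase_data G k F A ph" "lambda1 G \<le> k\<^sup>2" "0 < girth G" "girth G * k \<le> pi"
  have "0 < k" using *(1) by (simp add: phase_data_def)
  then have "k \<le> pi / girth G" using *(3,4) by (simp add: field_simps)
  then have "k\<^sup>2 \<le> (pi / girth G)\<^sup>2" using \<open>0 < k\<close> by (intro power_mono) auto
  then show ?thesis using *(2) by (simp add: power_divide)
qed

section \<open>Separated Dirichlet vertices\<close>

lemma separate_simps [simp]:
  "edges (separate_dirichlet G) = edges G" "len (separate_dirichlet G) = len G"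
  "src (separate_dirichlet G) e = separate_vertex G e False"
  "tgt (separate_dirichlet G) e = separate_vertex G e True"
  by (simp_all add: separate_dirichlet_def)

lemma separate_end: "end_vertex (separate_dirichlet G) e b = separate_vertex G e b"
  by (simp add: end_vertex_def)

lemma separate_vertex_verts:
  "compact_metric_graph G \<Longrightarrow> e \<in> edges G \<Longrightarrow> separate_vertex G e b \<in> verts (separate_dirichlet G)"
  by (auto simp: separate_dirichlet_def separate_vertex_def ends_at_def compact_metric_graph_def end_vertex_def)

lemma compact_separate:
  assumes "compact_metric_graph G"
  shows "compact_metric_graph (separate_dirichlet G)"
  unfolding compact_metric_graph_def
proof (intro conjI ballI)
  have "finite (dirichlet G)" using assms by (auto simp: compact_metric_graph_def intro: finite_subset)
  then show "finite (verts (separate_dirichlet G))"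
    using assms ends_at_finite[OF assms] by (auto simp: separate_dirichlet_def compact_metric_graph_def)
qed (use assms separate_vertex_verts[OF assms] in \<open>auto simp: compact_metric_graph_def separate_dirichlet_def\<close>)

lemma cut_graph_separate:
  assumes pd: "phase_data G k F A ph" and comp: "compact_metric_graph G"
  shows "cut_graph G (separate_dirichlet G) Inl k F A ph"
proof
  show "phase_data G k F A ph" "compact_metric_graph G" "compact_metric_graph (separate_dirichlet G)"
    using pd comp compact_separate by auto
qed (auto simp: separate_end separate_vertex_def)

text \<open>In the separated graph no Dirichlet vertex is shared by two edge ends, so
  \<open>F\<close> is closed under incidence. Applied to the support of phase data, this makes the
  eigenfunction positive on all edges.\<close>

lemma separated_edges_connected:
  assumes comp: "compact_metric_graph G" and conn: "connected_graph (separate_dirichlet G)"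
    and F: "separated_edges G F" "F \<noteq> {}"
  shows "F = edges G"
proof -
  let ?S = "separate_dirichlet G"
  define W where "W = Inl ` {v \<in> verts G - dirichlet G. \<exists>a\<in>ends_at G v. fst a \<in> F} \<union>
     Inr ` {a \<in> (\<Union>v\<in>dirichlet G. ends_at G v). fst a \<in> F}"
  have FE: "F \<subseteq> edges G" using F by (simp add: separated_edges_def)
  have "(W = {} \<and> F = {}) \<or> (W = verts ?S \<and> F = edges ?S)"
  proof (rule connected_graph_clopen[OF conn compact_separate[OF comp]])
    show "W \<subseteq> verts ?S" by (auto simp: W_def separate_dirichlet_def)
    show "F \<subseteq> edges ?S" using FE by simp
    fix e b assume "e \<in> edges ?S"
    then have e: "e \<in> edges G" by simp
    define v where "v = end_vertex G e b"
    have v: "v \<in> verts G" "(e, b) \<in> ends_at G v"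
      using comp e by (auto simp: v_def end_vertex_def compact_metric_graph_def ends_at_def)
    show "e \<in> F \<longleftrightarrow> end_vertex ?S e b \<in> W"
    proof (cases "v \<in> dirichlet G")
      case True
      then show ?thesis using v by (auto simp: separate_end separate_vertex_def v_def[symmetric] W_def)
    next
      case False
      then have "e \<in> F \<longleftrightarrow> (\<exists>a\<in>ends_at G v. fst a \<in> F)"
        using F(1)[unfolded separated_edges_iff] v by (metis DiffI fst_conv)
      then show ?thesis using v False by (auto simp: separate_end separate_vertex_def v_def[symmetric] W_def)
    qed
  qed
  then show ?thesis using F(2) by simp
qed

text \<open>A Dirichlet node is never the upper node of a link, so a descent cannot continue
  there.\<close>

lemma (in arch_network) dirichlet_last:
  "dpath n as w \<Longrightarrow> c \<in> set as \<Longrightarrow> lo c \<in> Dn \<Longrightarrow> c = last as"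
proof (induction as arbitrary: n)
  case (Cons a as)
  show ?case
  proof (cases as)
    case Nil
    then show ?thesis using Cons.prems by simp
  next
    case (Cons b bs)
    then have "lo a = up b" "b \<in> L" using Cons.prems(1) by auto
    then have "c \<noteq> a" using Cons.prems(3) up_free[of b] by auto
    then have "c = last as" using Cons.IH Cons.prems by auto
    then show ?thesis using Cons by simp
  qed
qed simp

lemma total_length_UN:
  assumes "finite J" "\<And>i. i \<in> J \<Longrightarrow> measurable_part M (X i)"
    and "\<And>i j. i \<in> J \<Longrightarrow> j \<in> J \<Longrightarrow> i \<noteq> j \<Longrightarrow> finite (X i \<inter> X j)"
  shows "measurable_part M (\<Union>i\<in>J. X i) \<and> total_length M (\<Union>i\<in>J. X i) = (\<Sum>i\<in>J. total_length M (X i))"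
  using assms
proof (induction J rule: finite_induct)
  case empty
  then show ?case by (simp add: measurable_part_def inner_params_def total_length_inner)
next
  case (insert i J)
  then have IH: "measurable_part M (\<Union>i\<in>J. X i)" "total_length M (\<Union>i\<in>J. X i) = (\<Sum>i\<in>J. total_length M (X i))"
    by auto
  have "finite (X i \<inter> X j)" if "j \<in> J" for j
    using insert.prems(2)[of i j] insert.hyps(2) that by auto
  then have "finite (\<Union>j\<in>J. X i \<inter> X j)" using insert.hyps(1) by blast
  moreover have "X i \<inter> (\<Union>j\<in>J. X j) = (\<Union>j\<in>J. X i \<inter> X j)" by auto
  ultimately have fin: "finite (X i \<inter> (\<Union>j\<in>J. X j))" by metis
  have Xi: "measurable_part M (X i)" using insert.prems by simp
  show ?case
    using total_length_Un[OF Xi IH(1) fin] measurable_part_Un[OF Xi IH(1)] IH(2) insert.hyps by simp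
qed

section \<open>Recognising an equilateral star\<close>

lemma compact_star: "0 < r \<Longrightarrow> compact_metric_graph (equilateral_star n r)"
  by (auto simp: compact_metric_graph_def equilateral_star_def)

lemma star_simps [simp]:
  "edges (equilateral_star n r) = {1..n}" "len (equilateral_star n r) j = r"
  "src (equilateral_star n r) j = 0" "tgt (equilateral_star n r) j = j"
  "verts (equilateral_star n r) = {0..n}" "dirichlet (equilateral_star n r) = {1..n}"
  by (simp_all add: equilateral_star_def)

lemma star_point:
  assumes "0 < r" "0 < n" "p \<in> points (equilateral_star n r)"
  shows "\<exists>j\<in>{1..n}. \<exists>t\<in>{0..r}. p = chart (equilateral_star n r) j t"
proof -
  consider i where "i \<le> n" "p = Vertex i"
    | j t where "j \<in> {1..n}" "0 < t" "t < r" "p = Inner j t"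
    using assms(3) unfolding points_def by auto
  then show ?thesis
  proof cases
    case (1 i)
    show ?thesis
    proof (cases "i = 0")
      case True
      then show ?thesis using assms 1 by (intro bexI[of _ 1] bexI[of _ 0]) (auto simp: chart_def)
    next
      case False
      then show ?thesis using assms 1 by (intro bexI[of _ i] bexI[of _ r]) (auto simp: chart_def)
    qed
  next
    case (2 j t)
    then show ?thesis by (intro bexI[of _ j] bexI[of _ t]) (auto simp: chart_def)
  qed
qed

text \<open>The bijection is built from the star to \<open>S\<close>, since continuity can be
  checked on the charts of the star. Compactness supplies the continuous inverse, which is the map
  that \<open>same_metric_graph\<close> asks for.\<close>

lemma star_of_arcs:
  fixes S :: "('v, 'e) metric_graph" and Q :: "nat \<Rightarrow> real \<Rightarrow> ('v, 'e) point"
  assumes comp: "compact_metric_graph S" and r: "0 < r" and n: "0 < n"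
    and arc: "\<And>j. j \<in> {1..n} \<Longrightarrow> unit_arc S r (Q j) c (Vertex (z j))"
    and disj: "\<And>i j. i \<in> {1..n} \<Longrightarrow> j \<in> {1..n} \<Longrightarrow> i \<noteq> j \<Longrightarrow> Q i ` {0..r} \<inter> Q j ` {0..r} \<subseteq> {c}"
    and cover: "(\<Union>j\<in>{1..n}. Q j ` {0..r}) = points S"
    and dir: "dirichlet S = z ` {1..n}"
  shows "same_metric_graph S (equilateral_star n r)"
proof -
  let ?X = "equilateral_star n r"
  have compX: "compact_metric_graph ?X" by (rule compact_star[OF r])
  have Q: "continuous_map (top_of_set {0..r}) (mg_topology S) (Q j)" "inj_on (Q j) {0..r}"
    "Q j 0 = c" "Q j r = Vertex (z j)"
    "\<And>W. W \<in> sets lebesgue \<Longrightarrow> W \<subseteq> {0..r} \<Longrightarrow> measurable_part S (Q j ` W) \<and> total_length S (Q j ` W) = measure lebesgue W"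
    if "j \<in> {1..n}" for j
    using arc[OF that] by (auto simp: unit_arc_def)
  define g where "g = (\<lambda>p. case p of Vertex j \<Rightarrow> if j = 0 then c else Vertex (z j) | Inner j t \<Rightarrow> Q j t)"
  have gc: "g (chart ?X j t) = Q j t" if "j \<in> {1..n}" "t \<in> {0..r}" for j t
    using that Q(3,4)[OF that(1)] r by (auto simp: g_def chart_def)
  have cont: "continuous_map (mg_topology ?X) (mg_topology S) g"
    unfolding continuous_map_mg_iff[OF compX]
  proof (intro conjI ballI)
    show "g \<in> points ?X \<rightarrow> topspace (mg_topology S)"
    proof
      fix p assume "p \<in> points ?X"
      then obtain j t where "j \<in> {1..n}" "t \<in> {0..r}" "p = chart ?X j t" using star_point[OF r n] by blast
      then show "g p \<in> topspace (mg_topology S)"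
        using gc cover topspace_mg_topology[OF comp] by (metis UN_I imageI)
    qed
    fix j assume "j \<in> edges ?X"
    then have j: "j \<in> {1..n}" by simp
    have "continuous_map (top_of_set {0..r}) (mg_topology S) (\<lambda>t. g (chart ?X j t))"
      by (rule continuous_map_eq[OF Q(1)[OF j]]) (simp add: gc[OF j])
    then show "continuous_map (top_of_set {0..len ?X j}) (mg_topology S) (\<lambda>t. g (chart ?X j t))" by simp
  qed
  have image_chart: "g ` points ?X = (\<Union>j\<in>{1..n}. Q j ` {0..r})"
  proof (intro equalityI subsetI)
    fix q assume "q \<in> g ` points ?X"
    then obtain p where "p \<in> points ?X" "q = g p" by blast
    then obtain j t where "j \<in> {1..n}" "t \<in> {0..r}" "q = Q j t" using star_point[OF r n] gc by metis
    then show "q \<in> (\<Union>j\<in>{1..n}. Q j ` {0..r})" by blast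
  next
    fix q assume "q \<in> (\<Union>j\<in>{1..n}. Q j ` {0..r})"
    then obtain j t where jt: "j \<in> {1..n}" "t \<in> {0..r}" "q = Q j t" by blast
    then have "chart ?X j t \<in> points ?X" by (intro chart_in_points[OF compX]) simp
    then show "q \<in> g ` points ?X" using gc jt by (metis image_eqI)
  qed
  have inj: "inj_on g (points ?X)"
  proof (rule inj_onI)
    fix p p' assume p: "p \<in> points ?X" "p' \<in> points ?X" and e: "g p = g p'"
    obtain j t where jt: "j \<in> {1..n}" "t \<in> {0..r}" "p = chart ?X j t" using star_point[OF r n p(1)] by blast
    obtain i u where iu: "i \<in> {1..n}" "u \<in> {0..r}" "p' = chart ?X i u" using star_point[OF r n p(2)] by blast
    have eq: "Q j t = Q i u" using e gc jt iu by simp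
    show "p = p'"
    proof (cases "i = j")
      case True
      then show ?thesis using inj_onD[OF Q(2)[OF jt(1)], of t u] eq jt iu by simp
    next
      case False
      have "Q j t \<in> Q j ` {0..r} \<inter> Q i ` {0..r}" using eq jt(2) iu(2) by (metis IntI imageI)
      then have "Q j t = c" using disj[OF jt(1) iu(1)] False by auto
      then have "Q j t = Q j 0" "Q i u = Q i 0" using Q(3) jt(1) iu(1) eq by simp_all
      then have "t = 0" "u = 0"
        using inj_onD[OF Q(2)[OF jt(1)], of t 0] inj_onD[OF Q(2)[OF iu(1)], of u 0] jt(2) iu(2) r by auto
      then show ?thesis using jt iu by (simp add: chart_def)
    qed
  qed
  have hom: "homeomorphic_map (mg_topology ?X) (mg_topology S) g"
    by (rule continuous_imp_homeomorphic_map[OF cont compact_space_mg[OF compX] Hausdorff_space_mg[OF comp]])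
      (use image_chart cover inj in \<open>auto simp: topspace_mg_topology[OF comp] topspace_mg_topology[OF compX]\<close>)
  then obtain h where h: "homeomorphic_maps (mg_topology ?X) (mg_topology S) g h"
    using homeomorphic_map_maps by blast
  have homh: "homeomorphic_map (mg_topology S) (mg_topology ?X) h"
    using h homeomorphic_maps_map by blast
  have gh: "g (h q) = q" if "q \<in> points S" for q
    using h that by (auto simp: homeomorphic_maps_def topspace_mg_topology[OF comp])
  have hg: "h (g p) = p" if "p \<in> points ?X" for p
    using h that by (auto simp: homeomorphic_maps_def topspace_mg_topology[OF compX])
  have len: "total_length S (g ` U) = total_length ?X U" if U: "openin (mg_topology ?X) U" for U
  proof -
    define W where "W = (\<lambda>j. {t \<in> {0..r}. chart ?X j t \<in> U})"
    have Usub: "U \<subseteq> points ?X" using U by (simp add: openin_mg_topology)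
    have W: "W j \<in> sets lebesgue" if "j \<in> {1..n}" for j
    proof -
      have "openin (top_of_set {0..r}) (W j)" using U that unfolding openin_mg_topology W_def by auto
      then obtain O' where "open O'" "W j = {0..r} \<inter> O'" by (auto simp: openin_open)
      then show ?thesis by (simp add: borel_open sets_completionI_sets)
    qed
    have Wr: "W j \<subseteq> {0..r}" for j by (auto simp: W_def)
    have "g ` U = (\<Union>j\<in>{1..n}. Q j ` W j)"
    proof (intro equalityI subsetI)
      fix q assume "q \<in> g ` U"
      then obtain p where p: "p \<in> U" "q = g p" by blast
      then obtain j t where jt: "j \<in> {1..n}" "t \<in> {0..r}" "p = chart ?X j t" using star_point[OF r n] Usub by blast
      then have "t \<in> W j" "q = Q j t" using p gc by (auto simp: W_def)
      then show "q \<in> (\<Union>j\<in>{1..n}. Q j ` W j)" using jt by blast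
    next
      fix q assume "q \<in> (\<Union>j\<in>{1..n}. Q j ` W j)"
      then obtain j t where jt: "j \<in> {1..n}" "t \<in> W j" "q = Q j t" by blast
      then have "chart ?X j t \<in> U" "q = g (chart ?X j t)" using gc[OF jt(1)] by (auto simp: W_def)
      then show "q \<in> g ` U" by blast
    qed
    moreover have "finite (Q i ` W i \<inter> Q j ` W j)" if "i \<in> {1..n}" "j \<in> {1..n}" "i \<noteq> j" for i j
    proof (rule finite_subset)
      show "Q i ` W i \<inter> Q j ` W j \<subseteq> {c}" using disj[OF that] Wr[of i] Wr[of j] by blast
    qed simp
    ultimately have "total_length S (g ` U) = (\<Sum>j\<in>{1..n}. total_length S (Q j ` W j))"
      using total_length_UN[of "{1..n}" S "\<lambda>j. Q j ` W j"] Q(5) W Wr by simp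
    also have "\<dots> = (\<Sum>j\<in>{1..n}. measure lebesgue (W j))"
      using Q(5) W Wr by (intro sum.cong) auto
    also have "\<dots> = (\<Sum>j\<in>{1..n}. measure lebesgue {t \<in> {0<..<r}. Inner j t \<in> U})"
    proof (intro sum.cong refl)
      fix j assume j: "j \<in> {1..n}"
      have "{t \<in> {0<..<r}. Inner j t \<in> U} = W j - {0, r}" by (auto simp: W_def chart_def)
      moreover have "measure lebesgue (W j - {0, r}) = measure lebesgue (W j)"
        using W[OF j] by (intro measure_Diff_null_set) (auto simp: negligible_iff_null_sets[symmetric] negligible_finite)
      ultimately show "measure lebesgue (W j) = measure lebesgue {t \<in> {0<..<r}. Inner j t \<in> U}" by simp
    qed
    also have "\<dots> = total_length ?X U" by (simp add: total_length_def)
    finally show ?thesis .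
  qed
  show ?thesis
    unfolding same_metric_graph_def
  proof (intro exI[of _ h] conjI allI impI homh)
    fix U assume U: "openin (mg_topology S) U"
    have Us: "U \<subseteq> points S" using U by (simp add: openin_mg_topology)
    have "openin (mg_topology ?X) (h ` U)"
      using homeomorphic_map_openness_eq[OF homh] U by blast
    moreover have "g ` h ` U = U" using gh Us by (force simp: image_iff)
    ultimately show "total_length ?X (h ` U) = total_length S U" using len[of "h ` U"] by simp
  next
    have "g (Vertex j) = Vertex (z j)" if "j \<in> {1..n}" for j using that by (auto simp: g_def)
    then have "Vertex ` dirichlet S = g ` Vertex ` {1..n}" unfolding dir by (auto simp: image_image)
    moreover have "h ` g ` Vertex ` {1..n} = Vertex ` {1..n}"
    proof -
      have "h (g (Vertex j)) = Vertex j" if "j \<in> {1..n}" for j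
        using hg[of "Vertex j"] that by (auto simp: points_def)
      then show ?thesis by (auto simp: image_image)
    qed
    ultimately show "h ` Vertex ` dirichlet S = Vertex ` dirichlet ?X" by simp
  qed
qed

text \<open>By the last clause of \<open>star_network\<close> the edges covered by branches form a
  separated set, so by connectedness the branches cover everything. They meet only in the node
  \<open>T\<close>: their lower ends are kept apart by the separation of the Dirichlet
  vertices.\<close>

lemma star_of_network:
  fixes G :: "('v, 'e) metric_graph"
  assumes pdG: "phase_data G k F A ph" and comp: "compact_metric_graph G"
    and conn: "connected_graph (separate_dirichlet G)"
    and star: "star_network (F \<times> UNIV) (link_lo G ph) (link_up G ph) (Inl ` dirichlet G) (link_len G k ph) k T P"
  shows "\<exists>n\<ge>2. same_metric_graph (separate_dirichlet G) (equilateral_star n (pi / (2 * k)))"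
proof -
  let ?S = "separate_dirichlet G"
  let ?D = "Inl ` dirichlet G :: ('v + 'e) set"
  interpret cut_graph G ?S Inl k F A ph by (rule cut_graph_separate[OF pdG comp])
  define r where "r = pi / (2 * k)"
  have r: "0 < r" using k_pos by (simp add: r_def)
  have FG: "F = edges G"
    using separated_edges_connected[OF comp conn] pdG by (auto simp: phase_data_def)
  define N where "N = {a \<in> F \<times> UNIV. link_up G ph a = T}"
  note st = star[unfolded star_network_def]
  note star1 = st[THEN conjunct1]
  have star2: "\<exists>w\<in>?D. dpath (link_lo G ph a) (P a) w" "k * (lk a + sum_list (map lk (P a))) = pi / 2" if "a \<in> N" for a
    using st[THEN conjunct2, THEN conjunct1, rule_format, of a] that unfolding N_def by blast+
  have star3: "link_up G ph ` set (P a) \<inter> link_up G ph ` set (P b) = {}" if "a \<in> N" "b \<in> N" "a \<noteq> b" for a b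
    using st[THEN conjunct2, THEN conjunct2, THEN conjunct1, rule_format, of a b] that unfolding N_def by blast
  have star4: "\<exists>a\<in>N. c \<in> set (a # P a)"
    if "b \<in> F \<times> UNIV" "c \<in> F \<times> UNIV" "m \<notin> ?D" "m = link_lo G ph c \<or> m = link_up G ph c"
      "m = link_lo G ph b \<or> m = link_up G ph b" "\<exists>a\<in>N. b \<in> set (a # P a)" for b c m
  proof -
    have "\<exists>a. a \<in> F \<times> UNIV \<and> link_up G ph a = T \<and> b \<in> set (a # P a)"
      using that(6) unfolding N_def by blast
    from st[THEN conjunct2, THEN conjunct2, THEN conjunct2, rule_format, OF that(1-5) this]
    show ?thesis unfolding N_def by blast
  qed
  define Z where "Z = {b \<in> F \<times> UNIV. \<exists>a\<in>N. b \<in> set (a # P a)}"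
  have share: "c \<in> Z" if "b \<in> Z" "c \<in> F \<times> UNIV" "m \<notin> ?D" "m = link_lo G ph c \<or> m = link_up G ph c"
      "m = link_lo G ph b \<or> m = link_up G ph b" for b c m
    using star4[OF _ that(2-5)] that(1,2) unfolding Z_def by blast
  \<comment> \<open>The two links of an edge share its cut point \<open>Inr e\<close>, which is
    never a Dirichlet node.\<close>
  have mid: "(e, b') \<in> Z" if "(e, b) \<in> Z" for e b b'
  proof (rule share[OF that, of _ "Inr e"])
    show "(e, b') \<in> F \<times> UNIV" using that by (simp add: Z_def)
  qed (auto simp: link_lo_def link_up_def)
  define E' where "E' = {e. (e, False) \<in> Z}"
  have "E' = edges G"
  proof (rule separated_edges_connected[OF comp conn])
    obtain e b where "(e, b) \<in> F \<times> UNIV" "link_up G ph (e, b) = T" using star1 by (metis surj_pair)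
    then have "(e, b) \<in> Z" unfolding Z_def N_def by fastforce
    then show "E' \<noteq> {}" using mid[of e b False] unfolding E'_def by blast
    show "separated_edges G E'"
      unfolding separated_edges_iff
    proof (intro conjI ballI impI)
      show "E' \<subseteq> edges G" using F_edges by (auto simp: E'_def Z_def)
      fix v a b assume v: "v \<in> verts G - dirichlet G" and ab: "a \<in> ends_at G v" "b \<in> ends_at G v" "fst a \<in> E'"
      have aZ: "a \<in> Z" using mid[of "fst a" False "snd a"] ab(3) by (simp add: E'_def)
      have "b \<in> Z"
      proof (rule share[OF aZ, of b "Inl v"])
        show "b \<in> F \<times> UNIV" using ab(2) FG by (auto simp: ends_at_def)
        show "Inl v \<notin> ?D" using v by auto
        have "end_node G a = Inl v" "end_node G b = Inl v" using ab by (auto simp: ends_at_def end_node_def)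
        then show "Inl v = link_lo G ph b \<or> Inl v = link_up G ph b" "Inl v = link_lo G ph a \<or> Inl v = link_up G ph a"
          by (auto simp: link_lo_def link_up_def)
      qed
      then show "fst b \<in> E'" using mid[of "fst b" "snd b" False] by (simp add: E'_def)
    qed
  qed
  then have Zall: "b \<in> Z" if "b \<in> F \<times> UNIV" for b
  proof -
    have "fst b \<in> E'" using \<open>E' = edges G\<close> that FG by auto
    then show ?thesis using mid[of "fst b" False "snd b"] by (simp add: E'_def)
  qed
  have finN: "finite N" unfolding N_def using finite_links by simp
  define n where "n = card N"
  have n: "2 \<le> n"
  proof -
    obtain a b where "a \<in> N" "b \<in> N" "a \<noteq> b" using star1 unfolding N_def by blast
    then have "card {a, b} \<le> card N" using finN by (intro card_mono) auto
    then show ?thesis using \<open>a \<noteq> b\<close> by (simp add: n_def)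
  qed
  obtain ix where ix: "bij_betw ix {1..n} N"
    using ex_bij_betw_nat_finite_1[OF finN] unfolding n_def by blast
  have ixN: "ix j \<in> N" if "j \<in> {1..n}" for j using ix that by (auto simp: bij_betw_def)
  define la where "la = (\<lambda>a. last (a # P a))"
  have NF: "a \<in> F \<times> UNIV" "link_up G ph a = T" if "a \<in> N" for a using that by (auto simp: N_def)
  have laF: "la a \<in> F \<times> UNIV" "link_lo G ph (la a) \<in> ?D" if a: "a \<in> N" for a
  proof -
    obtain w where w: "w \<in> ?D" "dpath (link_lo G ph a) (P a) w" using star2(1)[OF a] by blast
    then show "la a \<in> F \<times> UNIV" "link_lo G ph (la a) \<in> ?D"
      using last_link[OF NF(1)[OF a] w(2)] unfolding la_def by auto
  qed
  \<comment> \<open>In the separated graph each Dirichlet edge end \<open>a\<close> owns its vertex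
    \<open>Inr a\<close>, so different last links have different end points.\<close>
  have lapt: "lo_pt (la a) = Vertex (Inr (la a))" if a: "a \<in> N" for a
  proof -
    have "end_vertex G (fst (la a)) (snd (la a)) \<in> dirichlet G"
      using laF(2)[OF a] by (auto simp: link_lo_def end_node_def split: if_splits)
    then show ?thesis
      using lo_pt_dirichlet[OF laF[OF a]] by (simp add: end_pt_def separate_end separate_vertex_def)
  qed
  have upT: "up_pt a = node_pt T" if "a \<in> N" for a using node_pt_up NF[OF that] by simp
  have len_r: "lk a + sum_list (map lk (P a)) = r" if "a \<in> N" for a
    using star2(2)[OF that] k_pos by (simp add: r_def field_simps)
  have la_eq: "last (a # P a) = la a" for a by (simp only: la_def)
  have "\<exists>Q. unit_arc ?S r Q (node_pt T) (Vertex (Inr (la a))) \<and> Q ` {0..r} = path_pts (a # P a) (lo_pt (la a))"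
    if a: "a \<in> N" for a
  proof -
    obtain w where "dpath (link_lo G ph a) (P a) w" using star2(1)[OF a] by blast
    from descent_arc[OF NF(1)[OF a] this] show ?thesis
      unfolding len_r[OF a] la_eq upT[OF a] lapt[OF a] .
  qed
  then obtain Q where Q: "\<And>a. a \<in> N \<Longrightarrow> unit_arc ?S r (Q a) (node_pt T) (Vertex (Inr (la a)))"
    "\<And>a. a \<in> N \<Longrightarrow> Q a ` {0..r} = path_pts (a # P a) (lo_pt (la a))"
    by metis
  have la_inj: "la a \<noteq> la b" if ab: "a \<in> N" "b \<in> N" "a \<noteq> b" for a b
  proof
    assume e: "la a = la b"
    obtain w w' where w: "dpath (link_lo G ph a) (P a) w" "dpath (link_lo G ph b) (P b) w'"
      using star2(1) ab by blast
    have da: "distinct (map (link_up G ph) (a # P a))" and db: "distinct (map (link_up G ph) (b # P b))"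
      using dpath_distinct[of T "a # P a" w] dpath_distinct[of T "b # P b" w'] w NF ab by auto
    have "la c \<in> set (c # P c)" for c unfolding la_def by (rule last_in_set) simp
    then have m: "la a \<in> set (a # P a)" "la a \<in> set (b # P b)" using e by metis+
    have u: "link_up G ph a = link_up G ph b" using NF ab by simp
    show False
    proof (cases "la a = a")
      case True
      then have "a \<in> set (P b)" using m(2) ab(3) by auto
      then show False using db u by (auto simp: image_iff)
    next
      case False
      then have ma: "la a \<in> set (P a)" using m(1) by simp
      show False
      proof (cases "la a = b")
        case True
        then show False using ma da u by (auto simp: image_iff)
      next
        case False
        then have "la a \<in> set (P b)" using m(2) by simp
        then show False using ma star3[OF ab] by blast
      qed
    qed
  qed
  have disjN: "Q a ` {0..r} \<inter> Q b ` {0..r} \<subseteq> {node_pt T}" if ab: "a \<in> N" "b \<in> N" "a \<noteq> b" for a b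
  proof -
    obtain w w' where w: "dpath (link_lo G ph a) (P a) w" "w \<in> ?D" "dpath (link_lo G ph b) (P b) w'" "w' \<in> ?D"
      using star2(1) ab by blast
    have "w \<notin> link_up G ph ` set (P b)" "w' \<notin> link_up G ph ` set (P a)"
      using w up_free dpath_links[OF w(1)] dpath_links[OF w(3)] by blast+
    from descents_disjoint[OF NF(1)[OF ab(1)] NF(1)[OF ab(2)] ab(3) _ w(1,3) star3[OF ab] this]
    have "Q a ` {0..r} \<inter> Q b ` {0..r} \<subseteq> {up_pt a} \<union> ({lo_pt (la a)} \<inter> {lo_pt (la b)})"
      unfolding Q(2)[OF ab(1)] Q(2)[OF ab(2)] la_def using NF ab by simp
    then show ?thesis using la_inj[OF ab] lapt ab upT by auto
  qed
  have la_all: "\<exists>a\<in>N. b = la a" if b: "b \<in> F \<times> UNIV" "link_lo G ph b \<in> ?D" for b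
  proof -
    obtain a where a: "a \<in> N" "b \<in> set (a # P a)" using Zall[OF b(1)] unfolding Z_def by blast
    obtain w where "dpath (link_lo G ph a) (P a) w" using star2(1) a by blast
    then have "dpath T (a # P a) w" using NF[OF a(1)] by simp
    then have "b = la a" unfolding la_def using dirichlet_last[OF _ a(2) b(2)] by blast
    then show ?thesis using a by blast
  qed
  have up_in: "up_pt b \<in> (\<Union>a\<in>N. path_pts (a # P a) (lo_pt (la a)))"
    and int_in: "link_interior b \<subseteq> (\<Union>a\<in>N. path_pts (a # P a) (lo_pt (la a)))" if b: "b \<in> F \<times> UNIV" for b
    using Zall[OF b] unfolding Z_def path_pts_def by blast+
  have end_dir: "link_lo G ph a = end_node G a" if "a \<in> F \<times> UNIV" "end_node G a \<in> ?D" for a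
    using that up_free[OF that(1)] by (auto simp: link_lo_def link_up_def split: if_splits)
  have coverN: "(\<Union>a\<in>N. path_pts (a # P a) (lo_pt (la a))) = points ?S"
  proof (intro equalityI subsetI)
    fix p assume "p \<in> (\<Union>a\<in>N. path_pts (a # P a) (lo_pt (la a)))"
    then obtain a where a: "a \<in> N" "p \<in> Q a ` {0..r}" using Q(2) by blast
    have "Q a ` {0..r} \<subseteq> topspace (mg_topology ?S)"
      using Q(1)[OF a(1)] unfolding unit_arc_def continuous_map_def by auto
    then show "p \<in> points ?S" using a(2) topspace_mg_topology[OF compM] by blast
  next
    fix p assume p: "p \<in> points ?S"
    then consider v where "p = Vertex (Inl v)" "v \<in> verts G - dirichlet G"
      | a v where "p = Vertex (Inr a)" "v \<in> dirichlet G" "a \<in> ends_at G v"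
      | e t where "p = Inner e t" "e \<in> F" "0 < t" "t < len G e"
      unfolding points_def FG by (auto simp: separate_dirichlet_def)
    then show "p \<in> (\<Union>a\<in>N. path_pts (a # P a) (lo_pt (la a)))"
    proof cases
      case (1 v)
      have "\<exists>a. a \<in> ends_at G v"
      proof (rule ccontr)
        assume none: "\<not> ?thesis"
        have "({Inl v :: 'v + 'e \<times> bool} = {} \<and> ({} :: 'e set) = {}) \<or> ({Inl v} = verts ?S \<and> {} = edges ?S)"
        proof (rule connected_graph_clopen[OF conn compM])
          show "{Inl v} \<subseteq> verts ?S" using 1 by (auto simp: separate_dirichlet_def)
          show "e \<in> {} \<longleftrightarrow> end_vertex ?S e b \<in> {Inl v}" if "e \<in> edges ?S" for e b
            using none that by (auto simp: separate_end separate_vertex_def ends_at_def)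
        qed simp
        then show False using star1 FG by auto
      qed
      then obtain a where a: "a \<in> ends_at G v" by blast
      then have aF: "a \<in> F \<times> UNIV" "end_node G a = Inl v" using FG by (auto simp: ends_at_def end_node_def)
      have "\<exists>b\<in>F \<times> UNIV. link_up G ph b = Inl v"
      proof (cases "link_up G ph a = Inl v")
        case False
        then have "link_lo G ph a = Inl v" using aF by (auto simp: link_lo_def link_up_def split: if_splits)
        then show ?thesis using descending_link_exists[OF aF(1)] 1 by auto
      qed (use aF in blast)
      then obtain b where b: "b \<in> F \<times> UNIV" "link_up G ph b = Inl v" by blast
      then have "up_pt b = p" using node_pt_up[OF b(1)] 1 by (simp add: node_pt_def)
      then show ?thesis using up_in[OF b(1)] by simp
    next
      case (2 a v)
      then have a: "a \<in> F \<times> UNIV" "end_node G a \<in> ?D" using FG by (auto simp: ends_at_def end_node_def)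
      then obtain a' where a': "a' \<in> N" "a = la a'" using la_all[OF a(1)] end_dir[OF a] by auto
      then have "p = lo_pt (la a')" using lapt 2 by simp
      then show ?thesis using a' unfolding path_pts_def by blast
    next
      case (3 e t)
      consider "t < lk (e, False)" | "t = lk (e, False)" | "lk (e, False) < t" by linarith
      then show ?thesis
      proof cases
        case 1
        then have "p \<in> link_interior (e, False)" using 3 by (auto simp: link_interior_def)
        then show ?thesis using int_in[of "(e, False)"] 3 by auto
      next
        case 2
        \<comment> \<open>If neither end were rising, the two phases alone would add up to at least
          \<open>pi\<close>, leaving no room for the positive length of the edge.\<close>
        have "rising ph (e, False) \<or> rising ph (e, True)"
        proof (rule ccontr)
          assume "\<not> ?thesis"
          moreover have "ph (e, False) + ph (e, True) + k * len G e = pi" "0 < len G e"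
            using pdG 3 lk_facts(1)[of e False] lk_facts(3)[of e False] by (auto simp: phase_data_def)
          moreover have "0 < k * len G e" using k_pos calculation by simp
          ultimately show False unfolding rising_def by linarith
        qed
        then obtain b where b: "rising ph (e, b)" by blast
        then have "up_pt (e, b) = p" using 2 3 by (simp add: up_pt_def mid_pt_def)
        then show ?thesis using up_in[of "(e, b)"] 3 by simp
      next
        case later: 3
        then have "p \<in> link_interior (e, True)" using 3 later by (auto simp: link_interior_def)
        then show ?thesis using int_in[of "(e, True)"] 3 by auto
      qed
    qed
  qed
  have "same_metric_graph ?S (equilateral_star n r)"
  proof (rule star_of_arcs[OF compM r, where c = "node_pt T" and Q = "\<lambda>j. Q (ix j)" and z = "\<lambda>j. Inr (la (ix j))"])
    show "0 < n" using n by simp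
    show "unit_arc ?S r (Q (ix j)) (node_pt T) (Vertex (Inr (la (ix j))))" if "j \<in> {1..n}" for j
      by (rule Q(1)[OF ixN[OF that]])
    show "Q (ix i) ` {0..r} \<inter> Q (ix j) ` {0..r} \<subseteq> {node_pt T}" if "i \<in> {1..n}" "j \<in> {1..n}" "i \<noteq> j" for i j
    proof (rule disjN[OF ixN[OF that(1)] ixN[OF that(2)]])
      show "ix i \<noteq> ix j" using inj_onD[OF bij_betw_imp_inj_on[OF ix] _ that(1,2)] that(3) by blast
    qed
    have im: "ix ` {1..n} = N" using ix by (simp add: bij_betw_def)
    have "(\<Union>j\<in>{1..n}. Q (ix j) ` {0..r}) = (\<Union>a\<in>N. Q a ` {0..r})" unfolding im[symmetric] by simp
    then show "(\<Union>j\<in>{1..n}. Q (ix j) ` {0..r}) = points ?S" using coverN Q(2) by simp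
    have "dirichlet ?S = (\<lambda>a. Inr (la a)) ` N"
    proof (intro equalityI subsetI)
      fix x assume "x \<in> dirichlet ?S"
      then obtain v a where a: "x = Inr a" "v \<in> dirichlet G" "a \<in> ends_at G v" by (auto simp: separate_dirichlet_def)
      then have aF: "a \<in> F \<times> UNIV" "end_node G a \<in> ?D" using FG by (auto simp: ends_at_def end_node_def)
      then obtain a' where "a' \<in> N" "a = la a'" using la_all[OF aF(1)] end_dir[OF aF] by auto
      then show "x \<in> (\<lambda>a. Inr (la a)) ` N" using a(1) by blast
    next
      fix x :: "'v + 'e \<times> bool" assume "x \<in> (\<lambda>a. Inr (la a)) ` N"
      then obtain a where a: "a \<in> N" "x = Inr (la a)" by blast
      have "end_vertex G (fst (la a)) (snd (la a)) \<in> dirichlet G"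
        using laF(2)[OF a(1)] by (auto simp: link_lo_def end_node_def split: if_splits)
      moreover have "la a \<in> ends_at G (end_vertex G (fst (la a)) (snd (la a)))"
        using laF(1)[OF a(1)] FG by (auto simp: ends_at_def)
      ultimately show "x \<in> dirichlet ?S" using a(2) by (auto simp: separate_dirichlet_def)
    qed
    then show "dirichlet ?S = (\<lambda>j. Inr (la (ix j))) ` {1..n}" unfolding im[symmetric] by (simp add: image_image)
  qed
  then show ?thesis using n unfolding r_def by blast
qed

lemma star_if_equality:
  fixes G :: "('v, 'e) metric_graph"
  assumes comp: "compact_metric_graph G" and conn: "connected_graph G" and D: "dirichlet G \<noteq> {}"
    and s: "girth G \<noteq> 0" and connS: "connected_graph (separate_dirichlet G)"
    and eq: "lambda1 G = pi\<^sup>2 / (girth G)\<^sup>2"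
  shows "\<exists>n\<ge>2. is_equilateral_dirichlet_star G n (girth G / 2)"
proof (rule girth_frequency[OF comp conn D s])
  fix k F A ph
  assume *: "phase_data G k F A ph" "lambda1 G \<le> k\<^sup>2" "0 < girth G" "girth G * k \<le> pi"
    "girth G * k = pi \<Longrightarrow> \<exists>T P. star_network (F \<times> UNIV) (link_lo G ph) (link_up G ph) (Inl ` dirichlet G)
        (link_len G k ph) k T P"
  have k: "0 < k" using *(1) by (simp add: phase_data_def)
  \<comment> \<open>Equality for \<open>lambda1 G\<close> bounds \<open>k\<close> from below, so
    that \<open>girth G * k \<le> pi\<close> becomes an equality.\<close>
  have "(pi / girth G)\<^sup>2 \<le> k\<^sup>2" using *(2) eq by (simp add: power_divide)
  then have "pi / girth G \<le> k" using power2_le_imp_le[of "pi / girth G" k] k by simp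
  then have e: "girth G * k = pi" using *(3,4) by (simp add: field_simps)
  then obtain T P where "star_network (F \<times> UNIV) (link_lo G ph) (link_up G ph) (Inl ` dirichlet G)
        (link_len G k ph) k T P" using *(5) by blast
  then obtain n where n: "2 \<le> n" "same_metric_graph (separate_dirichlet G) (equilateral_star n (pi / (2 * k)))"
    using star_of_network[OF *(1) comp connS] by blast
  moreover have "pi / (2 * k) = girth G / 2" using e k by (simp add: field_simps)
  ultimately show ?thesis using *(3) unfolding is_equilateral_dirichlet_star_def by auto
qed

section \<open>Maps to a star\<close>

text \<open>Relative to the midpoint \<open>m\<close>, an isometry keeps or flips the sign of each
  displacement; two nonzero displacements treated differently would violate the distance between the
  two points.\<close>

lemma isometry_affine:
  fixes f :: "real \<Rightarrow> real"
  assumes iso: "\<And>s t. s \<in> {x<..<y} \<Longrightarrow> t \<in> {x<..<y} \<Longrightarrow> \<bar>f s - f t\<bar> = \<bar>s - t\<bar>"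
  shows "\<exists>d. (d = 1 \<or> d = - 1) \<and> (\<forall>s\<in>{x<..<y}. \<forall>t\<in>{x<..<y}. f t = f s + d * (t - s))"
proof (cases "x < y")
  case True
  define m where "m = (x + y) / 2"
  have m: "m \<in> {x<..<y}" using True by (auto simp: m_def)
  have pm: "f t - f m = t - m \<or> f t - f m = - (t - m)" if "t \<in> {x<..<y}" for t
    using iso[OF that m] by (auto simp: abs_if split: if_splits)
  show ?thesis
  proof (cases "\<forall>t\<in>{x<..<y}. f t - f m = t - m")
    case True
    have "f t = f s + 1 * (t - s)" if "s \<in> {x<..<y}" "t \<in> {x<..<y}" for s t
      using True[rule_format, OF that(1)] True[rule_format, OF that(2)] by simp
    then show ?thesis by blast
  next
    case False
    then obtain s where s: "s \<in> {x<..<y}" "f s - f m \<noteq> s - m" by blast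
    have "f t - f m = - (t - m)" if t: "t \<in> {x<..<y}" for t
      using pm[OF t] pm[OF s(1)] s(2) iso[OF s(1) t] by (auto simp: abs_if split: if_splits)
    then have "f t = f s + - 1 * (t - s)" if "s \<in> {x<..<y}" "t \<in> {x<..<y}" for s t
      using that by (smt (verit))
    then show ?thesis by blast
  qed
qed auto

lemma total_length_Inner_image:
  assumes "compact_metric_graph M" "e \<in> edges M" "A \<subseteq> {0<..<len M e}"
  shows "total_length M (Inner e ` A) = measure lebesgue A"
proof -
  have "inner_params M e' (Inner e ` A) = (if e' = e then A else {})" for e'
    using assms(3) by (auto simp: inner_params_def)
  then have "total_length M (Inner e ` A) = (\<Sum>e'\<in>edges M. if e' = e then measure lebesgue A else 0)"
    unfolding total_length_inner by (intro sum.cong) auto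
  also have "\<dots> = measure lebesgue A" using assms by (simp add: compact_metric_graph_def)
  finally show ?thesis .
qed

lemma openin_Inner_image:
  assumes "compact_metric_graph M" "E' \<subseteq> edges M" "\<And>e. e \<in> E' \<Longrightarrow> open (A e) \<and> A e \<subseteq> {0<..<len M e}"
  shows "openin (mg_topology M) (\<Union>e\<in>E'. Inner e ` A e)"
  unfolding openin_mg_topology
proof (intro conjI ballI)
  show "(\<Union>e\<in>E'. Inner e ` A e) \<subseteq> points M" using assms by (force simp: points_def)
  fix e assume "e \<in> edges M"
  have "{t \<in> {0..len M e}. chart M e t \<in> (\<Union>e\<in>E'. Inner e ` A e)} = (if e \<in> E' then A e else {})"
  proof (cases "e \<in> E'")
    case True
    then show ?thesis using assms(3)[OF True] by (auto simp: chart_def subset_iff)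
  next
    case False
    then show ?thesis by (auto simp: chart_def)
  qed
  then show "openin (top_of_set {0..len M e}) {t \<in> {0..len M e}. chart M e t \<in> (\<Union>e\<in>E'. Inner e ` A e)}"
    using assms(3)[of e] by (auto intro!: open_subset)
qed

locale star_map =
  fixes S :: "('v, 'e) metric_graph" and n :: nat and r :: real and h :: "('v, 'e) point \<Rightarrow> (nat, nat) point"
  assumes compS: "compact_metric_graph S" and r_pos: "0 < r"
    and hom: "homeomorphic_map (mg_topology S) (mg_topology (equilateral_star n r)) h"
    and len_h: "openin (mg_topology S) U \<Longrightarrow> total_length (equilateral_star n r) (h ` U) = total_length S U"
    and dir_h: "h ` Vertex ` dirichlet S = Vertex ` {1..n}" and dir_sub: "dirichlet S \<subseteq> verts S"
begin

abbreviation "X \<equiv> equilateral_star n r"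

lemma compX: "compact_metric_graph X"
  by (rule compact_star[OF r_pos])

lemma inj_h: "inj_on h (points S)"
  using homeomorphic_imp_injective_map[OF hom] topspace_mg_topology[OF compS] by metis

lemma h_points: "h ` points S = points X"
  using homeomorphic_imp_surjective_map[OF hom] topspace_mg_topology[OF compS] topspace_mg_topology[OF compX] by metis

lemma cont_h: "continuous_map (mg_topology S) (mg_topology X) h"
  by (rule homeomorphic_imp_continuous_map[OF hom])

lemma h_open: "openin (mg_topology S) U \<Longrightarrow> openin (mg_topology X) (h ` U)"
  using homeomorphic_imp_open_map[OF hom] by (simp add: open_map_def)

text \<open>The distance to the leaves of the star, pulled back to \<open>S\<close>; this is the
  \<open>d\<close> of the Wronskian.\<close>

definition lf :: "('v, 'e) point \<Rightarrow> real" where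
  "lf p = (case h p of Vertex j \<Rightarrow> if j = 0 then r else 0 | Inner j t \<Rightarrow> r - t)"

lemma h_cases:
  assumes "p \<in> points S"
  obtains "h p = Vertex 0" "lf p = r" | j where "j \<in> {1..n}" "h p = Vertex j" "lf p = 0"
    | j where "j \<in> {1..n}" "h p = Inner j (r - lf p)" "0 < lf p" "lf p < r"
proof -
  have "h p \<in> points X" using assms h_points by blast
  then consider i where "i \<le> n" "h p = Vertex i" | j t where "j \<in> {1..n}" "0 < t" "t < r" "h p = Inner j t"
    unfolding points_def by auto
  then show ?thesis
  proof cases
    case (1 i)
    then show ?thesis using that(1) that(2)[of i] by (cases "i = 0") (auto simp: lf_def)
  next
    case (2 j t)
    then show ?thesis by (intro that(3)[of j]) (auto simp: lf_def)
  qed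
qed

lemma lf_le: "p \<in> points S \<Longrightarrow> 0 \<le> lf p \<and> lf p \<le> r"
  using r_pos by (elim h_cases) auto

lemma lf_top: "p \<in> points S \<Longrightarrow> lf p = r \<longleftrightarrow> h p = Vertex 0"
  using r_pos by (elim h_cases) auto

lemma not_leaf:
  assumes "p \<in> points S" "p \<notin> Vertex ` dirichlet S" "j \<in> {1..n}"
  shows "h p \<noteq> Vertex j"
proof
  assume "h p = Vertex j"
  then have "h p \<in> h ` Vertex ` dirichlet S" unfolding dir_h using assms(3) by simp
  then obtain d where d: "d \<in> dirichlet S" "h p = h (Vertex d)" by auto
  then have "Vertex d \<in> points S" using dir_sub by (auto simp: points_def)
  then have "p = Vertex d" using inj_onD[OF inj_h d(2) assms(1)] by simp
  then show False using assms(2) d by simp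
qed

lemma lf_dirichlet: "d \<in> dirichlet S \<Longrightarrow> lf (Vertex d) = 0"
proof -
  assume "d \<in> dirichlet S"
  then have "h (Vertex d) \<in> Vertex ` {1..n}" using dir_h by blast
  then show ?thesis by (auto simp: lf_def)
qed

lemma continuous_lf:
  assumes e: "e \<in> edges S"
  shows "continuous_on {0..len S e} (\<lambda>t. lf (chart S e t))"
proof -
  define g :: "(nat, nat) point \<Rightarrow> real" where
    "g = (\<lambda>q. case q of Vertex j \<Rightarrow> if j = 0 then r else 0 | Inner j t \<Rightarrow> r - t)"
  have "continuous_map (mg_topology X) euclideanreal g"
    unfolding continuous_map_mg_iff[OF compX]
  proof (intro conjI ballI)
    fix j assume "j \<in> edges X"
    then have "j \<noteq> 0" by simp
    then have "g (chart X j t) = r - t" if "t \<in> {0..r}" for t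
      using that r_pos by (auto simp: g_def chart_def)
    moreover have "continuous_map (top_of_set {0..r}) euclideanreal (\<lambda>t. r - t)"
      by (simp add: continuous_intros)
    ultimately have "continuous_map (top_of_set {0..r}) euclideanreal (\<lambda>t. g (chart X j t))"
      by (rule_tac continuous_map_eq[where f = "\<lambda>t. r - t"]) auto
    then show "continuous_map (top_of_set {0..len X j}) euclideanreal (\<lambda>t. g (chart X j t))" by simp
  qed simp
  from continuous_map_compose[OF continuous_map_compose[OF continuous_map_chart[OF compS e] cont_h] this]
  have "continuous_map (top_of_set {0..len S e}) euclideanreal (\<lambda>t. g (h (chart S e t)))" by (simp add: o_def)
  then show ?thesis by (simp add: g_def lf_def)
qed

text \<open>By connectedness, a segment that avoids the centre is mapped into a single ray. There
  \<open>lf\<close> is continuous and injective, and the lengths of open subintervals show that it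
  is an isometry, so its slope is constantly \<open>1\<close> or \<open>- 1\<close>; continuity
  extends this to the end points.\<close>

lemma lf_segment:
  assumes e: "e \<in> edges S" and xy: "0 \<le> x" "x < y" "y \<le> len S e"
    and top: "\<And>t. t \<in> {x<..<y} \<Longrightarrow> h (Inner e t) \<noteq> Vertex 0"
  shows "\<exists>d. (d = 1 \<or> d = - 1) \<and> (\<forall>s\<in>{x..y}. \<forall>t\<in>{x..y}. lf (chart S e t) = lf (chart S e s) + d * (t - s))"
proof -
  have inner: "chart S e t = Inner e t" if "t \<in> {x<..<y}" for t using that xy by (simp add: chart_def)
  have pt: "Inner e t \<in> points S" if "t \<in> {x<..<y}" for t using that xy e by (auto simp: points_def)
  define V where "V = (\<lambda>J. \<Union>j\<in>J. Inner j ` {0<..<r} :: (nat, nat) point set)"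
  have oV: "openin (mg_topology X) (V J)" if "J \<subseteq> {1..n}" for J
    unfolding V_def by (rule openin_Inner_image[OF compX]) (use that in auto)
  have hV: "\<exists>j\<in>{1..n}. h (Inner e t) = Inner j (r - lf (Inner e t)) \<and> h (Inner e t) \<in> V {j}" if t: "t \<in> {x<..<y}" for t
    using pt[OF t]
  proof (cases rule: h_cases)
    case (3 j)
    then show ?thesis by (intro bexI[of _ j]) (auto simp: V_def)
  qed (use top[OF t] not_leaf[OF pt[OF t]] in auto)
  define m where "m = (x + y) / 2"
  have m: "m \<in> {x<..<y}" using xy by (auto simp: m_def)
  obtain j where j: "j \<in> {1..n}" "h (Inner e m) \<in> V {j}" using hV[OF m] by blast
  define K where "K = h ` Inner e ` {x<..<y}"
  have "connectedin (mg_topology S) (chart S e ` {x<..<y})"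
    by (rule connectedin_continuous_map_image[OF continuous_map_chart[OF compS e]])
      (use xy in \<open>auto simp: connectedin_subtopology connectedin_iff_connected\<close>)
  then have "connectedin (mg_topology X) (h ` chart S e ` {x<..<y})"
    by (rule connectedin_continuous_map_image[OF cont_h])
  moreover have "chart S e ` {x<..<y} = Inner e ` {x<..<y}" using inner by (intro image_cong) auto
  ultimately have cK: "connectedin (mg_topology X) K" by (simp add: K_def)
  have "K \<subseteq> V {j} \<union> V ({1..n} - {j})" using hV by (fastforce simp: K_def V_def)
  moreover have "V {j} \<inter> V ({1..n} - {j}) \<inter> K = {}" by (auto simp: V_def)
  moreover have "V {j} \<inter> K \<noteq> {}" using j m by (auto simp: K_def)
  ultimately have "V ({1..n} - {j}) \<inter> K = {}"
    using cK oV[of "{j}"] oV[of "{1..n} - {j}"] j(1) unfolding connectedin by blast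
  then have KV: "K \<subseteq> V {j}" using \<open>K \<subseteq> _\<close> by blast
  define f where "f = (\<lambda>t. lf (chart S e t))"
  have hf: "h (Inner e t) = Inner j (r - f t)" if t: "t \<in> {x<..<y}" for t
  proof -
    have "h (Inner e t) \<in> V {j}" using KV t by (auto simp: K_def)
    then show ?thesis using hV[OF t] inner[OF t] by (auto simp: V_def f_def)
  qed
  have f_range: "0 < f t \<and> f t < r" if t: "t \<in> {x<..<y}" for t
    using hf[OF t] KV t by (force simp: K_def V_def)
  have cf: "continuous_on {s..t} f" if "x \<le> s" "t \<le> y" for s t
    unfolding f_def by (rule continuous_on_subset[OF continuous_lf[OF e]]) (use that xy in auto)
  have inj: "inj_on f {x<..<y}"
  proof (rule inj_onI)
    fix s t assume st: "s \<in> {x<..<y}" "t \<in> {x<..<y}" "f s = f t"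
    then have "h (Inner e s) = h (Inner e t)" using hf by simp
    then have "Inner e s = (Inner e t :: ('v, 'e) point)" using inj_onD[OF inj_h] pt st by blast
    then show "s = t" by simp
  qed
  have iso: "\<bar>f s - f t\<bar> = \<bar>s - t\<bar>" if st: "s \<in> {x<..<y}" "t \<in> {x<..<y}" "s < t" for s t
  proof -
    have sub: "{s..t} \<subseteq> {x<..<y}" using st by auto
    have in_st: "inj_on f {s..t}" by (rule inj_on_subset[OF inj sub])
    have cst: "continuous_on {s..t} f" by (rule cf) (use st in auto)
    have im: "f ` {s<..<t} = {min (f s) (f t)<..<max (f s) (f t)}"
    proof (intro equalityI subsetI)
      fix z assume "z \<in> f ` {s<..<t}"
      then obtain u where "s < u" "u < t" "z = f u" by auto
      then show "z \<in> {min (f s) (f t)<..<max (f s) (f t)}"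
        using continuous_inj_imp_mono[OF _ _ cst in_st, of u] by auto
    next
      fix z assume z: "z \<in> {min (f s) (f t)<..<max (f s) (f t)}"
      have "\<exists>u. s \<le> u \<and> u \<le> t \<and> f u = z"
      proof (cases "f s \<le> f t")
        case True
        then show ?thesis using IVT'[of f s z t] cst z st(3) by auto
      next
        case False
        then show ?thesis using IVT2'[of f t z s] cst z st(3) by auto
      qed
      then obtain u where u: "s \<le> u" "u \<le> t" "f u = z" by blast
      then have "u \<noteq> s" "u \<noteq> t" using z by auto
      then show "z \<in> f ` {s<..<t}" using u by auto
    qed
    have "openin (mg_topology S) (\<Union>e'\<in>{e}. Inner e' ` {s<..<t})"
      by (rule openin_Inner_image[OF compS]) (use e st xy in auto)
    then have "total_length X (h ` Inner e ` {s<..<t}) = total_length S (Inner e ` {s<..<t})"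
      using len_h by simp
    also have "\<dots> = t - s"
    proof -
      have "{s<..<t} \<subseteq> {0<..<len S e}" using st xy by auto
      then show ?thesis using total_length_Inner_image[OF compS e, of "{s<..<t}"] st by simp
    qed
    finally have 1: "total_length X (h ` Inner e ` {s<..<t}) = t - s" .
    have "h ` Inner e ` {s<..<t} = Inner j ` (\<lambda>z. r - z) ` f ` {s<..<t}"
      unfolding image_image by (rule image_cong[OF refl]) (use hf st in auto)
    also have "(\<lambda>z. r - z) ` f ` {s<..<t} = {r - max (f s) (f t)<..<r - min (f s) (f t)}"
      unfolding im by (auto simp: image_iff intro!: bexI[of _ "r - _"])
    finally have "total_length X (h ` Inner e ` {s<..<t}) = measure lebesgue {r - max (f s) (f t)<..<r - min (f s) (f t)}"
    proof -
      have "{r - max (f s) (f t)<..<r - min (f s) (f t)} \<subseteq> {0<..<r}"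
        using f_range[OF st(1)] f_range[OF st(2)] by (auto simp: max_def min_def)
      moreover assume "h ` Inner e ` {s<..<t} = Inner j ` {r - max (f s) (f t)<..<r - min (f s) (f t)}"
      ultimately show ?thesis using total_length_Inner_image[OF compX, of j] j(1) by simp
    qed
    then show ?thesis using 1 st(3) by (auto simp: max_def min_def split: if_splits)
  qed
  have "\<bar>f s - f t\<bar> = \<bar>s - t\<bar>" if "s \<in> {x<..<y}" "t \<in> {x<..<y}" for s t
    using iso[of s t] iso[of t s] that by (cases s t rule: linorder_cases) auto
  then obtain d where d: "d = 1 \<or> d = - 1" "\<forall>s\<in>{x<..<y}. \<forall>t\<in>{x<..<y}. f t = f s + d * (t - s)"
    using isometry_affine[of x y f] by blast
  have fm: "f t = f m + d * (t - m)" if "t \<in> {x..y}" for t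
  proof -
    have "continuous_on (closure {x<..<y}) (\<lambda>t. f t - d * t)"
      using cf[of x y] xy by (auto intro!: continuous_intros)
    then have "f t - d * t = f m - d * m"
      by (rule continuous_constant_on_closure)
        (use d(2) m xy that in \<open>auto simp: algebra_simps\<close>)
    then show ?thesis by (simp add: algebra_simps)
  qed
  have "f t = f s + d * (t - s)" if "s \<in> {x..y}" "t \<in> {x..y}" for s t
    using fm[OF that(1)] fm[OF that(2)] by (simp add: algebra_simps)
  then show ?thesis using d(1) unfolding f_def by blast
qed

section \<open>Slopes of the distance to the boundary\<close>

definition from_end :: "'e \<times> bool \<Rightarrow> real \<Rightarrow> ('v, 'e) point" where
  "from_end a t = chart S (fst a) (if snd a then len S (fst a) - t else t)"

text \<open>
  Along an edge \<open>lf\<close> has slope \<open>1\<close> or \<open>-1\<close>, except that it has a maximum at the centre of the star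
  if the centre lies inside the edge.
\<close>

lemma edge_slopes:
  assumes e: "e \<in> edges S"
  shows "\<exists>d. (\<forall>b. (d b = 1 \<or> d b = - 1) \<and>
      (\<exists>w>0. w \<le> len S e / 2 \<and> (\<forall>t\<in>{0..w}. lf (from_end (e, b) t) = lf (from_end (e, b) 0) + d b * t))) \<and>
    ((\<forall>t\<in>{0<..<len S e}. h (Inner e t) \<noteq> Vertex 0) \<and> d True = - d False \<and>
        lf (from_end (e, True) 0) = lf (from_end (e, False) 0) + d False * len S e \<or>
     (\<exists>c\<in>{0<..<len S e}. h (Inner e c) = Vertex 0 \<and> d True = 1 \<and> d False = 1 \<and>
        lf (from_end (e, False) 0) = r - c \<and> lf (from_end (e, True) 0) = r - (len S e - c)))"
proof -
  define l where "l = len S e"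
  have l: "0 < l" using compS e by (auto simp: compact_metric_graph_def l_def)
  define f where "f = (\<lambda>t. lf (chart S e t))"
  have fe: "lf (from_end (e, False) t) = f t" "lf (from_end (e, True) t) = f (l - t)" for t
    by (auto simp: from_end_def f_def l_def)
  show ?thesis
  proof (cases "\<exists>c\<in>{0<..<l}. h (Inner e c) = Vertex 0")
    case False
    then obtain d where d: "d = 1 \<or> d = - 1" "\<forall>s\<in>{0..l}. \<forall>t\<in>{0..l}. f t = f s + d * (t - s)"
      using lf_segment[OF e, of 0 l] l unfolding f_def l_def by auto
    have 0: "f t = f 0 + d * t" if "t \<in> {0..l}" for t
      using d(2)[rule_format, of 0 t] that l by simp
    have 1: "f (l - t) = f l + - d * t" if "t \<in> {0..l}" for t
      using d(2)[rule_format, of l "l - t"] that l by simp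
    show ?thesis
    proof (rule exI[of _ "\<lambda>b. if b then - d else d"], rule conjI)
      show "\<forall>b. ((if b then - d else d) = 1 \<or> (if b then - d else d) = - 1) \<and>
        (\<exists>w>0. w \<le> len S e / 2 \<and> (\<forall>t\<in>{0..w}. lf (from_end (e, b) t) = lf (from_end (e, b) 0) + (if b then - d else d) * t))"
      proof (intro allI conjI)
        fix b
        show "(if b then - d else d) = 1 \<or> (if b then - d else d) = - 1" using d(1) by auto
        show "\<exists>w>0. w \<le> len S e / 2 \<and> (\<forall>t\<in>{0..w}. lf (from_end (e, b) t) = lf (from_end (e, b) 0) + (if b then - d else d) * t)"
        proof (intro exI[of _ "l / 2"] conjI ballI)
          fix t assume "t \<in> {0..l / 2}"
          then have "t \<in> {0..l}" using l by auto
          then show "lf (from_end (e, b) t) = lf (from_end (e, b) 0) + (if b then - d else d) * t"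
            using 0[of t] 1[of t] by (cases b) (simp_all add: fe)
        qed (use l in \<open>simp_all add: l_def\<close>)
      qed
      have "\<forall>t\<in>{0<..<len S e}. h (Inner e t) \<noteq> Vertex 0" using False unfolding l_def by blast
      moreover have "f l = f 0 + d * l" using 0[of l] l by simp
      ultimately show "(\<forall>t\<in>{0<..<len S e}. h (Inner e t) \<noteq> Vertex 0) \<and>
         (if True then - d else d) = - (if False then - d else d) \<and>
         lf (from_end (e, True) 0) = lf (from_end (e, False) 0) + (if False then - d else d) * len S e \<or>
       (\<exists>c\<in>{0<..<len S e}. h (Inner e c) = Vertex 0 \<and> (if True then - d else d) = 1 \<and> (if False then - d else d) = 1 \<and>
         lf (from_end (e, False) 0) = r - c \<and> lf (from_end (e, True) 0) = r - (len S e - c))"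
        by (intro disjI1 conjI) (simp_all add: fe l_def[symmetric])
    qed
  next
    case True
    then obtain c where c: "c \<in> {0<..<l}" "h (Inner e c) = Vertex 0" by blast
    have only: "h (Inner e t) \<noteq> Vertex 0" if "t \<in> {0<..<l}" "t \<noteq> c" for t
    proof
      assume "h (Inner e t) = Vertex 0"
      then have "Inner e t = (Inner e c :: ('v, 'e) point)"
        using c that e by (intro inj_onD[OF inj_h]) (auto simp: points_def l_def)
      then show False using that by simp
    qed
    have fc: "f c = r" using c by (simp add: f_def chart_def l_def lf_def)
    have f_le: "f t \<le> r" for t
      unfolding f_def using lf_le[OF chart_in_points[OF compS e]] by blast
    obtain d1 where d1: "d1 = 1 \<or> d1 = - 1" "\<forall>s\<in>{0..c}. \<forall>t\<in>{0..c}. f t = f s + d1 * (t - s)"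
      using lf_segment[OF e, of 0 c] c only unfolding f_def l_def by auto
    obtain d2 where d2: "d2 = 1 \<or> d2 = - 1" "\<forall>s\<in>{c..l}. \<forall>t\<in>{c..l}. f t = f s + d2 * (t - s)"
      using lf_segment[OF e, of c l] c only unfolding f_def l_def by auto
    \<comment> \<open>\<open>lf\<close> never exceeds the value \<open>r\<close> that it has at the
      centre, so it must rise towards \<open>c\<close>; the same holds on the other side.\<close>
    have "d1 = 1" using d1(1) d1(2)[rule_format, of c 0] fc f_le[of 0] c by auto
    then have 1: "f t = r - c + t" if "t \<in> {0..c}" for t
      using d1(2)[rule_format, of c t] that fc c by auto
    have "d2 = - 1" using d2(1) d2(2)[rule_format, of c l] fc f_le[of l] c by auto
    then have 2: "f t = r - (t - c)" if "t \<in> {c..l}" for t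
      using d2(2)[rule_format, of c t] that fc c by auto
    show ?thesis
    proof (rule exI[of _ "\<lambda>b. 1"], rule conjI)
      show "\<forall>b. ((1::real) = 1 \<or> (1::real) = - 1) \<and>
        (\<exists>w>0. w \<le> len S e / 2 \<and> (\<forall>t\<in>{0..w}. lf (from_end (e, b) t) = lf (from_end (e, b) 0) + 1 * t))"
      proof (intro allI conjI)
        fix b
        show "\<exists>w>0. w \<le> len S e / 2 \<and> (\<forall>t\<in>{0..w}. lf (from_end (e, b) t) = lf (from_end (e, b) 0) + 1 * t)"
        proof (intro exI[of _ "min (l / 2) (min c (l - c))"] conjI ballI)
          fix t assume t: "t \<in> {0..min (l / 2) (min c (l - c))}"
          show "lf (from_end (e, b) t) = lf (from_end (e, b) 0) + 1 * t"
            using 1[of t] 1[of 0] 2[of "l - t"] 2[of l] t c by (cases b) (auto simp: fe)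
        qed (use c l in \<open>auto simp: l_def min_def\<close>)
      qed simp
      show "(\<forall>t\<in>{0<..<len S e}. h (Inner e t) \<noteq> Vertex 0) \<and> (1::real) = - 1 \<and>
         lf (from_end (e, True) 0) = lf (from_end (e, False) 0) + 1 * len S e \<or>
       (\<exists>c\<in>{0<..<len S e}. h (Inner e c) = Vertex 0 \<and> (1::real) = 1 \<and> (1::real) = 1 \<and>
         lf (from_end (e, False) 0) = r - c \<and> lf (from_end (e, True) 0) = r - (len S e - c))"
        using 1[of 0] 2[of l] c by (intro disjI2 bexI[of _ c]) (auto simp: fe l_def)
    qed
  qed
qed

end

context star_map
begin

lemma from_end_zero: "e \<in> edges S \<Longrightarrow> from_end (e, b) 0 = Vertex (end_vertex S e b)"
  using chart_ends[OF _ compS, of e] by (auto simp: from_end_def end_vertex_def)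

lemma from_end_Inner: "0 < t \<Longrightarrow> t < len S e \<Longrightarrow> from_end (e, b) t = Inner e (if b then len S e - t else t)"
  by (auto simp: from_end_def chart_def)

lemma near_end:
  assumes a: "a \<in> ends_at S v" and U: "openin (mg_topology S) U" "Vertex v \<in> U"
  shows "\<exists>w>0. \<forall>t\<in>{0..w}. from_end a t \<in> U"
proof -
  obtain e b where ab: "a = (e, b)" "e \<in> edges S" "end_vertex S e b = v" using a by (auto simp: ends_at_def)
  have l: "0 < len S e" using compS ab by (auto simp: compact_metric_graph_def)
  have "continuous_map (top_of_set {0..len S e}) (top_of_set {0..len S e}) (\<lambda>t. if b then len S e - t else t)"
    by (cases b) (auto intro!: continuous_intros)
  from continuous_map_compose[OF this continuous_map_chart[OF compS ab(2)]]
  have "continuous_map (top_of_set {0..len S e}) (mg_topology S) (from_end a)"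
  proof -
    have "from_end a = chart S e \<circ> (\<lambda>t. if b then len S e - t else t)"
      by (simp add: from_end_def ab(1) fun_eq_iff)
    moreover assume "continuous_map (top_of_set {0..len S e}) (mg_topology S) (chart S e \<circ> (\<lambda>t. if b then len S e - t else t))"
    ultimately show ?thesis by simp
  qed
  then have "openin (top_of_set {0..len S e}) {t \<in> topspace (top_of_set {0..len S e}). from_end a t \<in> U}"
    using U(1) unfolding continuous_map_def by blast
  moreover have "0 \<in> {t \<in> topspace (top_of_set {0..len S e}). from_end a t \<in> U}"
    using l from_end_zero[OF ab(2), of b] ab U(2) by simp
  ultimately obtain w where w: "0 < w" "ball 0 w \<inter> {0..len S e} \<subseteq> {t \<in> topspace (top_of_set {0..len S e}). from_end a t \<in> U}"
    unfolding openin_contains_ball by blast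
  have "from_end a t \<in> U" if "t \<in> {0..min (w / 2) (len S e)}" for t
  proof -
    have "t \<in> ball 0 w \<inter> {0..len S e}" using that w(1) by (auto simp: dist_real_def)
    then show ?thesis using w(2) by blast
  qed
  then show ?thesis using w(1) l by (intro exI[of _ "min (w / 2) (len S e)"]) auto
qed

text \<open>At the centre every direction leads down. Elsewhere a neighbourhood of \<open>v\<close>
  is mapped into one ray: injectivity of \<open>h\<close> allows at most one ascending edge end, and
  openness of \<open>h\<close> forces a descending one beside it.\<close>

lemma vertex_slopes:
  assumes v: "v \<in> verts S" "v \<notin> dirichlet S"
    and d: "\<And>a. a \<in> ends_at S v \<Longrightarrow> (d a = 1 \<or> d a = - 1) \<and>
      (\<exists>w>0. w \<le> len S (fst a) / 2 \<and> (\<forall>t\<in>{0..w}. lf (from_end a t) = lf (from_end a 0) + d a * t))"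
  shows "(\<Sum>a\<in>ends_at S v. d a) \<le> 0"
    and "h (Vertex v) = Vertex 0 \<Longrightarrow> a \<in> ends_at S v \<Longrightarrow> d a = - 1"
proof -
  have pv: "Vertex v \<in> points S" "Vertex v \<notin> Vertex ` dirichlet S" using v by (auto simp: points_def)
  have zero: "from_end a 0 = Vertex v" if "a \<in> ends_at S v" for a
    using that from_end_zero by (auto simp: ends_at_def)
  have len: "0 < len S (fst a)" "fst a \<in> edges S" if "a \<in> ends_at S v" for a
    using that compS by (auto simp: ends_at_def compact_metric_graph_def)
  have top: "d a = - 1" if a: "a \<in> ends_at S v" and t: "h (Vertex v) = Vertex 0" for a
  proof -
    obtain w where w: "0 < w" "\<forall>t\<in>{0..w}. lf (from_end a t) = lf (from_end a 0) + d a * t" using d[OF a] by blast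
    have "lf (from_end a w) = r + d a * w" using w zero[OF a] lf_top[OF pv(1)] t by auto
    moreover have "lf (from_end a w) \<le> r"
      using lf_le[OF chart_in_points[OF compS len(2)[OF a]]] unfolding from_end_def by blast
    ultimately have "d a * w \<le> 0" by simp
    then show ?thesis using d[OF a] w(1) by auto
  qed
  then show "h (Vertex v) = Vertex 0 \<Longrightarrow> a \<in> ends_at S v \<Longrightarrow> d a = - 1" by blast
  have fin: "finite (ends_at S v)" by (rule ends_at_finite[OF compS])
  show "(\<Sum>a\<in>ends_at S v. d a) \<le> 0"
  proof (cases "h (Vertex v) = Vertex 0")
    case True
    then show ?thesis using top by (intro sum_nonpos) auto
  next
    case False
    define f0 where "f0 = lf (Vertex v)"
    obtain j where j: "j \<in> {1..n}" "h (Vertex v) = Inner j (r - f0)" "0 < f0" "f0 < r"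
      using pv(1) unfolding f0_def by (cases rule: h_cases) (use False not_leaf[OF pv] in auto)
    define V :: "(nat, nat) point set" where "V = (\<Union>i\<in>{j}. Inner i ` {0<..<r})"
    have oV: "openin (mg_topology X) V"
      unfolding V_def by (rule openin_Inner_image[OF compX]) (use j in auto)
    then have "openin (mg_topology S) {p \<in> topspace (mg_topology S). h p \<in> V}"
      using cont_h unfolding continuous_map_def by blast
    moreover have "Vertex v \<in> {p \<in> topspace (mg_topology S). h p \<in> V}"
      using pv(1) topspace_mg_topology[OF compS] j by (auto simp: V_def)
    ultimately have nV: "\<exists>w>0. \<forall>t\<in>{0..w}. from_end a t \<in> {p \<in> topspace (mg_topology S). h p \<in> V}"
      if "a \<in> ends_at S v" for a using near_end[OF that] by blast
    have loc: "\<exists>w>0. w \<le> len S (fst a) / 2 \<and> (\<forall>t\<in>{0..w}. h (from_end a t) = Inner j (r - (f0 + d a * t)) \<and>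
        lf (from_end a t) = f0 + d a * t)"
      if a: "a \<in> ends_at S v" for a
    proof -
      obtain w1 where w1: "0 < w1" "\<forall>t\<in>{0..w1}. h (from_end a t) \<in> V" using nV[OF a] by blast
      obtain w2 where w2: "0 < w2" "w2 \<le> len S (fst a) / 2" "\<forall>t\<in>{0..w2}. lf (from_end a t) = lf (from_end a 0) + d a * t"
        using d[OF a] by blast
      have "h (from_end a t) = Inner j (r - (f0 + d a * t)) \<and> lf (from_end a t) = f0 + d a * t"
        if t: "t \<in> {0..min w1 w2}" for t
      proof -
        have l: "lf (from_end a t) = f0 + d a * t" using w2(3) t zero[OF a] by (simp add: f0_def)
        have "h (from_end a t) \<in> V" using w1(2) t by simp
        then obtain x where x: "h (from_end a t) = Inner j x" by (auto simp: V_def)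
        then have "lf (from_end a t) = r - x" by (simp add: lf_def)
        then show ?thesis using l x by simp
      qed
      then show ?thesis using w1(1) w2(1,2) by (intro exI[of _ "min w1 w2"]) auto
    qed
    have one: "a = b" if ab: "a \<in> ends_at S v" "b \<in> ends_at S v" "d a = 1" "d b = 1" for a b
    proof -
      obtain w1 where w1: "0 < w1" "w1 \<le> len S (fst a) / 2" "\<forall>t\<in>{0..w1}. h (from_end a t) = Inner j (r - (f0 + d a * t))"
        using loc[OF ab(1)] by blast
      obtain w2 where w2: "0 < w2" "w2 \<le> len S (fst b) / 2" "\<forall>t\<in>{0..w2}. h (from_end b t) = Inner j (r - (f0 + d b * t))"
        using loc[OF ab(2)] by blast
      define t where "t = min w1 w2 / 2"
      have t: "0 < t" "t \<le> w1" "t \<le> w2" "t < len S (fst a) / 2" "t < len S (fst b) / 2"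
        using w1 w2 by (auto simp: t_def)
      have "h (from_end a t) = h (from_end b t)" using w1(3) w2(3) t ab by simp
      moreover have "from_end a t \<in> points S" "from_end b t \<in> points S"
        unfolding from_end_def using chart_in_points[OF compS] len ab by auto
      ultimately have "from_end a t = from_end b t" using inj_onD[OF inj_h] by blast
      then show ?thesis
        using from_end_Inner[of t "fst a" "snd a"] from_end_Inner[of t "fst b" "snd b"] t
        by (cases a; cases b) (auto split: if_splits)
    qed
    show ?thesis
    proof (cases "\<exists>a\<in>ends_at S v. d a = 1")
      case no: False
      then have "d a = - 1" if "a \<in> ends_at S v" for a using d[OF that] that by blast
      then show ?thesis by (intro sum_nonpos) auto
    next
      case True
      then obtain a where a: "a \<in> ends_at S v" "d a = 1" by blast
      have minus: "d b = - 1" if "b \<in> ends_at S v - {a}" for b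
        using d[of b] one[of a b] a that by auto
      \<comment> \<open>If the ascending end were the only one, \<open>v\<close> with an initial
        piece of its edge would be an open set whose image contains nothing below the height
        \<open>f0\<close>, contrary to the openness of \<open>h\<close>.\<close>
      have "ends_at S v \<noteq> {a}"
      proof
        assume only: "ends_at S v = {a}"
        obtain w where w: "0 < w" "w \<le> len S (fst a) / 2"
          "\<forall>t\<in>{0..w}. h (from_end a t) = Inner j (r - (f0 + d a * t)) \<and> lf (from_end a t) = f0 + d a * t"
          using loc[OF a(1)] by blast
        obtain e b where ab: "a = (e, b)" by (cases a)
        have e: "e \<in> edges S" "end_vertex S e b = v" "0 < len S e" using a(1) len[OF a(1)] by (auto simp: ends_at_def ab)
        define U where "U = insert (Vertex v) (from_end a ` {0<..<w})"
        have uniq: "e' = e \<and> b' = b" if "e' \<in> edges S" "end_vertex S e' b' = v" for e' b'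
          using only that unfolding ends_at_def ab by auto
        have "openin (mg_topology S) U"
          unfolding openin_mg_topology
        proof (intro conjI ballI)
          show "U \<subseteq> points S"
            using pv(1) chart_in_points[OF compS e(1)] by (auto simp: U_def from_end_def ab)
          fix e' assume e': "e' \<in> edges S"
          have U: "U = insert (Vertex v) (Inner e ` (if b then {len S e - w<..<len S e} else {0<..<w}))"
          proof -
            have "from_end a ` {0<..<w} = (\<lambda>t. Inner e (if b then len S e - t else t)) ` {0<..<w}"
              using from_end_Inner[of _ e b] w(2) e(3) by (intro image_cong) (auto simp: ab)
            also have "\<dots> = Inner e ` (if b then {len S e - w<..<len S e} else {0<..<w})"
              by (auto simp: image_iff intro!: bexI[of _ "len S e - _"])
            finally show ?thesis by (simp add: U_def)
          qed
          have sv: "src S e' = v \<longleftrightarrow> e' = e \<and> \<not> b" "tgt S e' = v \<longleftrightarrow> e' = e \<and> b"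
            using uniq[OF e', of False] uniq[OF e', of True] e(2) by (auto simp: end_vertex_def split: if_splits)
          have "{t \<in> {0..len S e'}. chart S e' t \<in> U} =
             (if e' = e then {0..len S e'} \<inter> (if b then {len S e - w<..} else {..<w}) else {})"
            using sv w(1) w(2)[unfolded ab fst_conv] e(3) compS e' unfolding U by (auto simp: chart_def compact_metric_graph_def)
          then show "openin (top_of_set {0..len S e'}) {t \<in> {0..len S e'}. chart S e' t \<in> U}"
            by (auto intro!: openin_open_Int)
        qed
        then have "openin (mg_topology X) (h ` U)" by (rule h_open)
        then have "openin (top_of_set {0..r}) {t \<in> {0..r}. chart X j t \<in> h ` U}"
          using j(1) unfolding openin_mg_topology by auto
        moreover have "r - f0 \<in> {t \<in> {0..r}. chart X j t \<in> h ` U}"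
          using j by (auto simp: U_def chart_def intro!: image_eqI[of _ h "Vertex v"])
        ultimately obtain u where u: "0 < u" "ball (r - f0) u \<inter> {0..r} \<subseteq> {t \<in> {0..r}. chart X j t \<in> h ` U}"
          unfolding openin_contains_ball by blast
        define y where "y = min u f0 / 2"
        have y: "0 < y" "y < u" "y < f0" using u j by (auto simp: y_def)
        have "r - f0 + y \<in> ball (r - f0) u \<inter> {0..r}" using y j by (auto simp: dist_real_def)
        then have "chart X j (r - f0 + y) \<in> h ` U" using u(2) by blast
        moreover have "chart X j (r - f0 + y) = Inner j (r - (f0 - y))" using y j by (auto simp: chart_def)
        ultimately obtain p where p: "p \<in> U" "h p = Inner j (r - (f0 - y))" by auto
        then have "lf p = f0 - y" by (simp add: lf_def)
        moreover have "f0 \<le> lf p" using p(1) w(3) a(2) by (auto simp: U_def f0_def)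
        ultimately show False using y by simp
      qed
      then obtain b where b: "b \<in> ends_at S v - {a}" using a by blast
      have "(\<Sum>x\<in>ends_at S v. d x) = d a + (\<Sum>x\<in>ends_at S v - {a}. d x)"
        using sum.remove[OF fin a(1)] .
      also have "(\<Sum>x\<in>ends_at S v - {a}. d x) = - real (card (ends_at S v - {a}))"
        using minus by simp
      finally have "(\<Sum>x\<in>ends_at S v. d x) = 1 - real (card (ends_at S v - {a}))" using a(2) by simp
      moreover have "0 < card (ends_at S v - {a})" using b fin by (auto simp: card_gt_0_iff)
      ultimately show ?thesis by simp
    qed
  qed
qed

end

section \<open>Wronskian comparison on a star\<close>

lemma free_vertex_has_end:
  fixes G :: "('v, 'e) metric_graph"
  assumes comp: "compact_metric_graph G" and conn: "connected_graph (separate_dirichlet G)"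
    and E: "edges G \<noteq> {}" and v: "v \<in> verts G - dirichlet G"
  shows "ends_at G v \<noteq> {}"
proof
  assume none: "ends_at G v = {}"
  let ?S = "separate_dirichlet G"
  have "({Inl v :: 'v + 'e \<times> bool} = {} \<and> ({} :: 'e set) = {}) \<or> ({Inl v} = verts ?S \<and> {} = edges ?S)"
  proof (rule connected_graph_clopen[OF conn compact_separate[OF comp]])
    show "{Inl v} \<subseteq> verts ?S" using v by (auto simp: separate_dirichlet_def)
    show "e \<in> {} \<longleftrightarrow> end_vertex ?S e b \<in> {Inl v}" if "e \<in> edges ?S" for e b
      using none that by (auto simp: separate_end separate_vertex_def ends_at_def)
  qed simp
  then show False using E by auto
qed

text \<open>The two boundary terms of the Wronskian on an edge of length \<open>l\<close>, for an
  arch with the phases \<open>p\<close>, \<open>p'\<close> and for \<open>sin (k * d)\<close>, where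
  the distance is \<open>x\<close> and \<open>y\<close> at the ends. If the distance has constant
  slope, both functions solve the same equation and the terms cancel. If it peaks at
  \<open>c\<close>, the kink of \<open>sin (k * d)\<close> leaves the slope jump
  \<open>2 * cos (k * r)\<close> times the value \<open>sin (k * c + p)\<close> of the arch.\<close>

lemma wronskian_sum:
  fixes A k x y l p p' d r c :: real
  assumes p': "p + p' + k * l = pi"
  shows "d = 1 \<or> d = - 1 \<Longrightarrow> y = x + d * l \<Longrightarrow>
     sin (k * x) * cos p - sin p * d * cos (k * x) + (sin (k * y) * cos p' - sin p' * (- d) * cos (k * y)) = 0"
    "x = r - c \<Longrightarrow> y = r - (l - c) \<Longrightarrow>
     sin (k * x) * cos p - sin p * 1 * cos (k * x) + (sin (k * y) * cos p' - sin p' * 1 * cos (k * y)) =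
       - 2 * cos (k * r) * sin (k * c + p)"
proof -
  have pp: "p' = pi - (p + k * l)" using p' by simp
  have sc: "sin p' = sin (p + k * l)" "cos p' = - cos (p + k * l)"
    unfolding pp by (rule sin_pi_minus, rule cos_pi_minus)
  assume d: "d = 1 \<or> d = - 1" "y = x + d * l"
  show "sin (k * x) * cos p - sin p * d * cos (k * x) + (sin (k * y) * cos p' - sin p' * (- d) * cos (k * y)) = 0"
    using d(1)
  proof
    assume d1: "d = 1"
    have "sin (k * x) * cos p - sin p * cos (k * x) = sin (k * x - p)" by (simp add: sin_diff)
    moreover have "sin (k * y) * cos p' + sin p' * cos (k * y) = sin ((p + k * l) - k * y)"
      unfolding sc sin_diff by simp
    moreover have "(p + k * l) - k * y = - (k * x - p)" using d(2) d1 by (simp add: algebra_simps)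
    ultimately show ?thesis using d1 sin_minus[of "k * x - p"] by simp
  next
    assume d1: "d = - 1"
    have "sin (k * x) * cos p + sin p * cos (k * x) = sin (k * x + p)" by (simp add: sin_add)
    moreover have "sin (k * y) * cos p' - sin p' * cos (k * y) = - sin ((p + k * l) + k * y)"
      unfolding sc sin_add by simp
    moreover have "(p + k * l) + k * y = k * x + p"
    proof -
      have "l + y = x" using d(2) d1 by simp
      then have "k * l + k * y = k * x" by (metis distrib_left)
      then show ?thesis by simp
    qed
    ultimately show ?thesis using d1 by simp
  qed
next
  have pp: "p' = pi - (p + k * l)" using p' by simp
  assume xy: "x = r - c" "y = r - (l - c)"
  have "sin (k * x) * cos p - sin p * cos (k * x) = sin (k * x - p)" by (simp add: sin_diff)
  moreover have "k * x - p = k * r - (k * c + p)" unfolding xy(1) by (simp add: algebra_simps)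
  moreover have "sin (k * y) * cos p' - sin p' * cos (k * y) = sin (k * y - p')" by (simp add: sin_diff)
  moreover have "k * y - p' = (k * r + (k * c + p)) - pi" unfolding xy(2) pp by (simp add: algebra_simps)
  moreover have "sin ((k * r + (k * c + p)) - pi) = - sin (k * r + (k * c + p))" by (rule sin_minus_pi)
  ultimately show "sin (k * x) * cos p - sin p * 1 * cos (k * x) + (sin (k * y) * cos p' - sin p' * 1 * cos (k * y)) =
       - 2 * cos (k * r) * sin (k * c + p)"
    by (simp add: sin_diff[of "k * r"] sin_add[of "k * r"])
qed

text \<open>One sum is grouped in two ways: by edges it is \<open>\<le> 0\<close>, by vertices it is
  \<open>\<ge> 0\<close>, since \<open>k * r < pi / 2\<close> keeps the cosines positive. The centre
  of the star makes one of them strict: the edge sum if it lies inside an edge, the vertex sum if it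
  is a vertex.\<close>

lemma star_frequency:
  fixes G :: "('v, 'e) metric_graph"
  assumes pd: "phase_data G k F A ph" and comp: "compact_metric_graph G"
    and conn: "connected_graph (separate_dirichlet G)" and r: "0 < r"
    and same: "same_metric_graph (separate_dirichlet G) (equilateral_star n r)"
  shows "pi / 2 \<le> k * r"
proof (rule ccontr)
  assume "\<not> pi / 2 \<le> k * r"
  then have kr: "k * r < pi / 2" by simp
  let ?S = "separate_dirichlet G"
  have F: "F = edges G" and k: "0 < k"
    using separated_edges_connected[OF comp conn] pd by (auto simp: phase_data_def)
  have E: "edges G \<noteq> {}" using pd F by (simp add: phase_data_def)
  obtain h where h: "homeomorphic_map (mg_topology ?S) (mg_topology (equilateral_star n r)) h"
    "\<And>U. openin (mg_topology ?S) U \<Longrightarrow> total_length (equilateral_star n r) (h ` U) = total_length ?S U"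
    "h ` Vertex ` dirichlet ?S = Vertex ` dirichlet (equilateral_star n r)"
    using same unfolding same_metric_graph_def by blast
  interpret star_map ?S n r h
  proof
    show "compact_metric_graph ?S" by (rule compact_separate[OF comp])
    show "dirichlet ?S \<subseteq> verts ?S" by (auto simp: separate_dirichlet_def)
  qed (use h r in auto)
  have "\<forall>e. \<exists>d. e \<in> edges G \<longrightarrow> (\<forall>b. (d b = 1 \<or> d b = - 1) \<and>
      (\<exists>w>0. w \<le> len G e / 2 \<and> (\<forall>t\<in>{0..w}. lf (from_end (e, b) t) = lf (from_end (e, b) 0) + d b * t))) \<and>
    ((\<forall>t\<in>{0<..<len G e}. h (Inner e t) \<noteq> Vertex 0) \<and> d True = - d False \<and>
        lf (from_end (e, True) 0) = lf (from_end (e, False) 0) + d False * len G e \<or>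
     (\<exists>c\<in>{0<..<len G e}. h (Inner e c) = Vertex 0 \<and> d True = 1 \<and> d False = 1 \<and>
        lf (from_end (e, False) 0) = r - c \<and> lf (from_end (e, True) 0) = r - (len G e - c)))"
    using edge_slopes by (simp del: ball_simps)
  then obtain d where "\<forall>e. e \<in> edges G \<longrightarrow> (\<forall>b. (d e b = 1 \<or> d e b = - 1) \<and>
      (\<exists>w>0. w \<le> len G e / 2 \<and> (\<forall>t\<in>{0..w}. lf (from_end (e, b) t) = lf (from_end (e, b) 0) + d e b * t))) \<and>
    ((\<forall>t\<in>{0<..<len G e}. h (Inner e t) \<noteq> Vertex 0) \<and> d e True = - d e False \<and>
        lf (from_end (e, True) 0) = lf (from_end (e, False) 0) + d e False * len G e \<or>
     (\<exists>c\<in>{0<..<len G e}. h (Inner e c) = Vertex 0 \<and> d e True = 1 \<and> d e False = 1 \<and>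
        lf (from_end (e, False) 0) = r - c \<and> lf (from_end (e, True) 0) = r - (len G e - c)))"
    by (rule choice[THEN exE])
  then have d1: "d e b = 1 \<or> d e b = - 1"
      "\<exists>w>0. w \<le> len G e / 2 \<and> (\<forall>t\<in>{0..w}. lf (from_end (e, b) t) = lf (from_end (e, b) 0) + d e b * t)"
    and d2: "(\<forall>t\<in>{0<..<len G e}. h (Inner e t) \<noteq> Vertex 0) \<and> d e True = - d e False \<and>
        lf (from_end (e, True) 0) = lf (from_end (e, False) 0) + d e False * len G e \<or>
     (\<exists>c\<in>{0<..<len G e}. h (Inner e c) = Vertex 0 \<and> d e True = 1 \<and> d e False = 1 \<and>
        lf (from_end (e, False) 0) = r - c \<and> lf (from_end (e, True) 0) = r - (len G e - c))"
    if "e \<in> edges G" for e b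
    using that by blast+
  define fv where "fv = (\<lambda>a. lf (from_end a 0))"
  \<comment> \<open>The Wronskian of the eigenfunction and \<open>sin (k * lf)\<close> at an edge
    end, with derivatives pointing inwards and divided by \<open>k\<close>.\<close>
  define W where "W = (\<lambda>a. A (fst a) * (sin (k * fv a) * cos (ph a) - sin (ph a) * d (fst a) (snd a) * cos (k * fv a)))"
  have pde: "0 < A e" "0 \<le> ph (e, False)" "0 \<le> ph (e, True)" "ph (e, False) + ph (e, True) + k * len G e = pi"
    if "e \<in> edges G" for e
    using pd that F by (auto simp: phase_data_def)
  have len: "0 < len G e" if "e \<in> edges G" for e
    using comp that by (auto simp: compact_metric_graph_def)
  have cr: "0 < cos (k * r)"
  proof (rule cos_gt_zero_pi)
    have "0 < k * r" using k r by simp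
    then show "- (pi / 2) < k * r" using pi_gt_zero by linarith
  qed (rule kr)
  have centre: "W (e, False) + W (e, True) < 0" if e: "e \<in> edges G" and c: "c \<in> {0<..<len G e}" "h (Inner e c) = Vertex 0" for e c
  proof -
    obtain c' where c': "c' \<in> {0<..<len G e}" "d e True = 1" "d e False = 1"
        "fv (e, False) = r - c'" "fv (e, True) = r - (len G e - c')"
      using d2[OF e] c unfolding fv_def by blast
    have "W (e, False) + W (e, True) = A e * (- 2 * cos (k * r) * sin (k * c' + ph (e, False)))"
      unfolding wronskian_sum(2)[OF pde(4)[OF e] c'(4,5), symmetric] W_def
      by (simp add: c'(2,3) algebra_simps)
    moreover have "0 < sin (k * c' + ph (e, False))"
    proof (rule sin_gt_zero)
      have "0 < k * c'" "k * c' < k * len G e" using c'(1) k by auto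
      then show "0 < k * c' + ph (e, False)" "k * c' + ph (e, False) < pi"
        using pde[OF e] by linarith+
    qed
    ultimately show ?thesis using cr pde(1)[OF e] by (simp add: mult_pos_pos)
  qed
  have edge_sum: "W (e, False) + W (e, True) \<le> 0" if e: "e \<in> edges G" for e
  proof (cases "\<exists>c\<in>{0<..<len G e}. h (Inner e c) = Vertex 0")
    case True
    then show ?thesis using centre[OF e] by force
  next
    case False
    then have d: "d e True = - d e False" "fv (e, True) = fv (e, False) + d e False * len G e"
      using d2[OF e] unfolding fv_def by blast+
    have "W (e, False) + W (e, True) = A e * 0"
      unfolding wronskian_sum(1)[OF pde(4)[OF e] d1(1)[OF e, of False] d(2), symmetric] W_def
      by (simp add: d(1) algebra_simps)
    then show ?thesis by simp
  qed
  \<comment> \<open>The part with \<open>sin (k * lf)\<close> drops out by Kirchhoff's condition; in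
    the rest the common vertex value \<open>c\<close> factors out and leaves the sum of the
    slopes.\<close>
  have vert_eq: "(\<Sum>a\<in>ends_at G v. W a) = - c * cos (k * lf (Vertex (Inl v))) * (\<Sum>a\<in>ends_at G v. d (fst a) (snd a))"
    if v: "v \<in> verts G - dirichlet G" and c: "\<forall>a\<in>ends_at G v. A (fst a) * sin (ph a) = c" for v c
  proof -
    have "fv a = lf (Vertex (Inl v))" if a: "a \<in> ends_at G v" for a
      using a v from_end_zero[of "fst a" "snd a"] by (auto simp: fv_def ends_at_def separate_end separate_vertex_def)
    then have "(\<Sum>a\<in>ends_at G v. W a) = (\<Sum>a\<in>ends_at G v. sin (k * lf (Vertex (Inl v))) * (A (fst a) * cos (ph a))
        + - c * cos (k * lf (Vertex (Inl v))) * d (fst a) (snd a))"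
      using c by (intro sum.cong) (auto simp: W_def algebra_simps)
    also have "\<dots> = sin (k * lf (Vertex (Inl v))) * (\<Sum>a\<in>ends_at G v. A (fst a) * cos (ph a)) +
        - c * cos (k * lf (Vertex (Inl v))) * (\<Sum>a\<in>ends_at G v. d (fst a) (snd a))"
      by (simp only: sum.distrib sum_distrib_left)
    also have "(\<Sum>a\<in>ends_at G v. A (fst a) * cos (ph a)) = 0"
    proof -
      have "ends_at G v \<subseteq> F \<times> UNIV" using F by (auto simp: ends_at_def)
      then show ?thesis using pd v unfolding phase_data_def by blast
    qed
    finally show ?thesis by simp
  qed
  have ends_S: "ends_at ?S (Inl v) = ends_at G v" if "v \<notin> dirichlet G" for v
    using that by (auto simp: ends_at_def separate_end separate_vertex_def)
  have free: "Inl v \<in> verts ?S" "Inl v \<notin> dirichlet ?S" if "v \<in> verts G - dirichlet G" for v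
    using that by (auto simp: separate_dirichlet_def)
  have slopes: "(d (fst a) (snd a) = 1 \<or> d (fst a) (snd a) = - 1) \<and>
      (\<exists>w>0. w \<le> len ?S (fst a) / 2 \<and> (\<forall>t\<in>{0..w}. lf (from_end a t) = lf (from_end a 0) + d (fst a) (snd a) * t))"
    if "a \<in> ends_at ?S x" for a x
    using that d1[of "fst a" "snd a"] by (auto simp: ends_at_def)
  have cpos: "\<exists>c>0. \<forall>a\<in>ends_at G v. A (fst a) * sin (ph a) = c" if v: "v \<in> verts G - dirichlet G" for v
  proof -
    have "ends_at G v \<subseteq> F \<times> UNIV" using F by (auto simp: ends_at_def)
    then show ?thesis using pd v unfolding phase_data_def by blast
  qed
  have cosv: "0 < cos (k * lf (Vertex (Inl v)))" if v: "v \<in> verts G - dirichlet G" for v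
  proof -
    have "Vertex (Inl v) \<in> points ?S" using free[OF v] by (auto simp: points_def)
    then have "0 \<le> lf (Vertex (Inl v))" "lf (Vertex (Inl v)) \<le> r" using lf_le by blast+
    then have "0 \<le> k * lf (Vertex (Inl v))" "k * lf (Vertex (Inl v)) \<le> k * r" using k by auto
    then show ?thesis using kr pi_gt_zero by (intro cos_gt_zero_pi) linarith+
  qed
  have vert_sum: "0 \<le> (\<Sum>a\<in>ends_at G v. W a)" if v: "v \<in> verts G" for v
  proof (cases "v \<in> dirichlet G")
    case True
    have "W a = 0" if a: "a \<in> ends_at G v" for a
    proof -
      have "ph a = 0" using pd True a F unfolding phase_data_def by (auto simp: ends_at_def)
      moreover have "a = (fst a, snd a)" "fst a \<in> edges G" "end_vertex G (fst a) (snd a) = v"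
        using a by (auto simp: ends_at_def)
      then have "from_end a 0 = Vertex (Inr a)"
        using from_end_zero[of "fst a" "snd a"] True by (simp add: separate_end separate_vertex_def)
      moreover have "Inr a \<in> dirichlet ?S" using True a by (auto simp: separate_dirichlet_def)
      ultimately show ?thesis using lf_dirichlet by (simp add: W_def fv_def)
    qed
    then show ?thesis by simp
  next
    case False
    then have v': "v \<in> verts G - dirichlet G" using v by simp
    obtain c where c: "0 < c" "\<forall>a\<in>ends_at G v. A (fst a) * sin (ph a) = c" using cpos[OF v'] by blast
    have "(\<Sum>a\<in>ends_at ?S (Inl v). d (fst a) (snd a)) \<le> 0"
      by (rule vertex_slopes(1)[OF free[OF v'] slopes])
    then show ?thesis
      unfolding vert_eq[OF v' c(2)] ends_S[OF False] using c(1) cosv[OF v']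
      by (simp add: mult_nonneg_nonpos)
  qed
  have total: "(\<Sum>v\<in>verts G. \<Sum>a\<in>ends_at G v. W a) = (\<Sum>e\<in>edges G. W (e, False) + W (e, True))"
    by (rule sum_edge_ends[OF comp])
  have fin: "finite (verts G)" "finite (edges G)" using comp by (auto simp: compact_metric_graph_def)
  obtain q where q: "q \<in> points ?S" "h q = Vertex 0"
  proof -
    have "Vertex 0 \<in> points X" by (simp add: points_def)
    then have "Vertex 0 \<in> h ` points ?S" unfolding h_points .
    then show ?thesis using that by (metis imageE)
  qed
  show False
  proof (cases q)
    case (Inner e c)
    then have e: "e \<in> edges G" "c \<in> {0<..<len G e}" using q(1) by (auto simp: points_def)
    have "(\<Sum>e\<in>edges G. W (e, False) + W (e, True)) < (\<Sum>e\<in>edges G. 0)"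
      by (rule sum_strict_mono_ex1[OF fin(2)])
        (use edge_sum centre[OF e] q(2) Inner e in auto)
    moreover have "0 \<le> (\<Sum>v\<in>verts G. \<Sum>a\<in>ends_at G v. W a)" by (rule sum_nonneg) (rule vert_sum)
    ultimately show False using total by simp
  next
    case (Vertex x)
    have "x \<notin> dirichlet ?S"
    proof
      assume "x \<in> dirichlet ?S"
      then have "h q \<in> Vertex ` {1..n}" using dir_h Vertex by blast
      then show False using q(2) by auto
    qed
    then obtain v where v: "x = Inl v" "v \<in> verts G - dirichlet G"
      using q(1) Vertex by (auto simp: points_def separate_dirichlet_def)
    obtain c where c: "0 < c" "\<forall>a\<in>ends_at G v. A (fst a) * sin (ph a) = c" using cpos[OF v(2)] by blast
    have "d (fst a) (snd a) = - 1" if "a \<in> ends_at G v" for a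
      by (rule vertex_slopes(2)[where d = "\<lambda>a. d (fst a) (snd a)", OF free[OF v(2)] slopes[where x = "Inl v"]])
        (use that q(2) Vertex v ends_S in auto)
    then have "(\<Sum>a\<in>ends_at G v. d (fst a) (snd a)) = - real (card (ends_at G v))" by simp
    moreover have "0 < card (ends_at G v)"
      using free_vertex_has_end[OF comp conn E v(2)] ends_at_finite[OF comp] by (simp add: card_gt_0_iff)
    ultimately have "0 < (\<Sum>a\<in>ends_at G v. W a)"
      unfolding vert_eq[OF v(2) c(2)] using c(1) cosv[OF v(2)] by simp
    then have "0 < (\<Sum>v\<in>verts G. \<Sum>a\<in>ends_at G v. W a)"
      using vert_sum v(2) fin(1) by (intro sum_pos2[of _ v]) auto
    moreover have "(\<Sum>e\<in>edges G. W (e, False) + W (e, True)) \<le> 0" by (rule sum_nonpos) (rule edge_sum)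
    ultimately show False using total by simp
  qed
qed

lemma equality_if_star:
  fixes G :: "('v, 'e) metric_graph"
  assumes comp: "compact_metric_graph G" and conn: "connected_graph G" and D: "dirichlet G \<noteq> {}"
    and s: "girth G \<noteq> 0" and connS: "connected_graph (separate_dirichlet G)"
    and star: "is_equilateral_dirichlet_star G n (girth G / 2)"
  shows "lambda1 G = pi\<^sup>2 / (girth G)\<^sup>2"
proof -
  have g: "0 < girth G" and same: "same_metric_graph (separate_dirichlet G) (equilateral_star n (girth G / 2))"
    using star by (auto simp: is_equilateral_dirichlet_star_def)
  obtain e0 where e0: "e0 \<in> edges G"
  proof (rule girth_frequency[OF comp conn D s])
    fix k F A ph assume "phase_data G k F A ph"
    then show thesis using that by (auto simp: phase_data_def separated_edges_def)
  qed
  obtain k F A ph where pd: "phase_data G k F A ph" "F = edges G \<longrightarrow> lambda1 G = k\<^sup>2"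
    using lambda1_phase_data[OF conn comp D e0] by metis
  have "F = edges G" using separated_edges_connected[OF comp connS] pd(1) by (auto simp: phase_data_def)
  then have l: "lambda1 G = k\<^sup>2" using pd(2) by simp
  \<comment> \<open>This is the lower bound for \<open>lambda1 G\<close>; the upper one holds for
    every graph of nonzero girth.\<close>
  have "pi / 2 \<le> k * (girth G / 2)"
    by (rule star_frequency[OF pd(1) comp connS _ same]) (use g in simp)
  then have "pi / girth G \<le> k" using g by (simp add: field_simps)
  then have "(pi / girth G)\<^sup>2 \<le> k\<^sup>2" using g by (intro power_mono) auto
  then show ?thesis using lambda1_le[OF comp conn D s] l by (simp add: power_divide)
qed

theorem theorem1p3:
  fixes G :: "('v, 'e) metric_graph" and s :: real
  assumes "compact_metric_graph G"
    and "connected_graph G"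
    and "dirichlet G \<noteq> {}"
    and "s = girth G"
  shows "ereal (lambda1 G) \<le> (if s = 0 then \<infinity> else ereal (pi\<^sup>2 / s\<^sup>2)) \<and>
    (connected_graph (separate_dirichlet G) \<longrightarrow>
      (ereal (lambda1 G) = (if s = 0 then \<infinity> else ereal (pi\<^sup>2 / s\<^sup>2)) \<longleftrightarrow>
        (\<exists>n\<ge>2. is_equilateral_dirichlet_star G n (s / 2))))"
proof (cases "girth G = 0")
  case True
  \<comment> \<open>For girth \<open>0\<close> both sides of the equivalence are false: a real
    number is not \<open>\<infinity>\<close>, and a star needs edges of positive length.\<close>
  then show ?thesis
    using assms(4) by (simp add: is_equilateral_dirichlet_star_def)
next
  case False
  have "lambda1 G \<le> pi\<^sup>2 / s\<^sup>2"
    using lambda1_le[OF assms(1-3) False] assms(4) by simp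
  moreover have "lambda1 G = pi\<^sup>2 / s\<^sup>2 \<longleftrightarrow> (\<exists>n\<ge>2. is_equilateral_dirichlet_star G n (s / 2))"
    if "connected_graph (separate_dirichlet G)"
    unfolding assms(4)
    using star_if_equality[OF assms(1-3) False that] equality_if_star[OF assms(1-3) False that] by blast
  ultimately show ?thesis using False assms(4) by simp
qed

end
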